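(* Let $\Sigma$ be a finitely primitive Markov shift with alphabet $I\subset\mathbb{N}$ and left shift $\sigma$, let $G$ be a countable group, let $\Psi:I^{*}\to G$ be a semigroup homomorphism, and suppose that the group-extended Markov system $(\Sigma\times G,\sigma\rtimes\Psi)$ is topologically mixing. Let $\varphi:\Sigma\to\mathbb{R}$ be Hölder continuous with $\mathcal{P}(\varphi\circ\pi_1,\sigma\rtimes\Psi)<\infty$. Then the following hold. (1) If $\varphi\circ\pi_1$ is recurrent, then $G$ is amenable. (2) The following are equivalent: (a) $\varphi\circ\pi_1$ is positive recurrent; (b) $G$ is finite; (c) $(\Sigma\times G,\sigma\rtimes\Psi)$ is finitely primitive.
   Context: Markov shifts. For an at most countable alphabet $I$ and a matrix $A=(a(i,j))\in\{0,1\}^{I\times I}$, the Markov shift is $\Sigma=\{\omega\in I^{\mathbb{N}}: a(\omega_i,\omega_{i+1})=1\ \forall i\}$ with left shift $\sigma$; $\Sigma^n$ is the set of admissible words of length $n$ (words $\omega\in I^n$ with $a(\omega_i,\omega_{i+1})=1$ for $1\le i<n$) and $\Sigma^*=\bigcup_{n\ge1}\Sigma^n$. $I^*$ is the free semigroup on $I$ (finite non-empty words under concatenation). $\Sigma$ is topologically mixing if for all $i,j\in I$ there is $n_0$ such that for every $n\ge n_0$ there is $\omega\in\Sigma^n$ with $i\omega j\in\Sigma^*$. $\Sigma$ is finitely primitive if there are $l\in\mathbb{N}$ and a finite set $\Lambda\subset\Sigma^l$ such that for all $i,j\in I$ there is $\omega\in\Lambda$ with $i\omega j\in\Sigma^*$.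 Hölder continuity. $f:\Sigma\to\mathbb{R}$ is Hölder continuous if for some $\alpha>0$ there is a finite constant $V$ with $|f(\omega)-f(\tau)|\le V e^{-\alpha|\omega\wedge\tau|}$ for all $\omega,\tau\in\Sigma$ with $\omega_1=\tau_1$, where $|\omega\wedge\tau|$ is the length of the longest common initial block. $S_nf=\sum_{k=0}^{n-1}f\circ\sigma^k$. Group extension. $\sigma\rtimes\Psi:\Sigma\times G\to\Sigma\times G$, $(\sigma\rtimes\Psi)(\omega,g)=(\sigma\omega,g\Psi(\omega_1))$. It is identified with the Markov shift with alphabet $I\times G$ and state space $\{((\omega_j,g_j))_j\in(I\times G)^{\mathbb{N}}:\omega\in\Sigma,\ g_j\Psi(\omega_j)=g_{j+1}\ \forall j\}$; topological mixing, finite primitivity, pressure and (positive) recurrence for $\Sigma\times G$ refer to this Markov shift. $\pi_1:\Sigma\times G\to\Sigma$ is the projection. Gurevich pressure and recurrence. For an irreducible Markov shift $(\Sigma,\sigma)$ (for all $i,j\in I$ there is $\omega\in\Sigma^*$ with $i\omega j\in\Sigma^*$) with alphabet $I$, Hölder continuous $f$ and $a\in I$, let $Z_n(f,a,\sigma)=\sum_{x\in\Sigma,\,x_1=a,\,\sigma^nx=x}e^{S_nf(x)}$, $Z_n^*(f,a,\sigma)=\sum_{x\in\Sigma,\,x_1=a,\,\sigma^nx=x,\,x_2,\dots,x_n\ne a}e^{S_nf(x)}$, and $\mathcal{P}(f,\sigma)=\limsup_{n}\frac1n\log Z_n(f,a,\sigma)$ (independent of $a$). If $\mathcal{P}(f,\sigma)<\infty$,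 $f$ is recurrent if $\sum_{n}e^{-n\mathcal{P}(f,\sigma)}Z_n(f,a,\sigma)=\infty$ for some (hence all) $a\in I$; a recurrent $f$ is positive recurrent if $\sum_n n\,e^{-n\mathcal{P}(f,\sigma)}Z_n^*(f,a,\sigma)<\infty$ for some (hence all) $a\in I$. A discrete group $G$ is amenable if there is a finitely additive probability measure $m$ on the power set of $G$ with $m(gA)=m(A)$ for all $g\in G$, $A\subset G$. *)

theory Defs
  imports "HOL-Analysis.Analysis" "HOL-Algebra.Coset"
begin

section \<open>Markov shifts\<close>

text \<open>A Markov shift is given by an alphabet \<open>I\<close> and a transition matrix
  \<open>A :: 'a \<Rightarrow> 'a \<Rightarrow> bool\<close>; the 0-1 entry \<open>a(i,j)\<close> is read as a truth value, and only its values on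
  \<open>I \<times> I\<close> matter. Sequences are indexed from 0, so the first letter of \<open>\<omega>\<close> is \<open>\<omega> 0\<close>.\<close>

definition shift_space :: "'a set \<Rightarrow> ('a \<Rightarrow> 'a \<Rightarrow> bool) \<Rightarrow> (nat \<Rightarrow> 'a) set" where
  "shift_space I A = {\<omega>. \<forall>k. \<omega> k \<in> I \<and> A (\<omega> k) (\<omega> (Suc k))}"

definition left_shift :: "(nat \<Rightarrow> 'a) \<Rightarrow> nat \<Rightarrow> 'a" where
  "left_shift \<omega> = (\<lambda>k. \<omega> (Suc k))"

definition words :: "'a set \<Rightarrow> ('a \<Rightarrow> 'a \<Rightarrow> bool) \<Rightarrow> nat \<Rightarrow> 'a list set" where
  "words I A n = {w. length w = n \<and> set w \<subseteq> I \<and> successively A w}"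

definition all_words :: "'a set \<Rightarrow> ('a \<Rightarrow> 'a \<Rightarrow> bool) \<Rightarrow> 'a list set" where
  "all_words I A = (\<Union>n\<in>{1..}. words I A n)"

definition topologically_mixing :: "'a set \<Rightarrow> ('a \<Rightarrow> 'a \<Rightarrow> bool) \<Rightarrow> bool" where
  "topologically_mixing I A \<longleftrightarrow>
     (\<forall>i\<in>I. \<forall>j\<in>I. \<exists>n0. \<forall>n\<ge>n0. \<exists>w\<in>words I A n. i # w @ [j] \<in> all_words I A)"

definition finitely_primitive :: "'a set \<Rightarrow> ('a \<Rightarrow> 'a \<Rightarrow> bool) \<Rightarrow> bool" where
  "finitely_primitive I A \<longleftrightarrow>
     (\<exists>l\<ge>1. \<exists>\<Lambda>. finite \<Lambda> \<and> \<Lambda> \<subseteq> words I A l \<and>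
        (\<forall>i\<in>I. \<forall>j\<in>I. \<exists>w\<in>\<Lambda>. i # w @ [j] \<in> all_words I A))"

section \<open>Hoelder continuous potentials\<close>

text \<open>The length of the longest common initial block of two \<^emph>\<open>distinct\<close> sequences.\<close>

definition common_length :: "(nat \<Rightarrow> 'a) \<Rightarrow> (nat \<Rightarrow> 'a) \<Rightarrow> nat" where
  "common_length \<omega> \<tau> = (LEAST k. \<omega> k \<noteq> \<tau> k)"

text \<open>For \<open>\<omega> = \<tau>\<close> the common length is infinite and the Hoelder inequality reads \<open>0 \<le> 0\<close>,
  so it is only required for \<open>\<omega> \<noteq> \<tau>\<close>.\<close>

definition hoelder_continuous ::
    "'a set \<Rightarrow> ('a \<Rightarrow> 'a \<Rightarrow> bool) \<Rightarrow> ((nat \<Rightarrow> 'a) \<Rightarrow> real) \<Rightarrow> bool" where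
  "hoelder_continuous I A f \<longleftrightarrow>
     (\<exists>\<alpha>>0. \<exists>V. \<forall>\<omega>\<in>shift_space I A. \<forall>\<tau>\<in>shift_space I A. \<omega> 0 = \<tau> 0 \<and> \<omega> \<noteq> \<tau> \<longrightarrow>
        \<bar>f \<omega> - f \<tau>\<bar> \<le> V * exp (- \<alpha> * real (common_length \<omega> \<tau>)))"

definition birkhoff_sum :: "nat \<Rightarrow> ((nat \<Rightarrow> 'a) \<Rightarrow> real) \<Rightarrow> (nat \<Rightarrow> 'a) \<Rightarrow> real" where
  "birkhoff_sum n f x = (\<Sum>k<n. f ((left_shift ^^ k) x))"

section \<open>Gurevich pressure and recurrence\<close>

text \<open>The sums over periodic points may be infinite, so they are taken in \<open>[0, \<infinity>]\<close>.\<close>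

definition Z :: "'a set \<Rightarrow> ('a \<Rightarrow> 'a \<Rightarrow> bool) \<Rightarrow> ((nat \<Rightarrow> 'a) \<Rightarrow> real) \<Rightarrow> 'a \<Rightarrow> nat \<Rightarrow> ennreal" where
  "Z I A f a n =
     (\<Sum>\<^sub>\<infinity>x\<in>{x\<in>shift_space I A. x 0 = a \<and> (left_shift ^^ n) x = x}.
        ennreal (exp (birkhoff_sum n f x)))"

definition Z_star :: "'a set \<Rightarrow> ('a \<Rightarrow> 'a \<Rightarrow> bool) \<Rightarrow> ((nat \<Rightarrow> 'a) \<Rightarrow> real) \<Rightarrow> 'a \<Rightarrow> nat \<Rightarrow> ennreal" where
  "Z_star I A f a n =
     (\<Sum>\<^sub>\<infinity>x\<in>{x\<in>shift_space I A. x 0 = a \<and> (left_shift ^^ n) x = x \<and> (\<forall>k\<in>{1..<n}. x k \<noteq> a)}.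
        ennreal (exp (birkhoff_sum n f x)))"

definition ln_ennreal :: "ennreal \<Rightarrow> ereal" where
  "ln_ennreal z = (if z = 0 then - \<infinity> else if z = \<infinity> then \<infinity> else ereal (ln (enn2real z)))"

text \<open>For an irreducible Markov shift the limit superior does not depend on the base letter, which
  is therefore chosen arbitrarily.\<close>

definition gurevich_pressure ::
    "'a set \<Rightarrow> ('a \<Rightarrow> 'a \<Rightarrow> bool) \<Rightarrow> ((nat \<Rightarrow> 'a) \<Rightarrow> real) \<Rightarrow> ereal" where
  "gurevich_pressure I A f =
     limsup (\<lambda>n. ereal (1 / real n) * ln_ennreal (Z I A f (SOME a. a \<in> I) n))"

text \<open>The sums start at \<open>n = 1\<close>: every sequence is fixed by the 0-th iterate of the shift.
  The pressure of a Hoelder continuous function on an irreducible Markov shift is never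
  \<open>- \<infinity>\<close>, so once it is less than \<open>\<infinity>\<close> it is a real number and \<open>real_of_ereal\<close> loses nothing.\<close>

definition recurrent :: "'a set \<Rightarrow> ('a \<Rightarrow> 'a \<Rightarrow> bool) \<Rightarrow> ((nat \<Rightarrow> 'a) \<Rightarrow> real) \<Rightarrow> bool" where
  "recurrent I A f \<longleftrightarrow> gurevich_pressure I A f < \<infinity> \<and>
     (\<exists>a\<in>I. (\<Sum>\<^sub>\<infinity>n\<in>{1..}.
        ennreal (exp (- real n * real_of_ereal (gurevich_pressure I A f))) * Z I A f a n) = \<infinity>)"

definition positive_recurrent :: "'a set \<Rightarrow> ('a \<Rightarrow> 'a \<Rightarrow> bool) \<Rightarrow> ((nat \<Rightarrow> 'a) \<Rightarrow> real) \<Rightarrow> bool" where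
  "positive_recurrent I A f \<longleftrightarrow> recurrent I A f \<and>
     (\<exists>a\<in>I. (\<Sum>\<^sub>\<infinity>n\<in>{1..}.
        ennreal (real n * exp (- real n * real_of_ereal (gurevich_pressure I A f)))
          * Z_star I A f a n) < \<infinity>)"

section \<open>Group extensions\<close>

definition semigroup_hom :: "'a set \<Rightarrow> ('g, 'b) monoid_scheme \<Rightarrow> ('a list \<Rightarrow> 'g) set" where
  "semigroup_hom I G = {\<Psi>. \<forall>u\<in>lists I - {[]}. \<Psi> u \<in> carrier G \<and>
     (\<forall>v\<in>lists I - {[]}. \<Psi> (u @ v) = \<Psi> u \<otimes>\<^bsub>G\<^esub> \<Psi> v)}"

definition skew_product ::
    "('g, 'b) monoid_scheme \<Rightarrow> ('a list \<Rightarrow> 'g) \<Rightarrow> (nat \<Rightarrow> 'a) \<times> 'g \<Rightarrow> (nat \<Rightarrow> 'a) \<times> 'g" where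
  "skew_product G \<Psi> = (\<lambda>(\<omega>, g). (left_shift \<omega>, g \<otimes>\<^bsub>G\<^esub> \<Psi> [\<omega> 0]))"

text \<open>The skew product over \<open>\<Sigma> \<times> G\<close> is identified with the Markov shift with alphabet
  \<open>I \<times> carrier G\<close> and the following transition matrix; the lemmas below spell out the
  identification.\<close>

definition extension_matrix ::
    "('a \<Rightarrow> 'a \<Rightarrow> bool) \<Rightarrow> ('g, 'b) monoid_scheme \<Rightarrow> ('a list \<Rightarrow> 'g) \<Rightarrow> 'a \<times> 'g \<Rightarrow> 'a \<times> 'g \<Rightarrow> bool" where
  "extension_matrix A G \<Psi> = (\<lambda>(i, g) (j, h). A i j \<and> g \<otimes>\<^bsub>G\<^esub> \<Psi> [i] = h)"

definition proj1 :: "(nat \<Rightarrow> 'a \<times> 'g) \<Rightarrow> nat \<Rightarrow> 'a" where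
  "proj1 x = (\<lambda>k. fst (x k))"

lemma shift_space_extension:
  "shift_space (I \<times> carrier G) (extension_matrix A G \<Psi>) =
     {x. proj1 x \<in> shift_space I A \<and>
         (\<forall>k. snd (x k) \<in> carrier G \<and> snd (x k) \<otimes>\<^bsub>G\<^esub> \<Psi> [fst (x k)] = snd (x (Suc k)))}"
  by (auto simp: shift_space_def extension_matrix_def proj1_def mem_Times_iff case_prod_beta)

lemma extension_conjugacy:
  "(proj1 (left_shift x), snd (left_shift x 0)) = skew_product G \<Psi> (proj1 x, snd (x 0))"
  if "x \<in> shift_space (I \<times> carrier G) (extension_matrix A G \<Psi>)"
  using that by (auto simp: shift_space_extension skew_product_def proj1_def left_shift_def)

lemma extension_bij_betw:
  assumes "group G" "\<Psi> \<in> semigroup_hom I G"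
  shows "bij_betw (\<lambda>x. (proj1 x, snd (x 0)))
           (shift_space (I \<times> carrier G) (extension_matrix A G \<Psi>))
           (shift_space I A \<times> carrier G)"
proof (rule bij_betw_imageI)
  let ?X = "shift_space (I \<times> carrier G) (extension_matrix A G \<Psi>)"
  show "inj_on (\<lambda>x. (proj1 x, snd (x 0))) ?X"
  proof (rule inj_onI)
    fix x y assume x: "x \<in> ?X" and y: "y \<in> ?X" and eq: "(proj1 x, snd (x 0)) = (proj1 y, snd (y 0))"
    have f: "fst (x k) = fst (y k)" for k
      using eq by (metis Pair_inject proj1_def)
    have "snd (x k) = snd (y k)" for k
    proof (induction k)
      case (Suc k)
      have "snd (x (Suc k)) = snd (x k) \<otimes>\<^bsub>G\<^esub> \<Psi> [fst (x k)]"
        "snd (y (Suc k)) = snd (y k) \<otimes>\<^bsub>G\<^esub> \<Psi> [fst (y k)]"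
        using x y by (simp_all add: shift_space_extension)
      then show ?case using Suc f by simp
    qed (use eq in simp)
    then show "x = y" using f by (intro ext prod_eqI)
  qed
  have "(\<omega>, g) \<in> (\<lambda>x. (proj1 x, snd (x 0))) ` ?X"
    if \<omega>: "\<omega> \<in> shift_space I A" and g: "g \<in> carrier G" for \<omega> g
  proof -
    interpret group G by fact
    define h where "h = rec_nat g (\<lambda>k u. u \<otimes>\<^bsub>G\<^esub> \<Psi> [\<omega> k])"
    have h: "h 0 = g" "h (Suc k) = h k \<otimes>\<^bsub>G\<^esub> \<Psi> [\<omega> k]" for k
      by (simp_all add: h_def)
    have "[\<omega> k] \<in> lists I - {[]}" for k
      using \<omega> by (auto simp: shift_space_def)
    then have \<Psi>: "\<Psi> [\<omega> k] \<in> carrier G" for k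
      using assms(2) unfolding semigroup_hom_def by blast
    have "h k \<in> carrier G" for k
      by (induction k) (use g \<Psi> h in auto)
    then have "(\<lambda>k. (\<omega> k, h k)) \<in> ?X"
      using \<omega> h by (simp add: shift_space_extension proj1_def)
    then show ?thesis
      by (rule rev_image_eqI) (simp add: proj1_def h)
  qed
  then show "(\<lambda>x. (proj1 x, snd (x 0))) ` ?X = shift_space I A \<times> carrier G"
    using shift_space_extension by fast
qed

section \<open>Amenable groups\<close>

definition amenable :: "('g, 'b) monoid_scheme \<Rightarrow> bool" where
  "amenable G \<longleftrightarrow>
     (\<exists>m :: 'g set \<Rightarrow> real. additive (Pow (carrier G)) m \<and> m (carrier G) = 1 \<and>
        (\<forall>S\<subseteq>carrier G. 0 \<le> m S) \<and>
        (\<forall>g\<in>carrier G. \<forall>S\<subseteq>carrier G. m (g <#\<^bsub>G\<^esub> S) = m S))"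

end

theory Submission
  imports Defs
begin

text \<open>The loops at a letter \<open>i\<close>, that is, the admissible words that start with \<open>i\<close> and can be followed by
  \<open>i\<close>, form a monoid under concatenation. By bounded distortion the weight
  \<open>w u = exp (S\<^sub>n \<phi> - n P)\<close> of a loop of length \<open>n\<close>, where \<open>P\<close> is the pressure of the extension, is
  multiplicative up to a constant. As the extension is irreducible, \<open>\<Psi>\<close> maps the loops onto \<open>G\<close>, and
  the periodic points of the extension above \<open>i\<close> correspond to the loops with value 1. Everything else
  happens in this weighted monoid, as for a random walk on \<open>G\<close> whose weights are only known up to
  constants. Let \<open>G\<^sub>s(g)\<close> be the sum of \<open>w u * s^n\<close> over the loops \<open>u\<close> with value \<open>g\<close>, and let \<open>F\<^sub>s(g)\<close> be
  the part coming from first visits to \<open>g\<close>. Then \<open>G\<^sub>s(g)\<close> and \<open>G\<^sub>s(1) F\<^sub>s(g)\<close> agree up to constants, and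
  consequently \<open>F = F\<^sub>1\<close> is finite and supermultiplicative up to constants.

  Recurrence means that \<open>G\<^sub>s(1)\<close>, which is finite for \<open>s < 1\<close>, diverges for \<open>s \<rightarrow> 1\<close>. The loops with value 1
  that avoid a given \<open>k\<close> stay summable, so almost all weight passes through \<open>k\<close>, and this yields a
  lower bound for \<open>F(k) F(k\<^sup>-\<^sup>1)\<close> that does not depend on \<open>k\<close>
  (\<open>weighted_word_monoid.recurrent_F_inverse\<close>). Both halves of the theorem rest on this bound.

  Amenability: the measures \<open>M\<^sub>t\<close> on \<open>G\<close> with masses \<open>F(g) G\<^sub>t(g\<^sup>-\<^sup>1)\<close> are finite for \<open>t < 1\<close>, and for \<open>t\<close>
  close to 1 they satisfy \<open>c M\<^sub>t(S) \<le> M\<^sub>t(k S)\<close> with \<open>c > 0\<close> independent of \<open>k\<close> and \<open>S\<close>. A cluster point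
  of the normalised measures is a mean on \<open>G\<close> that is invariant up to a constant, and the supremum of
  its translates in the lattice of finitely additive measures is an invariant mean
  (\<open>group.amenable_of_quasi_invariant_mean\<close>). Working up to constants in this way replaces conformal
  measures and eigenfunctions.

  Finiteness: the first returns to 1 in the loop monoid correspond to the first returns of the
  extension, and cutting a first return at all its positions shows that each \<open>g \<noteq> 1\<close> contributes at
  least a fixed amount to its mean length. If the mean length is finite, so is \<open>G\<close>
  (\<open>weighted_word_monoid.finite_if_positive_recurrent\<close>).

  Conversely, if \<open>G\<close> is finite, then mixing and finite primitivity of the base make the extension
  finitely primitive, and every Hoelder continuous potential of finite pressure on a finitely
  primitive shift is positive recurrent
  (\<open>markov_potential.finitely_primitive_positive_recurrent\<close>), because words that avoid a given letter
  are exponentially rare. Finite primitivity of the extension forces \<open>G\<close> to be finite, since a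
  connecting word behind \<open>(i, g)\<close> determines \<open>g\<close>.\<close>


section \<open>Unordered sums of extended nonnegative reals\<close>

lemma infsum_ennreal_SUP:
  fixes f :: "'a \<Rightarrow> ennreal"
  shows "infsum f S = (SUP F\<in>{F. finite F \<and> F \<subseteq> S}. sum f F)"
  by (rule nonneg_infsum_complete) simp

lemma infsum_ennreal_least:
  fixes f :: "'a \<Rightarrow> ennreal"
  assumes "\<And>F. finite F \<Longrightarrow> F \<subseteq> S \<Longrightarrow> sum f F \<le> c"
  shows "infsum f S \<le> c"
  unfolding infsum_ennreal_SUP by (rule SUP_least) (use assms in auto)

lemma sum_le_infsum_ennreal:
  fixes f :: "'a \<Rightarrow> ennreal"
  assumes "finite F" "F \<subseteq> S"
  shows "sum f F \<le> infsum f S"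
  unfolding infsum_ennreal_SUP by (rule SUP_upper) (use assms in auto)

lemma infsum_ennreal_mono:
  fixes f g :: "'a \<Rightarrow> ennreal"
  assumes "S \<subseteq> T" "\<And>x. x \<in> S \<Longrightarrow> f x \<le> g x"
  shows "infsum f S \<le> infsum g T"
proof (rule infsum_ennreal_least)
  fix F assume F: "finite F" "F \<subseteq> S"
  then have "sum f F \<le> sum g F"
    using assms by (intro sum_mono) auto
  also have "\<dots> \<le> infsum g T"
    using F assms by (intro sum_le_infsum_ennreal) auto
  finally show "sum f F \<le> infsum g T" .
qed

lemma infsum_ennreal_cmult:
  fixes f :: "'a \<Rightarrow> ennreal"
  shows "infsum (\<lambda>x. c * f x) S = c * infsum f S"
proof -
  have "infsum (\<lambda>x. c * f x) S = (SUP F\<in>{F. finite F \<and> F \<subseteq> S}. c * sum f F)"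
    unfolding infsum_ennreal_SUP by (simp add: sum_distrib_left)
  then show ?thesis
    by (simp add: infsum_ennreal_SUP SUP_mult_left_ennreal)
qed

lemma infsum_ennreal_cmult_right:
  fixes f :: "'a \<Rightarrow> ennreal"
  shows "infsum (\<lambda>x. f x * c) S = infsum f S * c"
  using infsum_ennreal_cmult[of c f S] by (simp add: mult.commute)

lemma infsum_ennreal_inj_le:
  fixes f :: "'a \<Rightarrow> ennreal" and g :: "'b \<Rightarrow> ennreal"
  assumes "inj_on h S" "h ` S \<subseteq> T" "\<And>x. x \<in> S \<Longrightarrow> f x \<le> g (h x)"
  shows "infsum f S \<le> infsum g T"
proof -
  have "infsum f S \<le> infsum (g \<circ> h) S"
    using assms by (intro infsum_ennreal_mono) auto
  also have "\<dots> = infsum g (h ` S)"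
    using assms by (simp add: infsum_reindex)
  also have "\<dots> \<le> infsum g T"
    using assms by (intro infsum_ennreal_mono) auto
  finally show ?thesis .
qed

text \<open>A finite partial sum of the left side meets finitely many classes, and finitely many classes are
  merged by finite additivity; so each side dominates the finite partial sums of the other.\<close>

lemma infsum_ennreal_partition:
  fixes f :: "'a \<Rightarrow> ennreal"
  assumes "\<And>x. x \<in> S \<Longrightarrow> \<kappa> x \<in> K"
  shows "infsum f S = infsum (\<lambda>k. infsum f {x\<in>S. \<kappa> x = k}) K"
proof (rule antisym)
  show "infsum f S \<le> infsum (\<lambda>k. infsum f {x\<in>S. \<kappa> x = k}) K"
  proof (rule infsum_ennreal_least)
    fix F assume F: "finite F" "F \<subseteq> S"
    have "sum f F = (\<Sum>k\<in>\<kappa> ` F. sum f {x\<in>F. \<kappa> x = k})"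
      by (rule sum.image_gen[OF F(1)])
    also have "\<dots> \<le> (\<Sum>k\<in>\<kappa> ` F. infsum f {x\<in>S. \<kappa> x = k})"
      using F by (intro sum_mono sum_le_infsum_ennreal) auto
    also have "\<dots> \<le> infsum (\<lambda>k. infsum f {x\<in>S. \<kappa> x = k}) K"
      using F assms by (intro sum_le_infsum_ennreal) auto
    finally show "sum f F \<le> \<dots>" .
  qed
  show "infsum (\<lambda>k. infsum f {x\<in>S. \<kappa> x = k}) K \<le> infsum f S"
  proof (rule infsum_ennreal_least)
    fix F assume F: "finite F" "F \<subseteq> K"
    have "(\<Sum>k\<in>F. infsum f {x\<in>S. \<kappa> x = k}) = infsum f {x\<in>S. \<kappa> x \<in> F}"
      using F(1)
    proof (induction F)
      case (insert a F)
      have "infsum f {x\<in>S. \<kappa> x \<in> insert a F} = infsum f ({x\<in>S. \<kappa> x = a} \<union> {x\<in>S. \<kappa> x \<in> F})"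
        by (rule arg_cong[of _ _ "infsum f"]) auto
      also have "\<dots> = infsum f {x\<in>S. \<kappa> x = a} + infsum f {x\<in>S. \<kappa> x \<in> F}"
        using insert by (intro infsum_Un_disjoint) (auto intro: nonneg_summable_on_complete)
      finally show ?case
        unfolding sum.insert[OF insert(1,2)] insert.IH by (rule sym)
    qed simp
    also have "\<dots> \<le> infsum f S"
      by (rule infsum_ennreal_mono) auto
    finally show "(\<Sum>k\<in>F. infsum f {x\<in>S. \<kappa> x = k}) \<le> infsum f S" .
  qed
qed

lemma infsum_ennreal_Times:
  fixes f :: "'a \<Rightarrow> 'b \<Rightarrow> ennreal"
  shows "infsum (\<lambda>(x, y). f x y) (X \<times> Y) = infsum (\<lambda>x. infsum (f x) Y) X"
proof -
  have "infsum (\<lambda>(x, y). f x y) (X \<times> Y) =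
      infsum (\<lambda>k. infsum (\<lambda>(x, y). f x y) {p\<in>X \<times> Y. fst p = k}) X"
    by (rule infsum_ennreal_partition) auto
  also have "\<dots> = infsum (\<lambda>x. infsum (f x) Y) X"
  proof (rule infsum_cong)
    fix k assume k: "k \<in> X"
    have "bij_betw (Pair k) Y {p\<in>X \<times> Y. fst p = k}"
      using k by (auto simp: bij_betw_def inj_on_def)
    from infsum_reindex_bij_betw[OF this, of "\<lambda>(x, y). f x y", symmetric]
    show "infsum (\<lambda>(x, y). f x y) {p\<in>X \<times> Y. fst p = k} = infsum (f k) Y"
      by simp
  qed
  finally show ?thesis .
qed

lemma infsum_ennreal_product:
  fixes f :: "'a \<Rightarrow> ennreal" and g :: "'b \<Rightarrow> ennreal"
  shows "infsum f X * infsum g Y = infsum (\<lambda>(x, y). f x * g y) (X \<times> Y)"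
  by (simp add: infsum_ennreal_Times infsum_ennreal_cmult infsum_ennreal_cmult_right)

lemma infsum_ennreal_swap:
  fixes f :: "'a \<Rightarrow> 'b \<Rightarrow> ennreal"
  shows "infsum (\<lambda>x. infsum (f x) Y) X = infsum (\<lambda>y. infsum (\<lambda>x. f x y) X) Y"
proof -
  have "bij_betw prod.swap (Y \<times> X) (X \<times> Y)"
    by (auto simp: bij_betw_def)
  from infsum_reindex_bij_betw[OF this, of "\<lambda>(x, y). f x y"]
  have "infsum (\<lambda>(y, x). f x y) (Y \<times> X) = infsum (\<lambda>(x, y). f x y) (X \<times> Y)"
    by (simp add: case_prod_unfold)
  then show ?thesis
    by (simp add: infsum_ennreal_Times)
qed

text \<open>All comparisons of word sums below are instances of the next two lemmas. A weight that is
  multiplicative up to a constant turns unique decomposability of words into a lower bound for a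
  product of sums, and mere decomposability into an upper bound.\<close>

lemma infsum_append_ge:
  fixes w :: "'a list \<Rightarrow> ennreal"
  assumes "inj_on (\<lambda>(u, v). u @ v) (X \<times> Y)"
    and "\<And>u v. u \<in> X \<Longrightarrow> v \<in> Y \<Longrightarrow> u @ v \<in> T \<and> w u * w v \<le> C * w (u @ v)"
  shows "infsum w X * infsum w Y \<le> C * infsum w T"
proof -
  have "infsum w X * infsum w Y = infsum (\<lambda>(u, v). w u * w v) (X \<times> Y)"
    by (rule infsum_ennreal_product)
  also have "\<dots> \<le> infsum (\<lambda>z. C * w z) T"
    by (rule infsum_ennreal_inj_le[OF assms(1)]) (use assms(2) in auto)
  finally show ?thesis
    by (simp add: infsum_ennreal_cmult)
qed

lemma infsum_append_le:
  fixes w :: "'a list \<Rightarrow> ennreal"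
  assumes "\<And>z. z \<in> T \<Longrightarrow> \<exists>u\<in>X. \<exists>v\<in>Y. z = u @ v \<and> w z \<le> C * (w u * w v)"
  shows "infsum w T \<le> C * (infsum w X * infsum w Y)"
proof -
  have "\<forall>z. \<exists>p. z \<in> T \<longrightarrow> p \<in> X \<times> Y \<and> z = fst p @ snd p \<and> w z \<le> C * (w (fst p) * w (snd p))"
    using assms by fastforce
  then obtain h where h: "\<And>z. z \<in> T \<Longrightarrow> h z \<in> X \<times> Y" "\<And>z. z \<in> T \<Longrightarrow> z = fst (h z) @ snd (h z)"
    "\<And>z. z \<in> T \<Longrightarrow> w z \<le> C * (w (fst (h z)) * w (snd (h z)))"
    by metis
  have "infsum w T \<le> infsum (\<lambda>p. C * (case p of (u, v) \<Rightarrow> w u * w v)) (X \<times> Y)"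
  proof (rule infsum_ennreal_inj_le)
    show "inj_on h T"
      using h(2) by (metis inj_onI)
    show "h ` T \<subseteq> X \<times> Y"
      using h(1) by blast
    show "w z \<le> C * (case h z of (u, v) \<Rightarrow> w u * w v)" if "z \<in> T" for z
      using h(3)[OF that] by (simp add: case_prod_unfold)
  qed
  then show ?thesis
    by (simp add: infsum_ennreal_cmult infsum_ennreal_product)
qed

lemma infsum_ennreal_incseq_SUP:
  fixes f :: "nat \<Rightarrow> 'a \<Rightarrow> ennreal"
  assumes "\<And>x. x \<in> S \<Longrightarrow> incseq (\<lambda>n. f n x)"
  shows "infsum (\<lambda>x. SUP n. f n x) S = (SUP n. infsum (f n) S)"
proof -
  have "infsum (\<lambda>x. SUP n. f n x) S = (SUP F\<in>{F. finite F \<and> F \<subseteq> S}. SUP n. sum (f n) F)"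
    unfolding infsum_ennreal_SUP
  proof (rule SUP_cong[OF refl])
    fix F assume "F \<in> {F. finite F \<and> F \<subseteq> S}"
    then show "(\<Sum>x\<in>F. SUP n. f n x) = (SUP n. sum (f n) F)"
      using assms by (subst ennreal_SUP_sum) auto
  qed
  also have "\<dots> = (SUP n. infsum (f n) S)"
    unfolding infsum_ennreal_SUP by (rule SUP_commute)
  finally show ?thesis .
qed

lemma infsum_ennreal_summable:
  fixes g :: "nat \<Rightarrow> real"
  assumes "\<And>n. 0 \<le> g n" "summable g"
  shows "(\<Sum>\<^sub>\<infinity>n\<in>S. ennreal (g n)) < \<infinity>"
proof -
  have "(\<Sum>\<^sub>\<infinity>n\<in>S. ennreal (g n)) \<le> ennreal (suminf g)"
  proof (rule infsum_ennreal_least)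
    fix F :: "nat set" assume "finite F"
    then have "sum g F \<le> suminf g"
      using assms by (intro sum_le_suminf) auto
    then show "(\<Sum>n\<in>F. ennreal (g n)) \<le> ennreal (suminf g)"
      using assms by (simp add: ennreal_leI)
  qed
  then show ?thesis
    using order_le_less_trans by fastforce
qed

lemma infsum_geometric_ennreal:
  fixes r :: ennreal
  assumes "r < 1"
  shows "(\<Sum>\<^sub>\<infinity>n\<in>(UNIV::nat set). r ^ n) < \<infinity>"
proof -
  obtain x where x: "r = ennreal x" "0 \<le> x" "x < 1"
    using assms by (cases r) auto
  have "(\<Sum>\<^sub>\<infinity>n\<in>(UNIV::nat set). ennreal (x ^ n)) < \<infinity>"
    using x by (intro infsum_ennreal_summable summable_geometric) auto
  then show ?thesis
    using x by (simp add: ennreal_power)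
qed

section \<open>Amenability from quasi-invariant means\<close>

text \<open>The set \<open>S\<close> is cut into the finitely many pieces on which \<open>\<kappa>\<close> is constant, and each piece is
  translated by the value of \<open>\<kappa>\<close> on it.\<close>

definition piecewise_translate ::
    "('g, 'b) monoid_scheme \<Rightarrow> ('g set \<Rightarrow> real) \<Rightarrow> ('g \<Rightarrow> 'g) \<Rightarrow> 'g set \<Rightarrow> real" where
  "piecewise_translate G \<mu> \<kappa> S =
     (\<Sum>r\<in>\<kappa> ` carrier G. \<mu> (r <#\<^bsub>G\<^esub> {x\<in>S. \<kappa> x = r}))"

lemma (in group) l_coset_subset: "g \<in> carrier G \<Longrightarrow> S \<subseteq> carrier G \<Longrightarrow> g <#\<^bsub>G\<^esub> S \<subseteq> carrier G"
  by (auto simp: l_coset_def)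

text \<open>The translates of \<open>\<mu>\<close> are all bounded by a fixed multiple of \<open>\<mu>\<close>, so they have a supremum in the
  lattice of finitely additive measures. The group permutes the translates, hence the supremum is
  invariant. Concretely, the supremum at \<open>S\<close> is the supremum of the piecewise translates of \<open>S\<close>:
  additivity holds because two ways of cutting disjoint sets can be glued, and invariance because
  cutting \<open>g S\<close> amounts to cutting \<open>S\<close>. This is what makes an argument with multiplicative constants
  sufficient for amenability.\<close>

lemma (in group) amenable_of_quasi_invariant_mean:
  fixes \<mu> :: "'a set \<Rightarrow> real"
  assumes add: "additive (Pow (carrier G)) \<mu>" and total: "\<mu> (carrier G) = 1"
    and nonneg: "\<And>S. S \<subseteq> carrier G \<Longrightarrow> 0 \<le> \<mu> S"
    and "c > 0"
    and quasi: "\<And>g S. g \<in> carrier G \<Longrightarrow> S \<subseteq> carrier G \<Longrightarrow> c * \<mu> S \<le> \<mu> (g <#\<^bsub>G\<^esub> S)"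
  shows "amenable G"
proof -
  let ?V = "piecewise_translate G \<mu>"
  define \<K> where "\<K> = {\<kappa>. \<kappa> ` carrier G \<subseteq> carrier G \<and> finite (\<kappa> ` carrier G)}"
  define \<nu> where "\<nu> S = (SUP \<kappa>\<in>\<K>. ?V \<kappa> S)" for S
  have add2: "\<mu> (S \<union> T) = \<mu> S + \<mu> T" if "S \<inter> T = {}" "S \<subseteq> carrier G" "T \<subseteq> carrier G" for S T
    using add that by (auto simp: additive_def)
  have empty: "\<mu> {} = 0"
    using add2[of "{}" "{}"] by simp
  have V_add: "?V \<kappa> (S \<union> T) = ?V \<kappa> S + ?V \<kappa> T"
    if \<kappa>: "\<kappa> \<in> \<K>" and disj: "S \<inter> T = {}" and ST: "S \<subseteq> carrier G" "T \<subseteq> carrier G" for \<kappa> S T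
  proof -
    have "\<mu> (r <#\<^bsub>G\<^esub> {x\<in>S \<union> T. \<kappa> x = r}) = \<mu> (r <#\<^bsub>G\<^esub> {x\<in>S. \<kappa> x = r}) + \<mu> (r <#\<^bsub>G\<^esub> {x\<in>T. \<kappa> x = r})"
      if "r \<in> carrier G" for r
    proof -
      have "r <#\<^bsub>G\<^esub> {x\<in>S \<union> T. \<kappa> x = r} = (r <#\<^bsub>G\<^esub> {x\<in>S. \<kappa> x = r}) \<union> (r <#\<^bsub>G\<^esub> {x\<in>T. \<kappa> x = r})"
        by (auto simp: l_coset_def)
      moreover have "(r <#\<^bsub>G\<^esub> {x\<in>S. \<kappa> x = r}) \<inter> (r <#\<^bsub>G\<^esub> {x\<in>T. \<kappa> x = r}) = {}"
      proof -
        have image: "r <#\<^bsub>G\<^esub> U = (\<lambda>x. r \<otimes> x) ` U" for U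
          by (auto simp: l_coset_def)
        have "{x\<in>S. \<kappa> x = r} \<inter> {x\<in>T. \<kappa> x = r} = {}"
          using disj by auto
        then show ?thesis
          using inj_on_image_Int[OF inj_on_cmult[OF that], of "{x\<in>S. \<kappa> x = r}" "{x\<in>T. \<kappa> x = r}"] ST
          unfolding image by auto
      qed
      moreover have "r <#\<^bsub>G\<^esub> {x\<in>S. \<kappa> x = r} \<subseteq> carrier G" "r <#\<^bsub>G\<^esub> {x\<in>T. \<kappa> x = r} \<subseteq> carrier G"
        by (rule l_coset_subset[OF that]; use ST in blast)+
      ultimately show ?thesis
        using add2 by simp
    qed
    then show ?thesis
      using \<kappa> unfolding piecewise_translate_def \<K>_def sum.distrib[symmetric]
      by (intro sum.cong) auto
  qed
  have mono: "\<mu> S \<le> \<mu> T" if "S \<subseteq> T" "T \<subseteq> carrier G" for S T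
  proof -
    have "\<mu> (S \<union> (T - S)) = \<mu> S + \<mu> (T - S)"
      using that by (intro add2) auto
    moreover have "S \<union> (T - S) = T"
      using that by auto
    moreover have "0 \<le> \<mu> (T - S)"
      using that by (intro nonneg) auto
    ultimately show ?thesis by simp
  qed
  have shift_le: "\<mu> (r <#\<^bsub>G\<^esub> S) \<le> \<mu> S / c" if "r \<in> carrier G" "S \<subseteq> carrier G" for r S
  proof -
    have "c * \<mu> (r <#\<^bsub>G\<^esub> S) \<le> \<mu> (inv r <#\<^bsub>G\<^esub> (r <#\<^bsub>G\<^esub> S))"
      using that by (intro quasi l_coset_subset) auto
    also have "inv r <#\<^bsub>G\<^esub> (r <#\<^bsub>G\<^esub> S) = S"
      using that by (simp add: lcos_m_assoc lcos_mult_one)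
    finally show ?thesis
      using \<open>c > 0\<close> by (simp add: field_simps)
  qed
  have sum_pieces: "(\<Sum>r\<in>R. \<mu> {x\<in>S. \<kappa> x = r}) \<le> \<mu> S" if "finite R" "S \<subseteq> carrier G" for R S \<kappa>
  proof -
    have "(\<Sum>r\<in>R. \<mu> {x\<in>S. \<kappa> x = r}) = \<mu> {x\<in>S. \<kappa> x \<in> R}"
      using that(1)
    proof (induction R)
      case (insert a R)
      have "\<mu> ({x\<in>S. \<kappa> x = a} \<union> {x\<in>S. \<kappa> x \<in> R}) = \<mu> {x\<in>S. \<kappa> x = a} + \<mu> {x\<in>S. \<kappa> x \<in> R}"
        using insert that by (intro add2) auto
      moreover have "{x\<in>S. \<kappa> x = a} \<union> {x\<in>S. \<kappa> x \<in> R} = {x\<in>S. \<kappa> x \<in> insert a R}"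
        by auto
      ultimately show ?case using insert by simp
    qed (simp add: empty)
    also have "\<dots> \<le> \<mu> S" using that by (intro mono) auto
    finally show ?thesis .
  qed
  have V_le: "?V \<kappa> S \<le> \<mu> S / c" if "\<kappa> \<in> \<K>" "S \<subseteq> carrier G" for \<kappa> S
  proof -
    have "?V \<kappa> S \<le> (\<Sum>r\<in>\<kappa> ` carrier G. \<mu> {x\<in>S. \<kappa> x = r} / c)"
      unfolding piecewise_translate_def using that
      by (intro sum_mono shift_le) (auto simp: \<K>_def)
    also have "\<dots> = (\<Sum>r\<in>\<kappa> ` carrier G. \<mu> {x\<in>S. \<kappa> x = r}) / c"
      by (simp add: sum_divide_distrib)
    also have "\<dots> \<le> \<mu> S / c"
      using that \<open>c > 0\<close> by (intro divide_right_mono sum_pieces) (auto simp: \<K>_def)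
    finally show ?thesis .
  qed
  have bdd: "bdd_above ((\<lambda>\<kappa>. ?V \<kappa> S) ` \<K>)" if "S \<subseteq> carrier G" for S
    using V_le that by (auto intro!: bdd_aboveI)
  have one_K: "(\<lambda>_. \<one>) \<in> \<K>"
    using finite_subset[of "(\<lambda>_. \<one>) ` carrier G" "{\<one>}"] by (auto simp: \<K>_def)
  have V_one: "?V (\<lambda>_. \<one>) S = \<mu> S" if "S \<subseteq> carrier G" for S
  proof -
    have "(\<lambda>_. \<one>) ` carrier G = {\<one>}" by auto
    then show ?thesis
      using that by (simp add: piecewise_translate_def lcos_mult_one)
  qed
  have \<nu>_ge: "?V \<kappa> S \<le> \<nu> S" if "\<kappa> \<in> \<K>" "S \<subseteq> carrier G" for \<kappa> S
    unfolding \<nu>_def using that bdd by (intro cSUP_upper) auto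
  have \<nu>_le: "\<nu> S \<le> b" if "\<And>\<kappa>. \<kappa> \<in> \<K> \<Longrightarrow> ?V \<kappa> S \<le> b" for S b
    unfolding \<nu>_def using that one_K by (intro cSUP_least) auto
  have \<mu>\<nu>: "\<mu> S \<le> \<nu> S" if "S \<subseteq> carrier G" for S
    using \<nu>_ge[OF one_K that] V_one that by simp
  have \<nu>_add: "\<nu> (S \<union> T) = \<nu> S + \<nu> T"
    if disj: "S \<inter> T = {}" and ST: "S \<subseteq> carrier G" "T \<subseteq> carrier G" for S T
  proof (rule antisym)
    show "\<nu> (S \<union> T) \<le> \<nu> S + \<nu> T"
      using disj ST \<nu>_ge by (intro \<nu>_le) (auto simp: V_add intro!: add_mono)
    have glue: "?V \<kappa>1 S + ?V \<kappa>2 T \<le> \<nu> (S \<union> T)" if "\<kappa>1 \<in> \<K>" "\<kappa>2 \<in> \<K>" for \<kappa>1 \<kappa>2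
    proof -
      define \<kappa> where "\<kappa> x = (if x \<in> S then \<kappa>1 x else \<kappa>2 x)" for x
      have sub: "\<kappa> ` carrier G \<subseteq> \<kappa>1 ` carrier G \<union> \<kappa>2 ` carrier G"
        by (auto simp: \<kappa>_def)
      then have \<kappa>: "\<kappa> \<in> \<K>"
        using that finite_subset[OF sub] by (auto simp: \<K>_def)
      have cong: "?V \<kappa> U = ?V \<kappa>' U"
        if eq: "\<And>x. x \<in> U \<Longrightarrow> \<kappa> x = \<kappa>' x" and K: "\<kappa> \<in> \<K>" "\<kappa>' \<in> \<K>" and U: "U \<subseteq> carrier G"
        for \<kappa> \<kappa>' U
      proof -
        have e: "{x\<in>U. \<kappa> x = r} = {x\<in>U. \<kappa>' x = r}" for r
          using eq by auto
        have z: "\<mu> (r <#\<^bsub>G\<^esub> {x\<in>U. \<rho> x = r}) = 0" if "r \<notin> \<rho> ` carrier G" for r \<rho>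
        proof -
          have "{x\<in>U. \<rho> x = r} = {}"
            using that U by auto
          then show ?thesis by (simp only:) (simp add: l_coset_def empty)
        qed
        have "(\<Sum>r\<in>\<kappa> ` carrier G. \<mu> (r <#\<^bsub>G\<^esub> {x\<in>U. \<kappa> x = r})) =
            (\<Sum>r\<in>\<kappa> ` carrier G \<union> \<kappa>' ` carrier G. \<mu> (r <#\<^bsub>G\<^esub> {x\<in>U. \<kappa> x = r}))"
          using K by (intro sum.mono_neutral_left) (auto simp: \<K>_def z)
        also have "\<dots> = (\<Sum>r\<in>\<kappa>' ` carrier G. \<mu> (r <#\<^bsub>G\<^esub> {x\<in>U. \<kappa> x = r}))"
          using K unfolding e
          by (intro sum.mono_neutral_right) (auto simp: \<K>_def z)
        finally show ?thesis
          by (simp add: piecewise_translate_def e)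
      qed
      have "?V \<kappa>1 S = ?V \<kappa> S" "?V \<kappa>2 T = ?V \<kappa> T"
        using that \<kappa> ST disj by (intro cong; auto simp: \<kappa>_def)+
      then show ?thesis
        using V_add[OF \<kappa> disj ST] \<nu>_ge[OF \<kappa>, of "S \<union> T"] ST by simp
    qed
    have "\<nu> S \<le> \<nu> (S \<union> T) - ?V \<kappa>2 T" if "\<kappa>2 \<in> \<K>" for \<kappa>2
      using glue that by (intro \<nu>_le) (simp add: le_diff_eq)
    then have "\<nu> T \<le> \<nu> (S \<union> T) - \<nu> S"
      by (intro \<nu>_le) (simp add: le_diff_eq add.commute)
    then show "\<nu> S + \<nu> T \<le> \<nu> (S \<union> T)" by simp
  qed
  have \<nu>_shift_ge: "\<nu> S \<le> \<nu> (g <#\<^bsub>G\<^esub> S)" if g: "g \<in> carrier G" and S: "S \<subseteq> carrier G" for g S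
  proof (rule \<nu>_le)
    fix \<kappa> assume \<kappa>: "\<kappa> \<in> \<K>"
    \<comment> \<open>the pieces of \<open>g S\<close> are first moved back to \<open>S\<close> and then treated as \<open>\<kappa>\<close> prescribes\<close>
    define \<kappa>' where "\<kappa>' y = \<kappa> (inv g \<otimes> y) \<otimes> inv g" for y
    have im: "\<kappa>' ` carrier G = (\<lambda>r. r \<otimes> inv g) ` \<kappa> ` carrier G"
    proof -
      have "(\<lambda>y. inv g \<otimes> y) ` carrier G = carrier G"
        using g by (intro surj_const_mult) auto
      then have "\<kappa> ` carrier G = (\<lambda>y. \<kappa> (inv g \<otimes> y)) ` carrier G"
        by (metis image_image)
      then show ?thesis
        unfolding \<kappa>'_def by (simp add: image_image)
    qed
    have \<kappa>': "\<kappa>' \<in> \<K>"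
    proof -
      have "(\<lambda>r. r \<otimes> inv g) ` \<kappa> ` carrier G \<subseteq> carrier G"
        using \<kappa> g by (auto simp: \<K>_def)
      then show ?thesis
        using \<kappa> unfolding \<K>_def mem_Collect_eq im by simp
    qed
    have "?V \<kappa>' (g <#\<^bsub>G\<^esub> S) = (\<Sum>r\<in>\<kappa> ` carrier G. \<mu> ((r \<otimes> inv g) <#\<^bsub>G\<^esub> {y\<in>g <#\<^bsub>G\<^esub> S. \<kappa>' y = r \<otimes> inv g}))"
      unfolding piecewise_translate_def im using \<kappa> g
      by (intro sum.reindex_cong[OF _ refl refl]) (auto simp: inj_on_def \<K>_def subset_iff)
    also have "\<dots> = ?V \<kappa> S"
      unfolding piecewise_translate_def
    proof (rule sum.cong[OF refl])
      fix r assume "r \<in> \<kappa> ` carrier G"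
      then have r: "r \<in> carrier G" using \<kappa> by (auto simp: \<K>_def)
      have k: "\<kappa> x \<in> carrier G" if "x \<in> S" for x
        using \<kappa> S that by (auto simp: \<K>_def)
      have c: "inv g \<otimes> (g \<otimes> x) = x" if "x \<in> S" for x
        using g S that by (metis inv_solve_left' m_closed subsetD)
      have "{y\<in>g <#\<^bsub>G\<^esub> S. \<kappa>' y = r \<otimes> inv g} = g <#\<^bsub>G\<^esub> {x\<in>S. \<kappa> x = r}"
        using g r k c by (auto simp: l_coset_def \<kappa>'_def)
      moreover have "(r \<otimes> inv g) <#\<^bsub>G\<^esub> (g <#\<^bsub>G\<^esub> {x\<in>S. \<kappa> x = r}) = r <#\<^bsub>G\<^esub> {x\<in>S. \<kappa> x = r}"
        using g r S by (subst lcos_m_assoc) (auto simp: m_assoc)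
      ultimately show "\<mu> ((r \<otimes> inv g) <#\<^bsub>G\<^esub> {y\<in>g <#\<^bsub>G\<^esub> S. \<kappa>' y = r \<otimes> inv g}) = \<mu> (r <#\<^bsub>G\<^esub> {x\<in>S. \<kappa> x = r})"
        by simp
    qed
    finally show "?V \<kappa> S \<le> \<nu> (g <#\<^bsub>G\<^esub> S)"
      using \<nu>_ge[OF \<kappa>', of "g <#\<^bsub>G\<^esub> S"] l_coset_subset[OF g S] by simp
  qed
  have \<nu>_inv: "\<nu> (g <#\<^bsub>G\<^esub> S) = \<nu> S" if g: "g \<in> carrier G" and S: "S \<subseteq> carrier G" for g S
  proof (rule antisym[OF _ \<nu>_shift_ge[OF that]])
    have "\<nu> (g <#\<^bsub>G\<^esub> S) \<le> \<nu> (inv g <#\<^bsub>G\<^esub> (g <#\<^bsub>G\<^esub> S))"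
      using g S by (intro \<nu>_shift_ge l_coset_subset) auto
    then show "\<nu> (g <#\<^bsub>G\<^esub> S) \<le> \<nu> S"
      using g S by (simp add: lcos_m_assoc lcos_mult_one)
  qed
  have pos: "\<nu> (carrier G) > 0"
    using \<mu>\<nu>[of "carrier G"] total by simp
  show ?thesis
    unfolding amenable_def
  proof (intro exI[of _ "\<lambda>S. \<nu> S / \<nu> (carrier G)"] conjI ballI allI impI)
    show "additive (Pow (carrier G)) (\<lambda>S. \<nu> S / \<nu> (carrier G))"
      by (auto simp: additive_def \<nu>_add add_divide_distrib)
    show "0 \<le> \<nu> S / \<nu> (carrier G)" if "S \<subseteq> carrier G" for S
      using \<mu>\<nu>[OF that] nonneg[OF that] pos by simp
    show "\<nu> (g <#\<^bsub>G\<^esub> S) / \<nu> (carrier G) = \<nu> S / \<nu> (carrier G)"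
      if "g \<in> carrier G" "S \<subseteq> carrier G" for g S
      using \<nu>_inv that by simp
  qed (use pos in simp)
qed


section \<open>Weighted monoids of words over a group\<close>

lemma mult_SUP_le_ennreal:
  fixes f g :: "nat \<Rightarrow> ennreal"
  assumes "incseq f" "incseq g" "\<And>n. f n * g n \<le> c"
  shows "(SUP n. f n) * (SUP n. g n) \<le> c"
proof -
  have "f m * g n \<le> c" for m n
  proof -
    have "f m * g n \<le> f (max m n) * g (max m n)"
      using assms by (intro mult_mono) (auto intro: incseqD)
    also have "\<dots> \<le> c" by (rule assms)
    finally show ?thesis .
  qed
  then have "f m * (SUP n. g n) \<le> c" for m
    by (subst SUP_mult_left_ennreal) (auto intro: SUP_least)
  then show ?thesis
    by (subst SUP_mult_right_ennreal) (auto intro: SUP_least)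
qed

text \<open>A fixed sequence increasing to 1 replaces the limit \<open>s \<rightarrow> 1\<close>, so that the limits below are suprema
  of increasing sequences. It starts at \<open>1/2\<close> and thus stays away from 0.\<close>

definition near_one :: "nat \<Rightarrow> ennreal" where
  "near_one n = ennreal (1 - 1 / real (n + 2))"

lemma near_one_less: "near_one n < 1"
  unfolding near_one_def by (subst ennreal_1[symmetric], subst ennreal_less_iff) auto

lemma near_one_ge_half: "ennreal (1/2) \<le> near_one n"
  unfolding near_one_def by (intro ennreal_leI) (simp add: field_simps)

lemma incseq_near_one: "incseq near_one"
  unfolding near_one_def by (intro incseq_SucI ennreal_leI) (simp add: field_simps)

lemma SUP_near_one_power: "(SUP n. near_one n ^ k) = 1"
proof -
  have inc: "incseq (\<lambda>n. near_one n ^ k)"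
    using incseq_near_one by (intro monoI power_mono) (auto dest: monoD)
  have "(\<lambda>n. (1 - 1 / real (n + 2)) ^ k) \<longlonglongrightarrow> (1 - 0) ^ k"
    by (intro tendsto_power tendsto_diff tendsto_const LIMSEQ_ignore_initial_segment lim_1_over_n)
  then have "(\<lambda>n. ennreal ((1 - 1 / real (n + 2)) ^ k)) \<longlonglongrightarrow> ennreal ((1 - 0) ^ k)"
    by (rule tendsto_ennrealI)
  then have "(\<lambda>n. near_one n ^ k) \<longlonglongrightarrow> 1"
    unfolding near_one_def by (simp add: ennreal_power)
  then show ?thesis
    using LIMSEQ_SUP[OF inc] LIMSEQ_unique by blast
qed

text \<open>This locale isolates what is needed of the loops at a letter of the base shift: a monoid of words
  with a weight that is multiplicative up to the constant \<open>C\<close>, and a homomorphism onto \<open>G\<close>. The last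
  assumption bounds the exponential growth rate of the words with value \<open>\<one>\<close> by 1, which is achieved by normalising
  with the pressure.\<close>

locale weighted_word_monoid = group G for G :: "('g, 'b) monoid_scheme" (structure) +
  fixes E :: "'a list set" and w :: "'a list \<Rightarrow> ennreal" and \<Psi> :: "'a list \<Rightarrow> 'g" and C :: ennreal
  assumes nil: "[] \<in> E"
    and append: "u \<in> E \<Longrightarrow> v \<in> E \<Longrightarrow> u @ v \<in> E"
    and cancel: "u @ v \<in> E \<Longrightarrow> v \<in> E \<Longrightarrow> u \<in> E"
    and w_nil: "w [] = 1"
    and w_pos: "u \<in> E \<Longrightarrow> 0 < w u" and w_fin: "u \<in> E \<Longrightarrow> w u < \<infinity>"
    and C_fin: "C < \<infinity>"
    and w_append_le: "u \<in> E \<Longrightarrow> v \<in> E \<Longrightarrow> w (u @ v) \<le> C * (w u * w v)"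
    and w_append_ge: "u \<in> E \<Longrightarrow> v \<in> E \<Longrightarrow> w u * w v \<le> C * w (u @ v)"
    and \<Psi>_closed: "u \<in> E \<Longrightarrow> \<Psi> u \<in> carrier G"
    and \<Psi>_nil: "\<Psi> [] = \<one>"
    and \<Psi>_append: "u \<in> E \<Longrightarrow> v \<in> E \<Longrightarrow> \<Psi> (u @ v) = \<Psi> u \<otimes> \<Psi> v"
    and \<Psi>_onto: "g \<in> carrier G \<Longrightarrow> \<exists>u\<in>E. \<Psi> u = g"
    and subcritical: "s < 1 \<Longrightarrow> (\<Sum>\<^sub>\<infinity>u\<in>{u\<in>E. \<Psi> u = \<one>}. w u * s ^ length u) < \<infinity>"
begin

definition gsum :: "ennreal \<Rightarrow> 'a list set \<Rightarrow> ennreal" where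
  "gsum s S = (\<Sum>\<^sub>\<infinity>u\<in>S. w u * s ^ length u)"

definition fiber :: "'g \<Rightarrow> 'a list set" where
  "fiber g = {u\<in>E. \<Psi> u = g}"

text \<open>Reading a word from right to left, its suffixes in \<open>E\<close> trace a path in \<open>G\<close> that starts at the unit.
  The words below are those whose path reaches \<open>g\<close> for the first time at the end. Their sum \<open>F\<close> and
  the sum over all words with value \<open>g\<close>, the Green function, play the roles of the generating functions
  \<open>F\<close> and \<open>G\<close> of a random walk on the group.\<close>

definition first_visit :: "'g \<Rightarrow> 'a list set" where
  "first_visit g = {v\<in>E. \<Psi> v = g \<and> (\<forall>x y. v = x @ y \<longrightarrow> x \<noteq> [] \<longrightarrow> y \<in> E \<longrightarrow> \<Psi> y \<noteq> g)}"

abbreviation Green :: "ennreal \<Rightarrow> 'g \<Rightarrow> ennreal" where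
  "Green s g \<equiv> gsum s (fiber g)"

abbreviation F :: "ennreal \<Rightarrow> 'g \<Rightarrow> ennreal" where
  "F s g \<equiv> gsum s (first_visit g)"

lemma fiber_subset: "fiber g \<subseteq> E"
  by (auto simp: fiber_def)

lemma first_visit_subset: "first_visit g \<subseteq> E"
  by (auto simp: first_visit_def)

lemma C_ge_1: "1 \<le> C"
  using w_append_ge[OF nil nil] by (simp add: w_nil)

lemma gsum_mono: "S \<subseteq> T \<Longrightarrow> s \<le> t \<Longrightarrow> gsum s S \<le> gsum t T"
  unfolding gsum_def by (intro infsum_ennreal_mono mult_left_mono power_mono) auto

lemma gsum_one_SUP: "gsum 1 S = (SUP n. gsum (near_one n) S)"
proof -
  have inc: "incseq (\<lambda>n. w u * near_one n ^ length u)" for u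
    using incseq_near_one by (intro monoI mult_left_mono power_mono) (auto dest: monoD)
  have "w u * 1 ^ length u = (SUP n. w u * near_one n ^ length u)" for u
    by (simp add: SUP_mult_left_ennreal[symmetric] SUP_near_one_power)
  then have "gsum 1 S = (\<Sum>\<^sub>\<infinity>u\<in>S. SUP n. w u * near_one n ^ length u)"
    unfolding gsum_def by (rule infsum_cong)
  then show ?thesis
    unfolding gsum_def infsum_ennreal_incseq_SUP[OF inc] .
qed

lemma incseq_gsum: "incseq (\<lambda>n. gsum (near_one n) S)"
  using incseq_near_one by (intro monoI gsum_mono) (auto dest: monoD)

lemma gsum_singleton: "gsum s {u} = w u * s ^ length u"
  by (simp add: gsum_def)

lemma gsum_append_ge:
  assumes "X \<subseteq> E" "Y \<subseteq> E" "inj_on (\<lambda>(u, v). u @ v) (X \<times> Y)"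
    and "\<And>u v. u \<in> X \<Longrightarrow> v \<in> Y \<Longrightarrow> u @ v \<in> T"
  shows "gsum s X * gsum s Y \<le> C * gsum s T"
  unfolding gsum_def
proof (rule infsum_append_ge[OF assms(3)], intro conjI)
  fix u v assume "u \<in> X" "v \<in> Y"
  then show "u @ v \<in> T" and "w u * s ^ length u * (w v * s ^ length v) \<le> C * (w (u @ v) * s ^ length (u @ v))"
    using assms mult_right_mono[OF w_append_ge[of u v], of "s ^ (length u + length v)"]
    by (auto simp: power_add ac_simps)
qed

lemma gsum_append_le:
  assumes "X \<subseteq> E" "Y \<subseteq> E" "\<And>z. z \<in> T \<Longrightarrow> \<exists>u\<in>X. \<exists>v\<in>Y. z = u @ v"
  shows "gsum s T \<le> C * (gsum s X * gsum s Y)"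
  unfolding gsum_def
proof (rule infsum_append_le)
  fix z assume "z \<in> T"
  then obtain u v where uv: "u \<in> X" "v \<in> Y" "z = u @ v"
    using assms(3) by blast
  then have "w z * s ^ length z \<le> C * (w u * s ^ length u * (w v * s ^ length v))"
    using assms(1,2) mult_right_mono[OF w_append_le[of u v], of "s ^ (length u + length v)"]
    by (auto simp: power_add ac_simps)
  then show "\<exists>u\<in>X. \<exists>v\<in>Y. z = u @ v \<and> w z * s ^ length z \<le> C * (w u * s ^ length u * (w v * s ^ length v))"
    using uv by blast
qed

lemma first_visit_suffix:
  assumes "u \<in> E" "u = x @ y" "y \<in> E" "\<Psi> y = g"
  obtains x' y' where "u = x' @ y'" "x' \<in> E" "y' \<in> first_visit g"
proof -
  define P where "P n \<longleftrightarrow> (\<exists>x y. u = x @ y \<and> y \<in> E \<and> \<Psi> y = g \<and> length y = n)" for n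
  have "P (length y)"
    using assms by (auto simp: P_def)
  then have "P (LEAST n. P n)"
    by (rule LeastI)
  then obtain x' y' where xy: "u = x' @ y'" "y' \<in> E" "\<Psi> y' = g" "length y' = (LEAST n. P n)"
    by (auto simp: P_def)
  have "\<Psi> b \<noteq> g" if "y' = a @ b" "a \<noteq> []" "b \<in> E" for a b
  proof
    assume "\<Psi> b = g"
    then have "P (length b)"
      using xy that unfolding P_def by (metis append.assoc)
    then have "length y' \<le> length b"
      using xy by (simp add: Least_le)
    then show False using that by simp
  qed
  then have "y' \<in> first_visit g"
    using xy by (auto simp: first_visit_def)
  moreover have "x' \<in> E"
    using xy assms(1) cancel by auto
  ultimately show thesis
    using that xy by blast
qed

lemma inj_append_first_visit: "inj_on (\<lambda>(u, v). u @ v) (X \<times> first_visit g)"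
proof (rule inj_onI)
  fix p q assume pq: "p \<in> X \<times> first_visit g" "q \<in> X \<times> first_visit g"
    "(case p of (u, v) \<Rightarrow> u @ v) = (case q of (u, v) \<Rightarrow> u @ v)"
  obtain u v u' v' where e: "p = (u, v)" "q = (u', v')" by force
  with pq have "u @ v = u' @ v'" and v: "v \<in> first_visit g" "v' \<in> first_visit g" by auto
  then consider d where "u = u' @ d" "v' = d @ v" | d where "u @ d = u'" "v = d @ v'"
    by (auto simp: append_eq_append_conv2)
  then show "p = q"
  proof cases
    case (1 d)
    then have "d = []" using v by (auto simp: first_visit_def)
    then show ?thesis using 1 e by simp
  next
    case (2 d)
    then have "d = []" using v by (auto simp: first_visit_def)
    then show ?thesis using 2 e by simp
  qed
qed

text \<open>A word is cut before its shortest suffix with value \<open>g\<close>.\<close>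

lemma Green_le: "Green s g \<le> C * (Green s \<one> * F s g)"
proof (rule gsum_append_le[OF fiber_subset first_visit_subset])
  fix z assume "z \<in> fiber g"
  then have z: "z \<in> E" "\<Psi> z = g" by (auto simp: fiber_def)
  from first_visit_suffix[OF z(1) _ z, of "[]"]
  obtain x y where xy: "z = x @ y" "x \<in> E" "y \<in> first_visit g" by auto
  have y: "y \<in> E" "\<Psi> y = g" using xy by (auto simp: first_visit_def)
  have "\<Psi> x \<otimes> g = g"
    using z xy y \<Psi>_append[of x y] by simp
  then have "\<Psi> x = \<one>"
    using xy y \<Psi>_closed by (metis r_cancel_one)
  then show "\<exists>u\<in>fiber \<one>. \<exists>v\<in>first_visit g. z = u @ v"
    using xy by (auto simp: fiber_def)
qed

lemma Green_mult_ge: "Green s g * F s k \<le> C * Green s (g \<otimes> k)"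
  by (rule gsum_append_ge[OF fiber_subset first_visit_subset inj_append_first_visit])
    (auto simp: fiber_def first_visit_def append \<Psi>_append)

lemma Green_one_mult_ge: "g \<in> carrier G \<Longrightarrow> Green s \<one> * F s g \<le> C * Green s g"
  using Green_mult_ge[of s \<one> g] by simp

lemma Green_one_ge: "1 \<le> Green s \<one>"
proof -
  have "gsum s {[]} \<le> Green s \<one>"
    using nil \<Psi>_nil by (intro gsum_mono) (auto simp: fiber_def)
  then show ?thesis by (simp add: gsum_singleton w_nil)
qed

lemma Green_one_pos: "Green s \<one> \<noteq> 0"
  using Green_one_ge[of s] by auto

lemma Green_one_fin: "s < 1 \<Longrightarrow> Green s \<one> \<noteq> \<infinity>"
  using subcritical[of s] by (auto simp: gsum_def fiber_def)

lemma cancel_Green_one: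
  assumes "s < 1" "Green s \<one> * a \<le> Green s \<one> * b"
  shows "a \<le> b"
  using assms Green_one_pos Green_one_fin ennreal_mult_le_mult_iff by (metis infinity_ennreal_def)

lemma Green_mult_word: 
  assumes "u \<in> E" "g \<in> carrier G" "\<Psi> u = inv g"
  shows "Green s g * (w u * s ^ length u) \<le> C * Green s \<one>"
proof -
  have "gsum s (fiber g) * gsum s {u} \<le> C * gsum s (fiber \<one>)"
    using assms by (intro gsum_append_ge) (auto simp: inj_on_def fiber_def append \<Psi>_append)
  then show ?thesis by (simp add: gsum_singleton)
qed

text \<open>\<open>F s g\<close> agrees with \<open>Green s g / Green s \<one>\<close> up to constants, and below the critical parameter
  the denominator is finite and can be cancelled.\<close>

lemma F_mult_ge_subcritical:
  assumes "s < 1" "g \<in> carrier G" "k \<in> carrier G"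
  shows "F s g * F s k \<le> C ^ 3 * F s (g \<otimes> k)"
proof (rule cancel_Green_one[OF assms(1)])
  have "Green s \<one> * (F s g * F s k) = (Green s \<one> * F s g) * F s k"
    by (simp add: ac_simps)
  also have "\<dots> \<le> (C * Green s g) * F s k"
    using assms by (intro mult_right_mono Green_one_mult_ge) auto
  also have "\<dots> = C * (Green s g * F s k)"
    by (simp add: ac_simps)
  also have "\<dots> \<le> C * (C * Green s (g \<otimes> k))"
    by (intro mult_left_mono Green_mult_ge) auto
  also have "\<dots> \<le> C * (C * (C * (Green s \<one> * F s (g \<otimes> k))))"
    by (intro mult_left_mono Green_le) auto
  also have "\<dots> = Green s \<one> * (C ^ 3 * F s (g \<otimes> k))"
    by (simp add: ac_simps power3_eq_cube)
  finally show "Green s \<one> * (F s g * F s k) \<le> Green s \<one> * (C ^ 3 * F s (g \<otimes> k))" .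
qed

lemma F_mult_ge:
  assumes "g \<in> carrier G" "k \<in> carrier G"
  shows "F 1 g * F 1 k \<le> C ^ 3 * F 1 (g \<otimes> k)"
  unfolding gsum_one_SUP[of "first_visit g"] gsum_one_SUP[of "first_visit k"]
proof (rule mult_SUP_le_ennreal[OF incseq_gsum incseq_gsum])
  fix n
  have "F (near_one n) g * F (near_one n) k \<le> C ^ 3 * F (near_one n) (g \<otimes> k)"
    by (rule F_mult_ge_subcritical[OF near_one_less assms])
  also have "\<dots> \<le> C ^ 3 * F 1 (g \<otimes> k)"
    using near_one_less[of n] by (intro mult_left_mono gsum_mono) auto
  finally show "F (near_one n) g * F (near_one n) k \<le> C ^ 3 * F 1 (g \<otimes> k)" .
qed

text \<open>Appending a fixed word with value \<open>inv g\<close> bounds \<open>Green s g / Green s \<one>\<close>, uniformly for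
  \<open>s \<ge> 1/2\<close>.\<close>

lemma F_fin:
  assumes g: "g \<in> carrier G"
  shows "F 1 g < \<infinity>"
proof -
  obtain u where u: "u \<in> E" "\<Psi> u = inv g"
    using \<Psi>_onto g by blast
  define b where "b = w u * ennreal (1/2) ^ length u"
  have b: "b \<noteq> 0" 
    using w_pos[OF u(1)] by (auto simp: b_def)
  have "F (near_one n) g * b \<le> C * C" for n
  proof (rule cancel_Green_one[OF near_one_less[of n]])
    let ?s = "near_one n"
    have "Green ?s \<one> * (F ?s g * b) \<le> Green ?s \<one> * (F ?s g * (w u * ?s ^ length u))"
      unfolding b_def by (intro mult_left_mono power_mono near_one_ge_half) auto
    also have "\<dots> = (Green ?s \<one> * F ?s g) * (w u * ?s ^ length u)"
      by (simp add: ac_simps)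
    also have "\<dots> \<le> (C * Green ?s g) * (w u * ?s ^ length u)"
      using g by (intro mult_right_mono Green_one_mult_ge) auto
    also have "\<dots> = C * (Green ?s g * (w u * ?s ^ length u))"
      by (simp add: ac_simps)
    also have "\<dots> \<le> C * (C * Green ?s \<one>)"
      using u g by (intro mult_left_mono Green_mult_word) auto
    finally show "Green ?s \<one> * (F ?s g * b) \<le> Green ?s \<one> * (C * C)"
      by (simp add: ac_simps)
  qed
  then have "F 1 g * b \<le> C * C"
    unfolding gsum_one_SUP by (subst SUP_mult_right_ennreal) (auto intro: SUP_least)
  also have "\<dots> < \<infinity>"
    using C_fin by (simp add: ennreal_mult_less_top)
  finally show ?thesis
    using b by (auto simp: ennreal_mult_less_top)
qed

lemma F_one: "F s \<one> = 1"
proof -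
  have "first_visit \<one> = {[]}"
    using nil \<Psi>_nil by (auto simp: first_visit_def)
  then show ?thesis by (simp add: gsum_singleton w_nil)
qed

text \<open>Let \<open>T\<close> be the set of words with value \<open>\<one>\<close> whose path avoids \<open>k\<close>. A
  shortest word \<open>p\<close> with value \<open>k\<close> turns each word of \<open>T\<close> into a first visit to \<open>k\<close>, so \<open>T\<close> has finite
  total weight. Every other word with value \<open>\<one>\<close> passes through \<open>k\<close>, which yields
  \<open>Green s \<one> \<le> gsum 1 T + C\<^sup>2 (F 1 (inv k) * F 1 k) Green s \<one>\<close>. As the Green function diverges for
  \<open>s \<rightarrow> 1\<close>, the factor in front of it is at least 1. For an irreducible recurrent random walk \<open>F\<close> is
  identically 1.\<close>

lemma recurrent_F_inverse:
  assumes rec: "Green 1 \<one> = \<infinity>" and k: "k \<in> carrier G"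
  shows "1 \<le> C ^ 2 * (F 1 (inv k) * F 1 k)"
proof (rule ccontr)
  define T where "T = {u\<in>fiber \<one>. \<forall>x y. u = x @ y \<longrightarrow> y \<in> E \<longrightarrow> \<Psi> y \<noteq> k}"
  define D where "D = C ^ 2 * (F 1 (inv k) * F 1 k)"
  obtain p where p: "p \<in> E" "\<Psi> p = k" and min: "\<And>q. q \<in> E \<Longrightarrow> \<Psi> q = k \<Longrightarrow> length p \<le> length q"
    using \<Psi>_onto[OF k] arg_min_nat_lemma[of "\<lambda>q. q \<in> E \<and> \<Psi> q = k" _ length]
    by (metis (no_types, lifting))
  have "p @ u \<in> first_visit k" if u: "u \<in> T" for u
  proof -
    have uE: "u \<in> E" "\<Psi> u = \<one>" using u by (auto simp: T_def fiber_def)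
    have "\<Psi> y \<noteq> k" if y: "p @ u = x @ y" "x \<noteq> []" "y \<in> E" for x y
    proof
      assume yk: "\<Psi> y = k"
      from y(1) consider d where "p = x @ d" "y = d @ u" | d where "x = p @ d" "u = d @ y"
        by (auto simp: append_eq_append_conv2)
      then show False
      proof cases
        case (1 d)
        then have d: "d \<in> E" using cancel y uE by blast
        then have "\<Psi> d = k"
          using 1 yk uE \<Psi>_append[OF d uE(1)] \<Psi>_closed[OF d] by simp
        then show False using min[OF d] 1 y by simp
      next
        case (2 d)
        then show False using u y yk by (auto simp: T_def)
      qed
    qed
    then show ?thesis
      using p uE k by (auto simp: first_visit_def append \<Psi>_append)
  qed
  then have "gsum 1 {p} * gsum 1 T \<le> C * F 1 k"
    using p by (intro gsum_append_ge) (auto simp: inj_on_def T_def fiber_def)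
  also have "\<dots> < \<infinity>"
    using C_fin F_fin[OF k] by (simp add: ennreal_mult_less_top)
  finally have T_fin: "gsum 1 T < \<infinity>"
    using w_pos[OF p(1)] by (auto simp: gsum_singleton ennreal_mult_less_top)
  have bound: "Green (near_one n) \<one> \<le> gsum 1 T + D * Green (near_one n) \<one>" for n
  proof -
    let ?s = "near_one n"
    have "Green ?s \<one> = gsum ?s (T \<union> (fiber \<one> - T))"
      by (rule arg_cong[of _ _ "gsum ?s"]) (auto simp: T_def)
    also have "\<dots> = gsum ?s T + gsum ?s (fiber \<one> - T)"
      unfolding gsum_def by (intro infsum_Un_disjoint) (auto intro: nonneg_summable_on_complete)
    also have "gsum ?s (fiber \<one> - T) \<le> C * (Green ?s (inv k) * F ?s k)"
    proof (rule gsum_append_le[OF fiber_subset first_visit_subset])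
      fix z assume "z \<in> fiber \<one> - T"
      then obtain x y where z: "z \<in> E" "\<Psi> z = \<one>" "z = x @ y" "y \<in> E" "\<Psi> y = k"
        by (auto simp: T_def fiber_def)
      from first_visit_suffix[OF z(1,3-5)]
      obtain x' y' where xy: "z = x' @ y'" "x' \<in> E" "y' \<in> first_visit k" by auto
      then have y': "y' \<in> E" "\<Psi> y' = k" by (auto simp: first_visit_def)
      have "\<Psi> x' \<otimes> k = \<one>"
        using xy z y' \<Psi>_append[of x' y'] by simp
      then have "\<Psi> x' = inv k"
        using k xy \<Psi>_closed by (metis inv_equality)
      then show "\<exists>u\<in>fiber (inv k). \<exists>v\<in>first_visit k. z = u @ v"
        using xy by (auto simp: fiber_def)
    qed
    also have "\<dots> \<le> C * ((C * (Green ?s \<one> * F ?s (inv k))) * F ?s k)"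
      by (intro mult_left_mono mult_right_mono Green_le) auto
    also have "\<dots> = C ^ 2 * (F ?s (inv k) * F ?s k) * Green ?s \<one>"
      by (simp add: power2_eq_square ac_simps)
    also have "\<dots> \<le> D * Green ?s \<one>"
      unfolding D_def using near_one_less[of n]
      by (intro mult_right_mono mult_left_mono mult_mono gsum_mono) auto
    also have "gsum ?s T \<le> gsum 1 T"
      using near_one_less[of n] by (intro gsum_mono) auto
    finally show ?thesis
      by (simp add: add_mono)
  qed
  assume "\<not> 1 \<le> C ^ 2 * (F 1 (inv k) * F 1 k)"
  then have "D < 1" by (simp add: D_def)
  then obtain d where d: "D = ennreal d" "0 \<le> d" "d < 1"
    by (cases D) auto
  obtain b where b: "gsum 1 T = ennreal b" "0 \<le> b"
    using T_fin by (cases "gsum 1 T") auto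
  have "Green (near_one n) \<one> \<le> ennreal (b / (1 - d))" for n
  proof -
    obtain x where x: "Green (near_one n) \<one> = ennreal x" "0 \<le> x"
      using Green_one_fin[OF near_one_less] by (cases "Green (near_one n) \<one>") auto
    have "ennreal x \<le> ennreal (b + d * x)"
      using bound[of n] x d b by (simp add: ennreal_mult ennreal_plus)
    then have "x \<le> b + d * x"
      using b d x by (subst (asm) ennreal_le_iff) auto
    then show ?thesis
      using x d by (auto intro!: ennreal_leI simp: field_simps)
  qed
  then have "Green 1 \<one> \<le> ennreal (b / (1 - d))"
    unfolding gsum_one_SUP by (intro SUP_least)
  then show False using rec by (simp add: top_unique)
qed

end


section \<open>An almost invariant mean from recurrence\<close>

text \<open>By Tychonoff's theorem the sequence has a cluster point, and a cluster point inherits every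
  closed condition that holds eventually.\<close>

lemma compact_function_limit:
  fixes \<mu> :: "nat \<Rightarrow> 'x \<Rightarrow> real"
  assumes "\<And>n S. 0 \<le> \<mu> n S \<and> \<mu> n S \<le> 1"
  obtains m where "\<And>K. closed K \<Longrightarrow> eventually (\<lambda>n. \<mu> n \<in> K) sequentially \<Longrightarrow> m \<in> K"
proof -
  define U :: "('x \<Rightarrow> real) set" where "U = PiE UNIV (\<lambda>_. {0..1})"
  have "compactin (product_topology (\<lambda>_. euclidean) UNIV) U"
    unfolding U_def by (subst compactin_PiE) auto
  then have "compact U"
    by (simp add: euclidean_product_topology)
  moreover have "eventually (\<lambda>x. x \<in> U) (filtermap \<mu> sequentially)"
    unfolding eventually_filtermap using assms by (intro always_eventually allI) (simp add: U_def PiE_def Pi_def)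
  ultimately obtain m where m: "inf (nhds m) (filtermap \<mu> sequentially) \<noteq> bot"
    unfolding compact_filter by (metis filtermap_bot_iff sequentially_bot)
  show thesis
  proof (rule that)
    fix K :: "('x \<Rightarrow> real) set"
    assume K: "closed K" "eventually (\<lambda>n. \<mu> n \<in> K) sequentially"
    show "m \<in> K"
    proof (rule ccontr)
      assume "m \<notin> K"
      then have "eventually (\<lambda>x. x \<in> - K) (nhds m)"
        using K by (intro eventually_nhds_in_open) auto
      moreover have "eventually (\<lambda>x. x \<in> K) (filtermap \<mu> sequentially)"
        using K by (simp add: eventually_filtermap)
      ultimately have "eventually (\<lambda>x. False) (inf (nhds m) (filtermap \<mu> sequentially))"
        unfolding eventually_inf by (intro exI[of _ "\<lambda>x. x \<in> - K"] exI[of _ "\<lambda>x. x \<in> K"]) auto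
      then show False
        using m by (simp add: trivial_limit_def)
    qed
  qed
qed

context weighted_word_monoid
begin

definition layer :: "nat \<Rightarrow> 'g \<Rightarrow> 'a list set" where
  "layer n g = {u\<in>fiber g. length u = n}"

text \<open>A word with value \<open>\<one>\<close> has only one suffix of length \<open>n\<close>, so the pairs of a word with value \<open>g\<close> and
  a word of length \<open>n\<close> with value \<open>inv g\<close> have, over all \<open>g\<close> together, at most the weight of
  \<open>Green s \<one>\<close> times \<open>C\<close>.\<close>

lemma layer_sum_le:
  "(\<Sum>\<^sub>\<infinity>g\<in>carrier G. F 1 g * gsum 1 (layer n (inv g))) \<le> C ^ 2"
proof -
  have sub: "(\<Sum>\<^sub>\<infinity>g\<in>carrier G. F s g * gsum s (layer n (inv g))) \<le> C ^ 2" if s: "s < 1" for s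
  proof (rule cancel_Green_one[OF s])
    define \<kappa> where "\<kappa> z = inv (\<Psi> (drop (length z - n) z))" for z
    define T where "T = {z\<in>fiber \<one>. \<kappa> z \<in> carrier G}"
    have *: "Green s \<one> * (F s g * gsum s (layer n (inv g))) \<le> C ^ 2 * gsum s {z\<in>T. \<kappa> z = g}"
      if g: "g \<in> carrier G" for g
    proof -
      have "Green s \<one> * (F s g * gsum s (layer n (inv g))) =
          (Green s \<one> * F s g) * gsum s (layer n (inv g))"
        by (simp add: ac_simps)
      also have "\<dots> \<le> (C * Green s g) * gsum s (layer n (inv g))"
        using g by (intro mult_right_mono Green_one_mult_ge) auto
      also have "\<dots> = C * (Green s g * gsum s (layer n (inv g)))"
        by (simp add: ac_simps)
      also have "\<dots> \<le> C * (C * gsum s {z\<in>T. \<kappa> z = g})"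
      proof (intro mult_left_mono gsum_append_ge)
        show "inj_on (\<lambda>(u, v). u @ v) (fiber g \<times> layer n (inv g))"
          by (auto simp: inj_on_def layer_def)
        show "u @ v \<in> {z\<in>T. \<kappa> z = g}" if "u \<in> fiber g" "v \<in> layer n (inv g)" for u v
          using that g by (auto simp: T_def \<kappa>_def fiber_def layer_def append \<Psi>_append)
      qed (auto simp: fiber_def layer_def)
      finally show ?thesis by (simp add: power2_eq_square ac_simps)
    qed
    have "Green s \<one> * (\<Sum>\<^sub>\<infinity>g\<in>carrier G. F s g * gsum s (layer n (inv g))) =
        (\<Sum>\<^sub>\<infinity>g\<in>carrier G. Green s \<one> * (F s g * gsum s (layer n (inv g))))"
      by (rule infsum_ennreal_cmult[symmetric])
    also have "\<dots> \<le> (\<Sum>\<^sub>\<infinity>g\<in>carrier G. C ^ 2 * gsum s {z\<in>T. \<kappa> z = g})"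
      using * by (intro infsum_ennreal_mono) auto
    also have "\<dots> = C ^ 2 * (\<Sum>\<^sub>\<infinity>g\<in>carrier G. gsum s {z\<in>T. \<kappa> z = g})"
      by (rule infsum_ennreal_cmult)
    also have "(\<Sum>\<^sub>\<infinity>g\<in>carrier G. gsum s {z\<in>T. \<kappa> z = g}) = gsum s T"
      unfolding gsum_def by (rule infsum_ennreal_partition[symmetric]) (simp add: T_def)
    also have "C ^ 2 * gsum s T \<le> C ^ 2 * Green s \<one>"
      by (intro mult_left_mono gsum_mono) (auto simp: T_def)
    finally show "Green s \<one> * (\<Sum>\<^sub>\<infinity>g\<in>carrier G. F s g * gsum s (layer n (inv g))) \<le>
        Green s \<one> * C ^ 2" by (simp add: ac_simps)
  qed
  have inc: "incseq (\<lambda>m. F (near_one m) g * gsum (near_one m) (layer n (inv g)))" for g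
    by (intro monoI mult_mono) (auto intro: monoD[OF incseq_gsum])
  have "(\<Sum>\<^sub>\<infinity>g\<in>carrier G. F 1 g * gsum 1 (layer n (inv g))) \<le>
      (\<Sum>\<^sub>\<infinity>g\<in>carrier G. SUP m. F (near_one m) g * gsum (near_one m) (layer n (inv g)))"
    unfolding gsum_one_SUP
    by (intro infsum_ennreal_mono mult_SUP_le_ennreal incseq_gsum SUP_upper order_refl) auto
  also have "\<dots> = (SUP m. \<Sum>\<^sub>\<infinity>g\<in>carrier G. F (near_one m) g * gsum (near_one m) (layer n (inv g)))"
    by (rule infsum_ennreal_incseq_SUP[OF inc])
  also have "\<dots> \<le> C ^ 2"
    using sub near_one_less by (intro SUP_least) auto
  finally show ?thesis .
qed

text \<open>Multiplying the weight of a word with value \<open>h\<close> by \<open>F 1 (inv h)\<close> makes the words of each length have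
  bounded total weight, as if they were the paths of a random walk. The measure is written in terms of
  \<open>g = inv h\<close>, because appending a word then becomes a translation from the left.\<close>

definition twisted_mass :: "ennreal \<Rightarrow> 'g set \<Rightarrow> ennreal" where
  "twisted_mass t S = (\<Sum>\<^sub>\<infinity>g\<in>S. F 1 g * Green t (inv g))"

lemma twisted_mass_fin:
  assumes "t < 1"
  shows "twisted_mass t (carrier G) < \<infinity>"
proof -
  have layers: "Green t h = (\<Sum>\<^sub>\<infinity>n\<in>UNIV. t ^ n * gsum 1 (layer n h))" for h
  proof -
    have "Green t h = (\<Sum>\<^sub>\<infinity>n\<in>UNIV. \<Sum>\<^sub>\<infinity>u\<in>{u\<in>fiber h. length u = n}. w u * t ^ length u)"
      unfolding gsum_def by (rule infsum_ennreal_partition) auto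
    also have "\<dots> = (\<Sum>\<^sub>\<infinity>n\<in>UNIV. t ^ n * gsum 1 (layer n h))"
    proof (rule infsum_cong)
      fix n
      have "(\<Sum>\<^sub>\<infinity>u\<in>{u\<in>fiber h. length u = n}. w u * t ^ length u) =
          (\<Sum>\<^sub>\<infinity>u\<in>layer n h. t ^ n * (w u * 1 ^ length u))"
        unfolding layer_def by (rule infsum_cong) (auto simp: mult.commute)
      then show "(\<Sum>\<^sub>\<infinity>u\<in>{u\<in>fiber h. length u = n}. w u * t ^ length u) = t ^ n * gsum 1 (layer n h)"
        unfolding gsum_def by (simp only: infsum_ennreal_cmult)
    qed
    finally show ?thesis .
  qed
  have "twisted_mass t (carrier G) =
      (\<Sum>\<^sub>\<infinity>g\<in>carrier G. \<Sum>\<^sub>\<infinity>n\<in>UNIV. t ^ n * (F 1 g * gsum 1 (layer n (inv g))))"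
    unfolding twisted_mass_def layers infsum_ennreal_cmult[symmetric] by (simp add: ac_simps)
  also have "\<dots> = (\<Sum>\<^sub>\<infinity>n\<in>UNIV. \<Sum>\<^sub>\<infinity>g\<in>carrier G. t ^ n * (F 1 g * gsum 1 (layer n (inv g))))"
    by (rule infsum_ennreal_swap)
  also have "\<dots> \<le> (\<Sum>\<^sub>\<infinity>n\<in>UNIV. t ^ n * C ^ 2)"
    unfolding infsum_ennreal_cmult by (intro infsum_ennreal_mono mult_left_mono layer_sum_le) auto
  also have "\<dots> = (\<Sum>\<^sub>\<infinity>n\<in>UNIV. t ^ n) * C ^ 2"
    by (rule infsum_ennreal_cmult_right)
  also have "\<dots> < \<infinity>"
    using infsum_geometric_ennreal[OF assms] C_fin
    by (simp add: ennreal_mult_less_top power_less_top_ennreal)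
  finally show ?thesis .
qed

text \<open>Words with value \<open>inv g\<close> are extended by first visits to \<open>inv k\<close>. The extended words have value
  \<open>inv (k \<otimes> g)\<close>, and first visits allow to recover the parts.\<close>

lemma twisted_mass_shift:
  assumes k: "k \<in> carrier G" and S: "S \<subseteq> carrier G"
  shows "F 1 k * F t (inv k) * twisted_mass t S \<le> C ^ 4 * twisted_mass t (k <#\<^bsub>G\<^esub> S)"
proof -
  have "F 1 k * F t (inv k) * twisted_mass t S =
      (\<Sum>\<^sub>\<infinity>g\<in>S. (F 1 k * F 1 g) * (Green t (inv g) * F t (inv k)))"
    unfolding twisted_mass_def infsum_ennreal_cmult[symmetric] by (simp add: ac_simps)
  also have "\<dots> \<le> (\<Sum>\<^sub>\<infinity>h\<in>k <#\<^bsub>G\<^esub> S. C ^ 4 * (F 1 h * Green t (inv h)))"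
  proof (rule infsum_ennreal_inj_le[where h = "\<lambda>g. k \<otimes> g"])
    show "inj_on (\<lambda>g. k \<otimes> g) S"
      using inj_on_cmult[OF k] S by (rule inj_on_subset)
    show "(\<lambda>g. k \<otimes> g) ` S \<subseteq> k <#\<^bsub>G\<^esub> S"
      by (auto simp: l_coset_def)
    fix g assume "g \<in> S"
    then have g: "g \<in> carrier G" using S by auto
    have "(F 1 k * F 1 g) * (Green t (inv g) * F t (inv k)) \<le>
        (C ^ 3 * F 1 (k \<otimes> g)) * (C * Green t (inv g \<otimes> inv k))"
      using k g by (intro mult_mono F_mult_ge Green_mult_ge) auto
    then show "(F 1 k * F 1 g) * (Green t (inv g) * F t (inv k)) \<le>
        C ^ 4 * (F 1 (k \<otimes> g) * Green t (inv (k \<otimes> g)))"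
      using k g by (simp add: inv_mult_group ac_simps eval_nat_numeral)
  qed
  finally show ?thesis
    by (simp add: infsum_ennreal_cmult twisted_mass_def)
qed

text \<open>For \<open>t\<close> close to 1 the factor \<open>F 1 k * F t (inv k)\<close> in the preceding lemma is bounded below by a
  constant that does not depend on \<open>k\<close>. Hence a cluster point of the normalised measures is a mean
  that is quasi-invariant with a uniform constant.\<close>

theorem amenable_if_recurrent:
  assumes rec: "Green 1 \<one> = \<infinity>"
  shows "amenable G"
proof -
  define N where "N n = twisted_mass (near_one n) (carrier G)" for n
  define \<mu> where "\<mu> n S = enn2real (twisted_mass (near_one n) (S \<inter> carrier G)) / enn2real (N n)" for n S
  define c where "c = 1 / (2 * enn2real C ^ 6)"
  have mass_mono: "twisted_mass t S \<le> twisted_mass t T" if "S \<subseteq> T" for t S T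
    unfolding twisted_mass_def using that by (intro infsum_ennreal_mono) auto
  have mass_fin: "twisted_mass (near_one n) S < \<infinity>" if "S \<subseteq> carrier G" for n S
    using mass_mono[OF that] twisted_mass_fin[OF near_one_less] by (rule le_less_trans)
  have N_pos: "0 < enn2real (N n)" for n
  proof -
    have "1 \<le> F 1 \<one> * Green (near_one n) (inv \<one>)"
      using Green_one_ge by (simp add: F_one)
    also have "\<dots> = twisted_mass (near_one n) {\<one>}"
      by (simp add: twisted_mass_def)
    also have "\<dots> \<le> N n"
      unfolding N_def by (intro mass_mono) auto
    finally have "0 < N n" by (rule less_le_trans[OF zero_less_one])
    then show ?thesis
      using mass_fin[of "carrier G" n] by (simp add: enn2real_positive_iff N_def)
  qed
  have "0 \<le> \<mu> n S \<and> \<mu> n S \<le> 1" for n S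
  proof -
    have "enn2real (twisted_mass (near_one n) (S \<inter> carrier G)) \<le> enn2real (N n)"
      unfolding N_def using mass_fin[of "carrier G" n] by (intro enn2real_mono mass_mono) auto
    then show ?thesis using N_pos[of n] by (simp add: \<mu>_def)
  qed
  then obtain m where m: "\<And>K. closed K \<Longrightarrow> eventually (\<lambda>n. \<mu> n \<in> K) sequentially \<Longrightarrow> m \<in> K"
    using compact_function_limit[of \<mu>] by blast
  have coord: "continuous_on UNIV (\<lambda>f :: 'g set \<Rightarrow> real. f S)" for S
    by (rule continuous_on_product_coordinates)
  have C_real: "1 \<le> enn2real C" "ennreal (enn2real C) = C"
    using C_ge_1 C_fin by (auto simp: enn2real_le_iff[symmetric] less_top dest: enn2real_mono)
  show ?thesis
  proof (rule amenable_of_quasi_invariant_mean[where \<mu> = m and c = c])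
    show "additive (Pow (carrier G)) m"
      unfolding additive_def
    proof (intro ballI impI)
      fix S T assume ST: "S \<in> Pow (carrier G)" "T \<in> Pow (carrier G)" "S \<inter> T = {}"
      have "m \<in> {f. f (S \<union> T) = f S + f T}"
      proof (rule m)
        show "closed {f :: 'g set \<Rightarrow> real. f (S \<union> T) = f S + f T}"
          by (rule closed_Collect_eq; intro continuous_on_add coord)
        have "\<mu> n (S \<union> T) = \<mu> n S + \<mu> n T" for n
        proof -
          have "twisted_mass (near_one n) (S \<union> T) = twisted_mass (near_one n) S + twisted_mass (near_one n) T"
            unfolding twisted_mass_def using ST
            by (intro infsum_Un_disjoint) (auto intro: nonneg_summable_on_complete)
          moreover have "(S \<union> T) \<inter> carrier G = S \<union> T" "S \<inter> carrier G = S" "T \<inter> carrier G = T"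
            using ST by auto
          ultimately show ?thesis
            using ST mass_fin[of S n] mass_fin[of T n]
            by (simp add: \<mu>_def enn2real_plus add_divide_distrib)
        qed
        then show "eventually (\<lambda>n. \<mu> n \<in> {f. f (S \<union> T) = f S + f T}) sequentially"
          by simp
      qed
      then show "m (S \<union> T) = m S + m T" by simp
    qed
    have "m \<in> {f. f (carrier G) = 1}"
      using N_pos by (intro m closed_Collect_eq coord continuous_on_const)
        (auto simp: \<mu>_def N_def less_imp_neq[symmetric])
    then show "m (carrier G) = 1" by simp
    show "0 \<le> m S" for S
    proof -
      have "m \<in> {f. 0 \<le> f S}"
        by (intro m closed_Collect_le coord continuous_on_const) (auto simp: \<mu>_def)
      then show ?thesis by simp
    qed
    show "0 < c"
      using C_real by (simp add: c_def)
    show "c * m S \<le> m (k <#\<^bsub>G\<^esub> S)" if k: "k \<in> carrier G" and S: "S \<subseteq> carrier G" for k S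
    proof -
      have "1 \<le> C ^ 2 * (F 1 k * F 1 (inv k))"
        using recurrent_F_inverse[OF rec, of "inv k"] k by simp
      also have "\<dots> = (SUP n. C ^ 2 * (F 1 k * F (near_one n) (inv k)))"
        unfolding gsum_one_SUP[of "first_visit (inv k)"] by (simp add: SUP_mult_left_ennreal)
      finally have "ennreal (1/2) < (SUP n. C ^ 2 * (F 1 k * F (near_one n) (inv k)))"
        by (rule less_le_trans[rotated]) (simp add: ennreal_less_one_iff del: ennreal_half)
      then obtain n0 where n0: "ennreal (1/2) < C ^ 2 * (F 1 k * F (near_one n0) (inv k))"
        by (auto simp: less_SUP_iff)
      have "c * \<mu> n S \<le> \<mu> n (k <#\<^bsub>G\<^esub> S)" if "n \<ge> n0" for n
      proof -
        let ?t = "near_one n"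
        have kS: "k <#\<^bsub>G\<^esub> S \<subseteq> carrier G"
          using k S by (rule l_coset_subset)
        have "ennreal (1/2) * twisted_mass ?t S \<le>
            (C ^ 2 * (F 1 k * F (near_one n0) (inv k))) * twisted_mass ?t S"
          using n0 by (intro mult_right_mono) auto
        also have "\<dots> \<le> (C ^ 2 * (F 1 k * F ?t (inv k))) * twisted_mass ?t S"
          using monoD[OF incseq_near_one that]
          by (intro mult_right_mono mult_left_mono gsum_mono) auto
        also have "\<dots> = C ^ 2 * (F 1 k * F ?t (inv k) * twisted_mass ?t S)"
          by (simp add: ac_simps)
        also have "\<dots> \<le> C ^ 2 * (C ^ 4 * twisted_mass ?t (k <#\<^bsub>G\<^esub> S))"
          by (intro mult_left_mono twisted_mass_shift k S) auto
        also have "\<dots> = ennreal (enn2real C ^ 6) * twisted_mass ?t (k <#\<^bsub>G\<^esub> S)"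
          using C_real by (simp add: ennreal_power[symmetric] mult.assoc[symmetric] power_add[symmetric])
        finally have *: "ennreal (1/2) * twisted_mass ?t S \<le>
            ennreal (enn2real C ^ 6) * twisted_mass ?t (k <#\<^bsub>G\<^esub> S)" .
        have "enn2real (ennreal (1/2) * twisted_mass ?t S) \<le>
            enn2real (ennreal (enn2real C ^ 6) * twisted_mass ?t (k <#\<^bsub>G\<^esub> S))"
          using mass_fin[OF kS, of n] by (intro enn2real_mono[OF *]) (simp add: ennreal_mult_less_top)
        then have "1/2 * enn2real (twisted_mass ?t S) \<le>
            enn2real C ^ 6 * enn2real (twisted_mass ?t (k <#\<^bsub>G\<^esub> S))"
          by (simp add: enn2real_mult del: ennreal_half)
        then have "c * enn2real (twisted_mass ?t S) \<le> enn2real (twisted_mass ?t (k <#\<^bsub>G\<^esub> S))"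
          using C_real(1) by (simp add: c_def field_simps)
        then have "c * enn2real (twisted_mass ?t S) / enn2real (N n) \<le>
            enn2real (twisted_mass ?t (k <#\<^bsub>G\<^esub> S)) / enn2real (N n)"
          using N_pos[of n] by (intro divide_right_mono) auto
        then show ?thesis
          using kS S by (simp add: \<mu>_def Int_absorb2)
      qed
      then have "m \<in> {f. c * f S \<le> f (k <#\<^bsub>G\<^esub> S)}"
        by (intro m closed_Collect_le continuous_on_mult continuous_on_const coord)
          (auto simp: eventually_sequentially)
      then show ?thesis by simp
    qed
  qed
qed

section \<open>Finiteness from positive recurrence\<close>

text \<open>The words that correspond to first returns of the path to the unit.\<close>

definition primes :: "'a list set" where
  "primes = {u\<in>fiber \<one>. u \<noteq> [] \<and>
     (\<forall>x y. u = x @ y \<longrightarrow> x \<noteq> [] \<longrightarrow> y \<noteq> [] \<longrightarrow> y \<in> E \<longrightarrow> \<Psi> y \<noteq> \<one>)}"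

definition excursion :: "'g \<Rightarrow> 'a list set" where
  "excursion g = {u\<in>fiber g. \<forall>x y. u = x @ y \<longrightarrow> y \<noteq> [] \<longrightarrow> y \<in> E \<longrightarrow> \<Psi> y \<noteq> \<one>}"

text \<open>A word is cut before its longest suffix with value \<open>\<one>\<close>.\<close>

lemma Green_le_excursion: "Green s g \<le> C * (gsum s (excursion g) * Green s \<one>)"
proof (rule gsum_append_le)
  fix z assume "z \<in> fiber g"
  then have z: "z \<in> E" "\<Psi> z = g" by (auto simp: fiber_def)
  define P where "P n \<longleftrightarrow> (\<exists>x y. z = x @ y \<and> y \<in> fiber \<one> \<and> length x = n)" for n
  have "P (length z)"
    using nil \<Psi>_nil by (auto simp: P_def fiber_def)
  then have "P (LEAST n. P n)"
    by (rule LeastI)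
  then obtain x y where xy: "z = x @ y" "y \<in> E" "\<Psi> y = \<one>" "length x = (LEAST n. P n)"
    by (auto simp: P_def fiber_def)
  have x: "x \<in> E" using cancel z xy by auto
  then have "\<Psi> x = g"
    using z xy \<Psi>_append[of x y] \<Psi>_closed[of x] by simp
  moreover have "\<Psi> b \<noteq> \<one>" if "x = a @ b" "b \<noteq> []" "b \<in> E" for a b
  proof
    assume "\<Psi> b = \<one>"
    then have "z = a @ (b @ y)" "b @ y \<in> fiber \<one>"
      using that xy by (auto simp: fiber_def append \<Psi>_append)
    then have "P (length a)"
      unfolding P_def by blast
    then have "length x \<le> length a"
      using xy by (simp add: Least_le)
    then show False using that by simp
  qed
  ultimately show "\<exists>u\<in>excursion g. \<exists>v\<in>fiber \<one>. z = u @ v"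
    using x xy by (auto simp: excursion_def fiber_def)
qed (auto simp: excursion_def fiber_def)

lemma F_le_excursion:
  assumes g: "g \<in> carrier G"
  shows "F 1 g \<le> C ^ 2 * gsum 1 (excursion g)"
  unfolding gsum_one_SUP[of "first_visit g"]
proof (rule SUP_least)
  fix n
  let ?s = "near_one n"
  have "F ?s g \<le> C ^ 2 * gsum ?s (excursion g)"
  proof (rule cancel_Green_one[OF near_one_less[of n]])
    have "Green ?s \<one> * F ?s g \<le> C * Green ?s g"
      by (rule Green_one_mult_ge[OF g])
    also have "\<dots> \<le> C * (C * (gsum ?s (excursion g) * Green ?s \<one>))"
      by (intro mult_left_mono Green_le_excursion) auto
    finally show "Green ?s \<one> * F ?s g \<le> Green ?s \<one> * (C ^ 2 * gsum ?s (excursion g))"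
      by (simp add: power2_eq_square ac_simps)
  qed
  also have "\<dots> \<le> C ^ 2 * gsum 1 (excursion g)"
    using near_one_less[of n] by (intro mult_left_mono gsum_mono) auto
  finally show "F ?s g \<le> C ^ 2 * gsum 1 (excursion g)" .
qed

text \<open>The weighted length of the first returns counts pairs of a first return and a position in it. The
  value of the part before the position sorts these pairs according to the elements of the group. A
  first visit to \<open>g\<close> followed by an excursion with value \<open>inv g\<close> is a first return, so an element
  \<open>g \<noteq> \<one>\<close> receives at least the weight \<open>F 1 g * gsum 1 (excursion (inv g)) / C\<close>, which is bounded below
  by recurrence. A finite total therefore leaves room for finitely many elements only.\<close>

theorem finite_if_positive_recurrent:
  assumes rec: "Green 1 \<one> = \<infinity>"
    and pos: "(\<Sum>\<^sub>\<infinity>u\<in>primes. of_nat (length u) * w u) < \<infinity>"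
  shows "finite (carrier G)"
proof (rule ccontr)
  assume inf: "infinite (carrier G)"
  define P where "P = {(z, j). z \<in> primes \<and> j < length z}"
  define K where "K = carrier G - {\<one>}"
  have P_sum: "(\<Sum>\<^sub>\<infinity>(z, j)\<in>P. w z) = (\<Sum>\<^sub>\<infinity>u\<in>primes. of_nat (length u) * w u)"
  proof -
    have "(\<Sum>\<^sub>\<infinity>(z, j)\<in>P. w z) = (\<Sum>\<^sub>\<infinity>u\<in>primes. \<Sum>\<^sub>\<infinity>(z, j)\<in>{p\<in>P. fst p = u}. w z)"
      by (rule infsum_ennreal_partition) (auto simp: P_def)
    also have "\<dots> = (\<Sum>\<^sub>\<infinity>u\<in>primes. of_nat (length u) * w u)"
    proof (rule infsum_cong)
      fix u assume "u \<in> primes"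
      then have "{p\<in>P. fst p = u} = {u} \<times> {..<length u}"
        by (auto simp: P_def)
      then show "(\<Sum>\<^sub>\<infinity>(z, j)\<in>{p\<in>P. fst p = u}. w z) = of_nat (length u) * w u"
        by (simp add: sum.cartesian_product[symmetric])
    qed
    finally show ?thesis .
  qed
  have piece: "1 \<le> C ^ 5 * (\<Sum>\<^sub>\<infinity>(z, j)\<in>{p\<in>P. \<Psi> (take (snd p) (fst p)) = g}. w z)" if g: "g \<in> K" for g
  proof -
    have gG: "g \<in> carrier G" "g \<noteq> \<one>" using g by (auto simp: K_def)
    let ?Q = "{p\<in>P. \<Psi> (take (snd p) (fst p)) = g}"
    have split: "u @ v \<in> primes \<and> length u < length (u @ v)"
      if u: "u \<in> first_visit g" and v: "v \<in> excursion (inv g)" for u v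
    proof -
      have uv: "u \<in> E" "\<Psi> u = g" "v \<in> E" "\<Psi> v = inv g"
        using u v by (auto simp: first_visit_def excursion_def fiber_def)
      have "v \<noteq> []"
        using uv gG \<Psi>_nil by (metis inv_eq_1_iff)
      moreover have "\<Psi> y \<noteq> \<one>" if y: "u @ v = x @ y" "x \<noteq> []" "y \<noteq> []" "y \<in> E" for x y
      proof
        assume y1: "\<Psi> y = \<one>"
        from y(1) consider d where "u = x @ d" "y = d @ v" | d where "x = u @ d" "v = d @ y"
          by (auto simp: append_eq_append_conv2)
        then show False
        proof cases
          case (1 d)
          then have d: "d \<in> E" using cancel y uv by blast
          have "\<Psi> d \<otimes> inv g = \<one>"
            using 1 y1 uv \<Psi>_append[OF d, of v] by simp
          then have "\<Psi> d = g"
            using gG \<Psi>_closed[OF d] by (metis inv_closed inv_equality inv_inv)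
          then show False
            using u 1 y d by (auto simp: first_visit_def)
        next
          case (2 d)
          then show False using v y y1 by (auto simp: excursion_def)
        qed
      qed
      ultimately show ?thesis
        using uv gG by (auto simp: primes_def fiber_def append \<Psi>_append)
    qed
    have "gsum 1 (first_visit g) * gsum 1 (excursion (inv g)) =
        (\<Sum>\<^sub>\<infinity>(u, v)\<in>first_visit g \<times> excursion (inv g). w u * w v)"
      unfolding gsum_def by (simp add: infsum_ennreal_product)
    also have "\<dots> \<le> (\<Sum>\<^sub>\<infinity>p\<in>?Q. C * (case p of (z, j) \<Rightarrow> w z))"
    proof (rule infsum_ennreal_inj_le[where h = "\<lambda>(u, v). (u @ v, length u)"])
      show "inj_on (\<lambda>(u, v). (u @ v, length u)) (first_visit g \<times> excursion (inv g))"
        by (auto simp: inj_on_def)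
      show "(\<lambda>(u, v). (u @ v, length u)) ` (first_visit g \<times> excursion (inv g)) \<subseteq> ?Q"
      proof (clarsimp, intro conjI)
        fix u v assume uv: "u \<in> first_visit g" "v \<in> excursion (inv g)"
        show "(u @ v, length u) \<in> P"
          using split[OF uv] by (simp add: P_def)
        show "\<Psi> u = g"
          using uv by (simp add: first_visit_def)
      qed
      show "(case p of (u, v) \<Rightarrow> w u * w v) \<le>
          C * (case (case p of (u, v) \<Rightarrow> (u @ v, length u)) of (z, j) \<Rightarrow> w z)"
        if "p \<in> first_visit g \<times> excursion (inv g)" for p
        using that by (cases p) (auto intro!: w_append_ge simp: first_visit_def excursion_def fiber_def)
    qed
    also have "\<dots> = C * (\<Sum>\<^sub>\<infinity>(z, j)\<in>?Q. w z)"
      by (rule infsum_ennreal_cmult)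
    finally have *: "F 1 g * gsum 1 (excursion (inv g)) \<le> C * (\<Sum>\<^sub>\<infinity>(z, j)\<in>?Q. w z)" .
    have "1 \<le> C ^ 2 * (F 1 g * F 1 (inv g))"
      using recurrent_F_inverse[OF rec, of "inv g"] gG by simp
    also have "\<dots> \<le> C ^ 2 * (F 1 g * (C ^ 2 * gsum 1 (excursion (inv g))))"
      using gG by (intro mult_left_mono F_le_excursion) auto
    also have "\<dots> = C ^ 4 * (F 1 g * gsum 1 (excursion (inv g)))"
      by (simp add: ac_simps eval_nat_numeral)
    also have "\<dots> \<le> C ^ 4 * (C * (\<Sum>\<^sub>\<infinity>(z, j)\<in>?Q. w z))"
      by (intro mult_left_mono *) auto
    finally show ?thesis
      by (simp add: ac_simps eval_nat_numeral)
  qed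
  define Q where "Q = {p\<in>P. \<Psi> (take (snd p) (fst p)) \<in> K}"
  have "(\<Sum>\<^sub>\<infinity>g\<in>K. (1::ennreal)) \<le>
      (\<Sum>\<^sub>\<infinity>g\<in>K. C ^ 5 * (\<Sum>\<^sub>\<infinity>(z, j)\<in>{p\<in>Q. \<Psi> (take (snd p) (fst p)) = g}. w z))"
  proof (rule infsum_ennreal_mono[OF order_refl])
    fix g assume g: "g \<in> K"
    then have "{p\<in>P. \<Psi> (take (snd p) (fst p)) = g} = {p\<in>Q. \<Psi> (take (snd p) (fst p)) = g}"
      by (auto simp: Q_def)
    then show "1 \<le> C ^ 5 * (\<Sum>\<^sub>\<infinity>(z, j)\<in>{p\<in>Q. \<Psi> (take (snd p) (fst p)) = g}. w z)"
      using piece[OF g] by simp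
  qed
  also have "\<dots> = C ^ 5 * (\<Sum>\<^sub>\<infinity>g\<in>K. \<Sum>\<^sub>\<infinity>(z, j)\<in>{p\<in>Q. \<Psi> (take (snd p) (fst p)) = g}. w z)"
    by (rule infsum_ennreal_cmult)
  also have "(\<Sum>\<^sub>\<infinity>g\<in>K. \<Sum>\<^sub>\<infinity>(z, j)\<in>{p\<in>Q. \<Psi> (take (snd p) (fst p)) = g}. w z) = (\<Sum>\<^sub>\<infinity>(z, j)\<in>Q. w z)"
    by (rule infsum_ennreal_partition[symmetric]) (simp add: Q_def)
  also have "(\<Sum>\<^sub>\<infinity>(z, j)\<in>Q. w z) \<le> (\<Sum>\<^sub>\<infinity>(z, j)\<in>P. w z)"
    by (rule infsum_ennreal_mono) (auto simp: Q_def)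
  finally have "(\<Sum>\<^sub>\<infinity>g\<in>K. (1::ennreal)) \<le> C ^ 5 * (\<Sum>\<^sub>\<infinity>(z, j)\<in>P. w z)"
    by (simp add: mult_left_mono)
  also have "\<dots> < \<infinity>"
    using C_fin pos by (simp add: P_sum ennreal_mult_less_top power_less_top_ennreal)
  finally have "(\<Sum>\<^sub>\<infinity>g\<in>K. (1::ennreal)) < \<infinity>" .
  moreover have "(\<Sum>\<^sub>\<infinity>g\<in>K. (1::ennreal)) = \<infinity>"
    using inf by (intro infsum_superconst_infinite_ennreal[where b = 1]) (auto simp: K_def)
  ultimately show False by simp
qed

end


section \<open>Periodic points and words of a Markov shift\<close>

lemma left_shift_funpow: "(left_shift ^^ k) x = (\<lambda>j. x (k + j))"
  by (induction k) (auto simp: left_shift_def)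

lemma shift_space_funpow: "x \<in> shift_space I A \<Longrightarrow> (left_shift ^^ k) x \<in> shift_space I A"
  by (auto simp: left_shift_funpow shift_space_def)

lemma birkhoff_sum_add:
  "birkhoff_sum (n + m) f x = birkhoff_sum n f x + birkhoff_sum m f ((left_shift ^^ n) x)"
proof -
  have "(\<Sum>k<n + m. f ((left_shift ^^ k) x)) =
      (\<Sum>k<n. f ((left_shift ^^ k) x)) + (\<Sum>k\<in>{n..<n + m}. f ((left_shift ^^ k) x))"
    by (simp add: lessThan_atLeast0 sum.atLeastLessThan_concat)
  also have "(\<Sum>k\<in>{n..<n + m}. f ((left_shift ^^ k) x)) = (\<Sum>k<m. f ((left_shift ^^ (k + n)) x))"
    using sum.shift_bounds_nat_ivl[of "\<lambda>k. f ((left_shift ^^ k) x)" 0 n m]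
    by (simp add: lessThan_atLeast0 add.commute)
  finally show ?thesis
    by (simp add: birkhoff_sum_def funpow_add)
qed

text \<open>The points \<open>\<sigma>\<^sup>k x\<close> and \<open>\<sigma>\<^sup>k y\<close> agree on their first \<open>n - k\<close> letters, so the differences are bounded by
  a geometric series. At least one common letter is left for each \<open>k < n\<close>, as the Hoelder condition
  demands.\<close>

lemma bounded_distortion:
  assumes "hoelder_continuous I A f"
  obtains d where "0 \<le> d"
    "\<And>n x y. x \<in> shift_space I A \<Longrightarrow> y \<in> shift_space I A \<Longrightarrow> (\<And>k. k < n \<Longrightarrow> x k = y k) \<Longrightarrow>
       \<bar>birkhoff_sum n f x - birkhoff_sum n f y\<bar> \<le> d"
proof -
  obtain \<alpha> V where \<alpha>: "\<alpha> > 0" and V: "\<And>x y. x \<in> shift_space I A \<Longrightarrow> y \<in> shift_space I A \<Longrightarrow>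
      x 0 = y 0 \<Longrightarrow> x \<noteq> y \<Longrightarrow> \<bar>f x - f y\<bar> \<le> V * exp (- \<alpha> * real (common_length x y))"
    using assms unfolding hoelder_continuous_def by blast
  define r where "r = exp (- \<alpha>)"
  have r: "0 < r" "r < 1" using \<alpha> by (auto simp: r_def)
  have "\<bar>birkhoff_sum n f x - birkhoff_sum n f y\<bar> \<le> \<bar>V\<bar> * (1 / (1 - r))"
    if x: "x \<in> shift_space I A" and y: "y \<in> shift_space I A" and eq: "\<And>k. k < n \<Longrightarrow> x k = y k" for n x y
  proof -
    have one: "\<bar>f ((left_shift ^^ k) x) - f ((left_shift ^^ k) y)\<bar> \<le> \<bar>V\<bar> * r ^ (n - k)" if k: "k < n" for k
    proof (cases "(left_shift ^^ k) x = (left_shift ^^ k) y")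
      case False
      let ?x = "(left_shift ^^ k) x" and ?y = "(left_shift ^^ k) y"
      have "n - k \<le> common_length ?x ?y"
        unfolding common_length_def
      proof (rule LeastI2_ex)
        show "\<exists>j. ?x j \<noteq> ?y j" using False by auto
        show "n - k \<le> j" if "?x j \<noteq> ?y j" for j
          using that eq[of "k + j"] by (force simp: left_shift_funpow)
      qed
      then have "exp (- \<alpha> * real (common_length ?x ?y)) \<le> exp (- \<alpha> * real (n - k))"
        using \<alpha> by simp
      also have "\<dots> = r ^ (n - k)"
        by (simp add: r_def exp_of_nat_mult[symmetric] mult.commute)
      finally have e: "exp (- \<alpha> * real (common_length ?x ?y)) \<le> r ^ (n - k)" .
      have "\<bar>f ?x - f ?y\<bar> \<le> V * exp (- \<alpha> * real (common_length ?x ?y))"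
        using False eq[OF k] by (intro V shift_space_funpow x y) (auto simp: left_shift_funpow)
      also have "\<dots> \<le> \<bar>V\<bar> * exp (- \<alpha> * real (common_length ?x ?y))"
        by (intro mult_right_mono) auto
      also have "\<dots> \<le> \<bar>V\<bar> * r ^ (n - k)"
        using e by (intro mult_left_mono) auto
      finally show ?thesis .
    qed (use r in auto)
    have "\<bar>birkhoff_sum n f x - birkhoff_sum n f y\<bar> \<le>
        (\<Sum>k<n. \<bar>f ((left_shift ^^ k) x) - f ((left_shift ^^ k) y)\<bar>)"
      unfolding birkhoff_sum_def sum_subtractf[symmetric] by (rule sum_abs)
    also have "\<dots> \<le> (\<Sum>k<n. \<bar>V\<bar> * r ^ (n - k))"
      using one by (intro sum_mono) auto
    also have "\<dots> = \<bar>V\<bar> * (\<Sum>k<n. r ^ (n - k))"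
      by (simp add: sum_distrib_left)
    also have "(\<Sum>k<n. r ^ (n - k)) = (\<Sum>k<n. r ^ Suc k)"
      using sum.nat_diff_reindex[of "\<lambda>k. r ^ (n - k)" n]
      by (simp del: power_Suc cong: sum.cong_simp)
    also have "\<bar>V\<bar> * \<dots> \<le> \<bar>V\<bar> * (1 / (1 - r))"
    proof (rule mult_left_mono)
      have "(\<Sum>k<n. r ^ Suc k) \<le> (\<Sum>k<n. r ^ k)"
        using r by (intro sum_mono power_decreasing) auto
      also have "\<dots> \<le> (\<Sum>k. r ^ k)"
        using r by (intro sum_le_suminf summable_geometric) auto
      also have "\<dots> = 1 / (1 - r)"
        using r by (intro suminf_geometric) auto
      finally show "(\<Sum>k<n. r ^ Suc k) \<le> 1 / (1 - r)" .
    qed simp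
    finally show ?thesis .
  qed
  then show thesis
    using r by (intro that[of "\<bar>V\<bar> * (1 / (1 - r))"]) auto
qed

definition begins_with :: "(nat \<Rightarrow> 'a) \<Rightarrow> 'a list \<Rightarrow> bool" where
  "begins_with x u \<longleftrightarrow> (\<forall>k<length u. x k = u ! k)"

lemma begins_with_append:
  "begins_with x (u @ v) \<longleftrightarrow> begins_with x u \<and> begins_with ((left_shift ^^ length u) x) v"
proof (intro iffI conjI)
  assume *: "begins_with x (u @ v)"
  show "begins_with x u"
    unfolding begins_with_def
  proof (intro allI impI)
    fix k assume "k < length u"
    with * show "x k = u ! k"
      by (auto simp: begins_with_def nth_append dest: spec[of _ k])
  qed
  show "begins_with ((left_shift ^^ length u) x) v"
    unfolding begins_with_def left_shift_funpow
  proof (intro allI impI)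
    fix k assume "k < length v"
    with * show "x (length u + k) = v ! k"
      by (auto simp: begins_with_def nth_append dest: spec[of _ "length u + k"])
  qed
next
  assume *: "begins_with x u \<and> begins_with ((left_shift ^^ length u) x) v"
  show "begins_with x (u @ v)"
    unfolding begins_with_def
  proof (intro allI impI)
    fix k assume k: "k < length (u @ v)"
    show "x k = (u @ v) ! k"
    proof (cases "k < length u")
      case False
      then have "k - length u < length v" using k by auto
      with * have "x (length u + (k - length u)) = v ! (k - length u)"
        unfolding begins_with_def left_shift_funpow by blast
      then show ?thesis using False by (simp add: nth_append)
    qed (use * in \<open>auto simp: begins_with_def nth_append\<close>)
  qed
qed

text \<open>The word \<open>p\<close> contains its initial letter \<open>i\<close> but not the final letter \<open>j\<close>, so paths are concatenated
  by appending words.\<close>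

definition word_path :: "'a set \<Rightarrow> ('a \<Rightarrow> 'a \<Rightarrow> bool) \<Rightarrow> 'a \<Rightarrow> 'a list \<Rightarrow> 'a \<Rightarrow> bool" where
  "word_path I A i p j \<longleftrightarrow> p \<noteq> [] \<and> hd p = i \<and> set p \<subseteq> I \<and> successively A (p @ [j])"

definition irreducible :: "'a set \<Rightarrow> ('a \<Rightarrow> 'a \<Rightarrow> bool) \<Rightarrow> bool" where
  "irreducible I A \<longleftrightarrow> (\<forall>i\<in>I. \<forall>j\<in>I. \<exists>p. word_path I A i p j)"

definition loops :: "'a set \<Rightarrow> ('a \<Rightarrow> 'a \<Rightarrow> bool) \<Rightarrow> 'a \<Rightarrow> 'a list set" where
  "loops I A a = insert [] {p. word_path I A a p a}"

definition cyc :: "'a list \<Rightarrow> nat \<Rightarrow> 'a" where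
  "cyc u = (\<lambda>k. u ! (k mod length u))"

lemma word_path_append: "word_path I A i p j \<Longrightarrow> word_path I A j q k \<Longrightarrow> word_path I A i (p @ q) k"
  by (auto simp: word_path_def successively_append_iff)

lemma word_path_of_all_words: "i # q @ [j] \<in> all_words I A \<Longrightarrow> word_path I A i (i # q) j"
  by (auto simp: word_path_def all_words_def words_def)

lemma irreducible_if_mixing: "topologically_mixing I A \<Longrightarrow> irreducible I A"
  unfolding topologically_mixing_def irreducible_def by (meson order_refl word_path_of_all_words)

lemma irreducible_if_primitive: "finitely_primitive I A \<Longrightarrow> irreducible I A"
  unfolding finitely_primitive_def irreducible_def by (meson word_path_of_all_words)

lemma loops_append: "u \<in> loops I A a \<Longrightarrow> v \<in> loops I A a \<Longrightarrow> u @ v \<in> loops I A a"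
  by (auto simp: loops_def word_path_append)

lemma loops_cancel:
  assumes "u @ v \<in> loops I A a" "v \<in> loops I A a"
  shows "u \<in> loops I A a"
proof (cases "u = [] \<or> v = []")
  case False
  then have "hd v = a" "word_path I A a (u @ v) a"
    using assms by (auto simp: loops_def word_path_def)
  then have "word_path I A a u a"
    using False by (cases v) (auto simp: word_path_def successively_append_iff)
  then show ?thesis by (simp add: loops_def)
qed (use assms in \<open>auto simp: loops_def\<close>)

lemma cyc_shift_space:
  assumes "word_path I A a u a"
  shows "cyc u \<in> shift_space I A"
proof -
  have u: "u \<noteq> []" "hd u = a" "set u \<subseteq> I" "successively A (u @ [a])"
    using assms by (auto simp: word_path_def)
  have "A (u ! (k mod length u)) (u ! (Suc k mod length u))" for k
  proof -
    have k: "k mod length u < length u"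
      using u by simp
    have "A ((u @ [a]) ! (k mod length u)) ((u @ [a]) ! Suc (k mod length u))"
      using u(4) k by (simp add: successively_conv_nth)
    moreover have "(u @ [a]) ! Suc (k mod length u) = u ! (Suc k mod length u)"
    proof (cases "Suc (k mod length u) = length u")
      case False
      then have "Suc (k mod length u) < length u" using k by linarith
      then show ?thesis using False by (simp add: mod_Suc nth_append)
    qed (use u in \<open>simp add: mod_Suc nth_append hd_conv_nth\<close>)
    ultimately show ?thesis
      using k by (simp add: nth_append)
  qed
  then show ?thesis
    using u by (auto simp: shift_space_def cyc_def)
qed

lemma begins_with_cyc: "begins_with (cyc u) u"
  by (auto simp: begins_with_def cyc_def)

lemma cyc_periodic: "(left_shift ^^ length u) (cyc u) = cyc u"
  by (auto simp: left_shift_funpow cyc_def)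

text \<open>A periodic point is determined by its first period, which is a loop.\<close>

lemma periodic_points_bij_betw:
  assumes "n \<ge> 1"
  shows "bij_betw cyc {u\<in>loops I A a. length u = n}
    {x\<in>shift_space I A. x 0 = a \<and> (left_shift ^^ n) x = x}"
proof (rule bij_betw_imageI)
  show "inj_on cyc {u\<in>loops I A a. length u = n}"
  proof (rule inj_onI)
    fix u v assume uv: "u \<in> {u\<in>loops I A a. length u = n}" "v \<in> {u\<in>loops I A a. length u = n}"
      and "cyc u = cyc v"
    then show "u = v"
      using begins_with_cyc[of u] begins_with_cyc[of v]
      by (auto simp: begins_with_def intro!: nth_equalityI)
  qed
  have "x \<in> cyc ` {u\<in>loops I A a. length u = n}"
    if x: "x \<in> shift_space I A" "x 0 = a" "(left_shift ^^ n) x = x" for x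
  proof -
    let ?u = "map x [0..<n]"
    have per: "x (n + j) = x j" for j
      using fun_cong[OF x(3), of j] by (simp add: left_shift_funpow)
    have per': "x (k mod n) = x k" for k
    proof (induction k rule: less_induct)
      case (less k)
      show ?case
      proof (cases "k < n")
        case False
        then have "x ((k - n) mod n) = x (k - n)"
          using assms by (intro less) auto
        then show ?thesis
          using False per[of "k - n"] by (simp add: le_mod_geq)
      qed simp
    qed
    have "successively A (map x [0..<Suc n])"
      using x(1) unfolding successively_conv_nth by (auto simp del: upt_Suc simp: shift_space_def)
    moreover have "map x [0..<Suc n] = ?u @ [a]"
      using per[of 0] x(2) by simp
    ultimately have "word_path I A a ?u a"
      using assms x by (auto simp: word_path_def shift_space_def hd_conv_nth)
    moreover have "cyc ?u = x"
      using assms per' by (auto simp: cyc_def)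
    ultimately show ?thesis
      by (intro image_eqI[of _ _ ?u]) (auto simp: loops_def)
  qed
  moreover have "cyc u \<in> shift_space I A \<and> cyc u 0 = a \<and> (left_shift ^^ n) (cyc u) = cyc u"
    if "u \<in> loops I A a" "length u = n" for u
  proof -
    have p: "word_path I A a u a" using that assms by (auto simp: loops_def)
    moreover have "cyc u 0 = a"
      using p by (auto simp: cyc_def word_path_def hd_conv_nth)
    ultimately show ?thesis
      using cyc_shift_space[OF p] cyc_periodic[of u] that by simp
  qed
  ultimately show "cyc ` {u\<in>loops I A a. length u = n} =
      {x\<in>shift_space I A. x 0 = a \<and> (left_shift ^^ n) x = x}"
    by auto
qed

locale markov_potential =
  fixes I :: "'a set" and A :: "'a \<Rightarrow> 'a \<Rightarrow> bool" and f :: "(nat \<Rightarrow> 'a) \<Rightarrow> real"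
  assumes hoelder: "hoelder_continuous I A f"
begin

definition language :: "'a list set" where
  "language = {u. \<exists>x\<in>shift_space I A. begins_with x u}"

text \<open>A word weighs as much as the Birkhoff sum along some point of the cylinder of the word; by bounded
  distortion the choice of the point affects weights by a bounded factor only.\<close>

definition extension :: "'a list \<Rightarrow> nat \<Rightarrow> 'a" where
  "extension u = (SOME x. x \<in> shift_space I A \<and> begins_with x u)"

definition W :: "'a list \<Rightarrow> ennreal" where
  "W u = ennreal (exp (birkhoff_sum (length u) f (extension u)))"

text \<open>One constant that serves for replacing points of a cylinder and for splitting words.\<close>

definition distortion :: ennreal where
  "distortion = (SOME D. 1 \<le> D \<and> D < \<infinity> \<and>
     (\<forall>u v. u @ v \<in> language \<longrightarrow> W (u @ v) \<le> D * (W u * W v) \<and> W u * W v \<le> D * W (u @ v)) \<and>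
     (\<forall>u. \<forall>x\<in>shift_space I A. begins_with x u \<longrightarrow>
        W u \<le> D * ennreal (exp (birkhoff_sum (length u) f x)) \<and>
        ennreal (exp (birkhoff_sum (length u) f x)) \<le> D * W u))"

lemma extension: "u \<in> language \<Longrightarrow> extension u \<in> shift_space I A \<and> begins_with (extension u) u"
  unfolding extension_def by (rule someI_ex[of "\<lambda>x. x \<in> shift_space I A \<and> begins_with x u"]) (auto simp: language_def)

lemma W_pos: "0 < W u" and W_fin: "W u < \<infinity>"
  by (auto simp: W_def)

lemma W_nil: "W [] = 1"
  by (simp add: W_def birkhoff_sum_def)

lemma language_append: "u @ v \<in> language \<Longrightarrow> u \<in> language \<and> v \<in> language"
  using shift_space_funpow unfolding language_def by (fastforce simp: begins_with_append)

lemma distortion_exists: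
  "\<exists>D::ennreal. 1 \<le> D \<and> D < \<infinity> \<and>
     (\<forall>u v. u @ v \<in> language \<longrightarrow> W (u @ v) \<le> D * (W u * W v) \<and> W u * W v \<le> D * W (u @ v)) \<and>
     (\<forall>u. \<forall>x\<in>shift_space I A. begins_with x u \<longrightarrow>
        W u \<le> D * ennreal (exp (birkhoff_sum (length u) f x)) \<and>
        ennreal (exp (birkhoff_sum (length u) f x)) \<le> D * W u)"
proof -
  obtain d where d: "0 \<le> d" and dist: "\<And>n x y. x \<in> shift_space I A \<Longrightarrow> y \<in> shift_space I A \<Longrightarrow>
      (\<And>k. k < n \<Longrightarrow> x k = y k) \<Longrightarrow> \<bar>birkhoff_sum n f x - birkhoff_sum n f y\<bar> \<le> d"
    using bounded_distortion[OF hoelder] by blast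
  have cmp: "\<bar>birkhoff_sum (length u) f x - birkhoff_sum (length u) f (extension u)\<bar> \<le> d"
    if "x \<in> shift_space I A" "begins_with x u" for u x
  proof -
    have "u \<in> language" using that by (auto simp: language_def)
    from extension[OF this] that show ?thesis
      by (intro dist) (auto simp: begins_with_def)
  qed
  have ex: "ennreal (exp a) \<le> ennreal (exp (2 * d)) * ennreal (exp b)" if "a \<le> 2 * d + b" for a b
    using that by (simp add: ennreal_mult[symmetric] exp_add[symmetric])
  show ?thesis
  proof (intro exI[of _ "ennreal (exp (2 * d))"] conjI allI impI ballI)
    show "1 \<le> ennreal (exp (2 * d))"
      using d by simp
    fix u v assume uv: "u @ v \<in> language"
    let ?x = "extension (u @ v)"
    have x: "?x \<in> shift_space I A" "begins_with ?x u" "begins_with ((left_shift ^^ length u) ?x) v"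
      using extension[OF uv] by (auto simp: begins_with_append)
    have 1: "\<bar>birkhoff_sum (length u) f ?x - birkhoff_sum (length u) f (extension u)\<bar> \<le> d"
      by (rule cmp[OF x(1,2)])
    have 2: "\<bar>birkhoff_sum (length v) f ((left_shift ^^ length u) ?x) - birkhoff_sum (length v) f (extension v)\<bar> \<le> d"
      by (rule cmp[OF shift_space_funpow[OF x(1)] x(3)])
    have W2: "W u * W v = ennreal (exp (birkhoff_sum (length u) f (extension u) + birkhoff_sum (length v) f (extension v)))"
      by (simp add: W_def ennreal_mult[symmetric] exp_add)
    show "W (u @ v) \<le> ennreal (exp (2 * d)) * (W u * W v)"
      unfolding W2 unfolding W_def length_append birkhoff_sum_add using 1 2 by (intro ex) linarith
    show "W u * W v \<le> ennreal (exp (2 * d)) * W (u @ v)"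
      unfolding W2 unfolding W_def length_append birkhoff_sum_add using 1 2 by (intro ex) linarith
  next
    fix u x assume x: "x \<in> shift_space I A" "begins_with x u"
    show "W u \<le> ennreal (exp (2 * d)) * ennreal (exp (birkhoff_sum (length u) f x))"
      unfolding W_def using cmp[OF x] d by (intro ex) linarith
    show "ennreal (exp (birkhoff_sum (length u) f x)) \<le> ennreal (exp (2 * d)) * W u"
      unfolding W_def using cmp[OF x] d by (intro ex) linarith
  qed simp
qed

lemmas distortion_spec = someI_ex[OF distortion_exists, folded distortion_def]

lemma distortion_ge_1: "1 \<le> distortion"
  by (rule distortion_spec[THEN conjunct1])

lemma distortion_fin: "distortion < \<infinity>"
  by (rule distortion_spec[THEN conjunct2, THEN conjunct1])

lemma
  assumes "u @ v \<in> language"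
  shows W_append_le: "W (u @ v) \<le> distortion * (W u * W v)"
    and W_append_ge: "W u * W v \<le> distortion * W (u @ v)"
  using distortion_spec[THEN conjunct2, THEN conjunct2, THEN conjunct1, rule_format, OF assms] by simp_all

lemma
  assumes "x \<in> shift_space I A" "begins_with x u"
  shows W_le_exp: "W u \<le> distortion * ennreal (exp (birkhoff_sum (length u) f x))"
    and exp_le_W: "ennreal (exp (birkhoff_sum (length u) f x)) \<le> distortion * W u"
  using distortion_spec[THEN conjunct2, THEN conjunct2, THEN conjunct2, rule_format, OF assms] by simp_all

lemma loops_language: "a \<in> I \<Longrightarrow> irreducible I A \<Longrightarrow> u \<in> loops I A a \<Longrightarrow> u \<in> language"
proof (cases "u = []")
  case True
  assume "a \<in> I" "irreducible I A"
  then obtain p where "word_path I A a p a" by (auto simp: irreducible_def)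
  then show ?thesis
    using True cyc_shift_space by (fastforce simp: language_def begins_with_def)
next
  case False
  assume "u \<in> loops I A a"
  then have "word_path I A a u a" using False by (auto simp: loops_def)
  then show ?thesis
    using cyc_shift_space begins_with_cyc by (fastforce simp: language_def)
qed

definition loop_sum :: "'a \<Rightarrow> ('a list \<Rightarrow> bool) \<Rightarrow> nat \<Rightarrow> ennreal" where
  "loop_sum a Q n = (\<Sum>\<^sub>\<infinity>u\<in>{u\<in>loops I A a. length u = n \<and> Q u}. W u)"

lemma periodic_sum_loop_sum:
  fixes a :: 'a and Q :: "'a list \<Rightarrow> bool"
  assumes "n \<ge> 1"
  defines "S \<equiv> (\<Sum>\<^sub>\<infinity>x\<in>{x\<in>shift_space I A. x 0 = a \<and> (left_shift ^^ n) x = x \<and> Q (map x [0..<n])}.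
      ennreal (exp (birkhoff_sum n f x)))"
  shows "S \<le> distortion * loop_sum a Q n" and "loop_sum a Q n \<le> distortion * S"
proof -
  have m: "map (cyc u) [0..<length u] = u" for u :: "'a list"
    by (rule nth_equalityI) (auto simp: cyc_def)
  let ?L = "{u\<in>loops I A a. length u = n \<and> Q u}"
  have bij: "bij_betw cyc ?L {x\<in>shift_space I A. x 0 = a \<and> (left_shift ^^ n) x = x \<and> Q (map x [0..<n])}"
  proof -
    have "bij_betw cyc {u\<in>{u\<in>loops I A a. length u = n}. Q u}
        {x\<in>{x\<in>shift_space I A. x 0 = a \<and> (left_shift ^^ n) x = x}. Q (map x [0..<n])}"
      using m by (intro bij_betw_Collect[OF periodic_points_bij_betw[OF assms(1)]]) auto
    then show ?thesis by (simp add: conj_assoc)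
  qed
  have S: "S = (\<Sum>\<^sub>\<infinity>u\<in>?L. ennreal (exp (birkhoff_sum n f (cyc u))))"
    unfolding S_def by (rule infsum_reindex_bij_betw[OF bij, symmetric])
  have in_shift: "cyc u \<in> shift_space I A" if "u \<in> ?L" for u
    using that assms(1) cyc_shift_space by (fastforce simp: loops_def)
  show "S \<le> distortion * loop_sum a Q n"
    unfolding S loop_sum_def infsum_ennreal_cmult[symmetric]
    using exp_le_W[OF in_shift begins_with_cyc] by (intro infsum_ennreal_mono) auto
  show "loop_sum a Q n \<le> distortion * S"
    unfolding S loop_sum_def infsum_ennreal_cmult[symmetric]
    using W_le_exp[OF in_shift begins_with_cyc] by (intro infsum_ennreal_mono) auto
qed

lemma Z_loop_sum:
  assumes "n \<ge> 1"
  shows "Z I A f a n \<le> distortion * loop_sum a (\<lambda>_. True) n"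
    and "loop_sum a (\<lambda>_. True) n \<le> distortion * Z I A f a n"
  using periodic_sum_loop_sum[OF assms, of a "\<lambda>_. True"] by (auto simp: Z_def)

lemma Z_star_loop_sum:
  assumes "n \<ge> 1"
  shows "Z_star I A f a n \<le> distortion * loop_sum a (\<lambda>u. \<forall>k\<in>{1..<length u}. u ! k \<noteq> a) n"
    and "loop_sum a (\<lambda>u. \<forall>k\<in>{1..<length u}. u ! k \<noteq> a) n \<le> distortion * Z_star I A f a n"
proof -
  have "{x\<in>shift_space I A. x 0 = a \<and> (left_shift ^^ n) x = x \<and> (\<forall>k\<in>{1..<n}. x k \<noteq> a)} =
    {x\<in>shift_space I A. x 0 = a \<and> (left_shift ^^ n) x = x \<and>
       (\<forall>k\<in>{1..<length (map x [0..<n])}. map x [0..<n] ! k \<noteq> a)}"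
    by auto
  then show "Z_star I A f a n \<le> distortion * loop_sum a (\<lambda>u. \<forall>k\<in>{1..<length u}. u ! k \<noteq> a) n"
    "loop_sum a (\<lambda>u. \<forall>k\<in>{1..<length u}. u ! k \<noteq> a) n \<le> distortion * Z_star I A f a n"
    using periodic_sum_loop_sum[OF assms, of a "\<lambda>u. \<forall>k\<in>{1..<length u}. u ! k \<noteq> a"]
    unfolding Z_star_def by simp_all
qed

end


section \<open>Loop sums and the Gurevich pressure\<close>

lemma pressure_less_eventually:
  assumes "gurevich_pressure I A f < ereal q"
  shows "eventually (\<lambda>n. Z I A f (SOME a. a \<in> I) n \<le> ennreal (exp (real n * q))) sequentially"
proof -
  let ?z = "\<lambda>n. Z I A f (SOME a. a \<in> I) n"
  have "eventually (\<lambda>n. ereal (1 / real n) * ln_ennreal (?z n) < ereal q) sequentially"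
    using assms unfolding gurevich_pressure_def by (rule Limsup_lessD)
  then show ?thesis
    using eventually_gt_at_top[of 0]
  proof eventually_elim
    case (elim n)
    show "?z n \<le> ennreal (exp (real n * q))"
    proof (cases "?z n = 0 \<or> ?z n = \<infinity>")
      case True
      then show ?thesis
        using elim by (auto simp: ln_ennreal_def)
    next
      case False
      then obtain x where x: "?z n = ennreal x" "x > 0"
        by (cases "?z n") (auto simp: less_le)
      then have "1 / real n * ln x < q"
        using elim False by (simp add: ln_ennreal_def)
      then have "ln x < real n * q"
        using elim by (simp add: field_simps)
      then have "x < exp (real n * q)"
        using x by (metis exp_less_mono exp_ln)
      then show ?thesis
        using x by (auto intro!: ennreal_leI)
    qed
  qed
qed

lemma pressure_le:
  assumes "K > 0"
    and "eventually (\<lambda>n. Z I A f (SOME a. a \<in> I) n \<le> ennreal (K * exp (real n * q))) sequentially"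
  shows "gurevich_pressure I A f \<le> ereal q"
proof -
  let ?z = "\<lambda>n. Z I A f (SOME a. a \<in> I) n"
  have lim: "(\<lambda>n. ereal (ln K * (1 / real n) + q)) \<longlonglongrightarrow> ereal (ln K * 0 + q)"
    by (intro tendsto_ereal tendsto_add tendsto_mult tendsto_const lim_1_over_n)
  have "limsup (\<lambda>n. ereal (1 / real n) * ln_ennreal (?z n)) \<le> limsup (\<lambda>n. ereal (ln K * (1 / real n) + q))"
  proof (rule Limsup_mono)
    show "eventually (\<lambda>n. ereal (1 / real n) * ln_ennreal (?z n) \<le> ereal (ln K * (1 / real n) + q)) sequentially"
      using assms(2) eventually_gt_at_top[of 0]
    proof eventually_elim
      case (elim n)
      show ?case
      proof (cases "?z n = 0")
        case False
        then obtain x where x: "?z n = ennreal x" "x > 0"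
          using elim(1) by (cases "?z n") (auto simp: less_le top_unique)
        then have "x \<le> K * exp (real n * q)"
          using elim assms(1) by (simp add: ennreal_le_iff)
        then have "ln x \<le> ln (K * exp (real n * q))"
          using x assms(1) by simp
        also have "\<dots> = ln K + real n * q"
          using assms(1) by (simp add: ln_mult)
        finally have "1 / real n * ln x \<le> ln K * (1 / real n) + q"
          using elim by (simp add: field_simps)
        then show ?thesis
          using x False by (simp add: ln_ennreal_def)
      qed (use elim in \<open>simp add: ln_ennreal_def\<close>)
    qed
  qed
  also have "\<dots> = ereal q"
    using lim_imp_Limsup[OF _ lim] by simp
  finally show ?thesis
    by (simp add: gurevich_pressure_def)
qed

lemma exp_cancel_ennreal: "ennreal (exp (- r)) * (ennreal (exp r) * x) = x"
  by (simp add: mult.assoc[symmetric] ennreal_mult[symmetric] exp_add[symmetric])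

context markov_potential
begin

definition Wsum :: "'a list set \<Rightarrow> ennreal" where
  "Wsum S = (\<Sum>\<^sub>\<infinity>u\<in>S. W u)"

lemma Wsum_mono: "S \<subseteq> T \<Longrightarrow> Wsum S \<le> Wsum T"
  unfolding Wsum_def by (intro infsum_ennreal_mono) auto

lemma Wsum_append_ge:
  assumes "inj_on (\<lambda>(u, v). u @ v) (X \<times> Y)"
    and "\<And>u v. u \<in> X \<Longrightarrow> v \<in> Y \<Longrightarrow> u @ v \<in> T" and "T \<subseteq> language"
  shows "Wsum X * Wsum Y \<le> distortion * Wsum T"
  unfolding Wsum_def
  by (rule infsum_append_ge[OF assms(1)]) (use assms(2,3) W_append_ge in blast)

lemma Wsum_append_le:
  assumes "\<And>z. z \<in> T \<Longrightarrow> \<exists>u\<in>X. \<exists>v\<in>Y. z = u @ v" and "T \<subseteq> language"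
  shows "Wsum T \<le> distortion * (Wsum X * Wsum Y)"
  unfolding Wsum_def
  by (rule infsum_append_le) (use assms W_append_le in blast)

definition loop_total :: "'a \<Rightarrow> nat \<Rightarrow> ennreal" where
  "loop_total a n = Wsum {u\<in>loops I A a. length u = n}"

lemma loop_total_eq_loop_sum: "loop_total a n = loop_sum a (\<lambda>_. True) n"
  by (simp add: loop_total_def Wsum_def loop_sum_def)

lemma W_eq_exp: obtains r where "W u = ennreal (exp r)"
  by (auto simp: W_def)

lemma distortion_eq_real: obtains d where "distortion = ennreal d" "1 \<le> d"
  using distortion_ge_1 distortion_fin by (cases distortion) auto

lemma loop_total_mult:
  assumes "irreducible I A" "a \<in> I"
  shows "loop_total a n * loop_total a m \<le> distortion * loop_total a (n + m)"
  unfolding loop_total_def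
proof (rule Wsum_append_ge)
  show "{u\<in>loops I A a. length u = n + m} \<subseteq> language"
    using loops_language[OF assms(2,1)] by blast
qed (simp_all add: inj_on_def loops_append)

text \<open>A loop at \<open>a\<close> becomes a loop at \<open>b\<close> by adding fixed paths from \<open>b\<close> to \<open>a\<close> and back. Therefore
  growth and divergence of the loop sums do not depend on the letter.\<close>

lemma loop_total_compare:
  assumes irr: "irreducible I A" and ab: "a \<in> I" "b \<in> I"
  obtains K m where "K < \<infinity>" "\<And>n. loop_total a n \<le> K * loop_total b (n + m)"
proof -
  obtain p q where p: "word_path I A b p a" and q: "word_path I A a q b"
    using irr ab unfolding irreducible_def by blast
  obtain r1 r2 where r: "W p = ennreal (exp r1)" "W q = ennreal (exp r2)"
    using W_eq_exp by metis
  have lang: "loops I A b \<subseteq> language"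
    using loops_language[OF ab(2) irr] by auto
  have path: "p @ u @ q \<in> loops I A b" if "u \<in> loops I A a" for u
    using that p q word_path_append[OF p q] word_path_append[OF p word_path_append[OF _ q], of u]
    by (auto simp: loops_def)
  define K where "K = ennreal (exp (- r1)) * (ennreal (exp (- r2)) * distortion ^ 2)"
  have "loop_total a n \<le> K * loop_total b (n + (length p + length q))" for n
  proof -
    let ?X = "{u\<in>loops I A a. length u = n}"
    let ?Y = "(\<lambda>u. u @ q) ` ?X"
    let ?T = "{u\<in>loops I A b. length u = n + (length p + length q)}"
    have sub: "?Y \<subseteq> language"
    proof
      fix y assume "y \<in> ?Y"
      then obtain u where "u \<in> loops I A a" "y = u @ q" by auto
      then have "p @ y \<in> language" using path lang by auto
      then show "y \<in> language" by (rule language_append[THEN conjunct2])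
    qed
    have XY: "Wsum ?X * Wsum {q} \<le> distortion * Wsum ?Y"
    proof (rule Wsum_append_ge[OF _ _ sub])
      show "inj_on (\<lambda>(u, v). u @ v) (?X \<times> {q})"
        by (simp add: inj_on_def)
    qed simp
    have YT: "Wsum {p} * Wsum ?Y \<le> distortion * Wsum ?T"
    proof (rule Wsum_append_ge)
      show "inj_on (\<lambda>(u, v). u @ v) ({p} \<times> ?Y)"
        by (simp add: inj_on_def)
      show "p' @ y \<in> ?T" if py: "p' \<in> {p}" "y \<in> ?Y" for p' y
      proof -
        obtain u where "u \<in> loops I A a" "length u = n" "y = u @ q"
          using py by blast
        then show ?thesis
          using py(1) path[of u] by simp
      qed
      show "?T \<subseteq> language"
        using lang by blast
    qed
    have "W p * (Wsum ?X * W q) \<le> W p * (distortion * Wsum ?Y)"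
      using XY by (intro mult_left_mono) (simp_all add: Wsum_def)
    also have "\<dots> = distortion * (Wsum {p} * Wsum ?Y)"
      by (simp add: Wsum_def ac_simps)
    also have "\<dots> \<le> distortion * (distortion * Wsum ?T)"
      using YT by (rule mult_left_mono) simp
    finally have "W p * (Wsum ?X * W q) \<le> distortion * (distortion * Wsum ?T)" .
    then have "ennreal (exp (- r1)) * (ennreal (exp (- r2)) * (W p * (Wsum ?X * W q))) \<le>
        ennreal (exp (- r1)) * (ennreal (exp (- r2)) * (distortion * (distortion * Wsum ?T)))"
      by (intro mult_left_mono) auto
    moreover have "ennreal (exp (- r1)) * (ennreal (exp (- r2)) * (W p * (Wsum ?X * W q))) = Wsum ?X"
    proof -
      have "ennreal (exp (- r1)) * (ennreal (exp (- r2)) * (W p * (Wsum ?X * W q))) =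
          ennreal (exp (- r1)) * (ennreal (exp r1) * (ennreal (exp (- r2)) * (ennreal (exp r2) * Wsum ?X)))"
        by (simp only: r ac_simps)
      then show ?thesis by (simp only: exp_cancel_ennreal)
    qed
    ultimately show ?thesis
      by (simp add: loop_total_def K_def power2_eq_square ac_simps)
  qed
  moreover have "K < \<infinity>"
    using distortion_fin by (simp add: K_def ennreal_mult_less_top power_less_top_ennreal)
  ultimately show thesis
    using that by blast
qed

lemma loop_total_power:
  assumes "irreducible I A" "a \<in> I"
  shows "loop_total a n ^ k \<le> distortion ^ k * loop_total a (n * k)"
proof (induction k)
  case 0
  have "[] \<in> {u\<in>loops I A a. length u = n * 0}" by (simp add: loops_def)
  then have "Wsum {[]} \<le> loop_total a (n * 0)"
    unfolding loop_total_def by (intro Wsum_mono) auto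
  then show ?case by (simp add: Wsum_def W_nil)
next
  case (Suc k)
  have "loop_total a n ^ Suc k \<le> loop_total a n * (distortion ^ k * loop_total a (n * k))"
    using Suc by (simp add: mult_left_mono)
  also have "\<dots> = distortion ^ k * (loop_total a n * loop_total a (n * k))"
    by (simp add: ac_simps)
  also have "\<dots> \<le> distortion ^ k * (distortion * loop_total a (n + n * k))"
    by (intro mult_left_mono loop_total_mult assms) auto
  finally show ?case by (simp add: ac_simps)
qed

text \<open>The loop sums are supermultiplicative up to a constant, since loops can be concatenated. If one of
  them exceeded the bound, its powers would force a larger exponential growth rate.\<close>

lemma loop_total_le_exp_pressure_base:
  assumes irr: "irreducible I A" and "I \<noteq> {}" and P: "gurevich_pressure I A f \<le> ereal p"
  shows "loop_total (SOME a. a \<in> I) n \<le> distortion * ennreal (exp (real n * p))"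
proof (rule ccontr)
  define a where "a = (SOME a. a \<in> I)"
  have a: "a \<in> I" using assms(2) unfolding a_def by (simp add: some_in_eq)
  obtain d where d: "distortion = ennreal d" "1 \<le> d" by (rule distortion_eq_real)
  assume "\<not> ?thesis"
  then have gt: "ennreal (d * exp (real n * p)) < loop_total a n"
    using d by (simp add: a_def not_le ennreal_mult)
  have n: "n \<ge> 1"
  proof (rule ccontr)
    assume "\<not> 1 \<le> n"
    then have "n = 0" by simp
    then have "{u\<in>loops I A a. length u = n} = {[]}" by (auto simp: loops_def)
    then have "loop_total a n = 1" by (simp add: loop_total_def Wsum_def W_nil)
    then have "ennreal d < 1" using gt \<open>n = 0\<close> by simp
    then show False using d by (metis distortion_ge_1 not_le)
  qed
  obtain y where y: "ennreal (d * exp (real n * p)) < ennreal y" "ennreal y < loop_total a n"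
    using dense[OF gt] by (metis ennreal_cases infinity_ennreal_def less_top neq_top_trans order.strict_implies_order top.not_eq_extremum)
  have y': "d * exp (real n * p) < y" 
    using y(1) d by (simp add: ennreal_less_iff)
  \<comment> \<open>\<open>q\<close> is a lower bound for the growth rate that powers of the loops of length \<open>n\<close> enforce\<close>
  define q where "q = ln (y / d) / real n"
  have yd: "y / d > exp (real n * p)"
    using y' d by (simp add: field_simps)
  have "y / d > 0"
    using yd exp_gt_zero[of "real n * p"] by linarith
  then have "y = d * exp (real n * q)"
    using n d by (simp add: q_def)
  moreover have "p < q"
    using yd \<open>y / d > 0\<close> n by (simp add: q_def field_simps) (metis exp_less_cancel_iff exp_ln mult.commute)
  moreover define q' where "q' = (p + q) / 2"
  ultimately have q: "p < q'" "q' < q" "ennreal (d * exp (real n * q)) < loop_total a n"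
    using y(2) by auto
  have low: "ennreal (exp (real (n * k) * q)) \<le> loop_total a (n * k)" for k
  proof -
    have "ennreal d ^ k * ennreal (exp (real (n * k) * q)) = ennreal (d * exp (real n * q)) ^ k"
      using d by (simp add: ennreal_power ennreal_mult[symmetric] power_mult_distrib exp_of_nat_mult[symmetric] ac_simps)
    also have "\<dots> \<le> loop_total a n ^ k"
      using q by (intro power_mono) auto
    also have "\<dots> \<le> ennreal d ^ k * loop_total a (n * k)"
      using loop_total_power[OF irr a] d by simp
    finally show ?thesis
      using d by (subst (asm) ennreal_mult_le_mult_iff) (auto simp: ennreal_power)
  qed
  have "gurevich_pressure I A f < ereal q'"
    using P q by (meson ereal_less_eq(3) less_ereal.simps(1) order_le_less_trans)
  from pressure_less_eventually[OF this] obtain N where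
    N: "\<And>m. m \<ge> N \<Longrightarrow> Z I A f a m \<le> ennreal (exp (real m * q'))"
    by (auto simp: eventually_sequentially a_def)
  have upper: "exp (real (n * k) * (q - q')) \<le> d" if k: "k \<ge> max 1 N" for k
  proof -
    have nk: "n * k \<ge> N" "n * k \<ge> 1"
      using n k by (auto intro: order_trans[of _ k] simp: Suc_le_eq)
    have "ennreal (exp (real (n * k) * q)) \<le> loop_total a (n * k)" by (rule low)
    also have "\<dots> \<le> distortion * Z I A f a (n * k)"
      using Z_loop_sum(2)[OF nk(2)] by (simp add: loop_total_eq_loop_sum)
    also have "\<dots> \<le> ennreal d * ennreal (exp (real (n * k) * q'))"
      using N[OF nk(1)] d by (simp add: mult_left_mono)
    finally have "exp (real (n * k) * q) \<le> d * exp (real (n * k) * q')"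
      using d by (simp add: ennreal_mult[symmetric])
    then show ?thesis
      by (simp add: right_diff_distrib exp_diff field_simps)
  qed
  obtain k where k: "k \<ge> max 1 N" "d < real k * (q - q')"
  proof -
    obtain k0 :: nat where k0: "d / (q - q') < real k0"
      using reals_Archimedean2 by blast
    have "d < real (max k0 (max 1 N)) * (q - q')"
    proof -
      have "d < real k0 * (q - q')" using k0 q by (simp add: field_simps)
      also have "\<dots> \<le> real (max k0 (max 1 N)) * (q - q')"
        using q by (intro mult_right_mono) auto
      finally show ?thesis .
    qed
    then show thesis using that[of "max k0 (max 1 N)"] by auto
  qed
  have "d < real k * (q - q')" by (rule k)
  also have "\<dots> \<le> real (n * k) * (q - q')"
    using n q by (intro mult_right_mono, unfold of_nat_le_iff) auto
  also have "\<dots> \<le> exp (real (n * k) * (q - q'))"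
    using exp_ge_add_one_self[of "real (n * k) * (q - q')"] by linarith
  also have "\<dots> \<le> d"
    by (rule upper[OF k(1)])
  finally show False by simp
qed

lemma loop_total_le_exp_pressure:
  assumes irr: "irreducible I A" and a: "a \<in> I" and P: "gurevich_pressure I A f \<le> ereal p"
  obtains K where "K < \<infinity>" "\<And>n. loop_total a n \<le> K * ennreal (exp (real n * p))"
proof -
  have ne: "I \<noteq> {}" using a by auto
  define b where "b = (SOME a. a \<in> I)"
  have "b \<in> I" using ne unfolding b_def by (simp add: some_in_eq)
  from loop_total_compare[OF irr a this] obtain K m where K: "K < \<infinity>" "\<And>n. loop_total a n \<le> K * loop_total b (n + m)"
    by blast
  have "loop_total a n \<le> K * distortion * ennreal (exp (real m * p)) * ennreal (exp (real n * p))" for n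
  proof -
    have "loop_total a n \<le> K * (distortion * ennreal (exp (real (n + m) * p)))"
      using K(2)[of n] loop_total_le_exp_pressure_base[OF irr ne P, of "n + m", folded b_def]
      by (meson mult_left_mono order_trans zero_le)
    also have "ennreal (exp (real (n + m) * p)) = ennreal (exp (real m * p)) * ennreal (exp (real n * p))"
      by (simp add: ennreal_mult[symmetric] exp_add[symmetric] algebra_simps)
    finally show ?thesis by (simp add: ac_simps)
  qed
  moreover have "K * distortion * ennreal (exp (real m * p)) < \<infinity>"
    using K distortion_fin by (simp add: ennreal_mult_less_top)
  ultimately show thesis using that by blast
qed

text \<open>Otherwise the loop sums would be bounded by a constant times \<open>exp (n p)\<close> for every real \<open>p\<close> and
  vanish, but there is a loop.\<close>

lemma pressure_not_minus_infinity:
  assumes irr: "irreducible I A" and "I \<noteq> {}"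
  shows "gurevich_pressure I A f \<noteq> - \<infinity>"
proof
  assume P: "gurevich_pressure I A f = - \<infinity>"
  define a where "a = (SOME a. a \<in> I)"
  have a: "a \<in> I" using assms(2) unfolding a_def by (simp add: some_in_eq)
  obtain d where d: "distortion = ennreal d" "1 \<le> d" by (rule distortion_eq_real)
  obtain u where u: "word_path I A a u a" using irr a by (auto simp: irreducible_def)
  obtain r where r: "W u = ennreal (exp r)" by (rule W_eq_exp)
  define n where "n = length u"
  have n: "n > 0" using u by (auto simp: n_def word_path_def)
  define p where "p = (r - ln d - 1) / real n"
  have "ennreal (exp r) = Wsum {u}" by (simp add: Wsum_def r)
  also have "\<dots> \<le> loop_total a n"
    unfolding loop_total_def using u by (intro Wsum_mono) (auto simp: loops_def n_def)
  also have "\<dots> \<le> distortion * ennreal (exp (real n * p))"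
    using loop_total_le_exp_pressure_base[OF assms, of p n] P by (simp add: a_def)
  finally have "exp r \<le> d * exp (real n * p)"
    using d by (simp add: ennreal_mult[symmetric])
  also have "\<dots> = exp (ln d + real n * p)"
    using d by (simp add: exp_add)
  finally show False
    using n by (simp add: p_def)
qed

lemma pressure_eq_real:
  assumes "irreducible I A" "I \<noteq> {}" "gurevich_pressure I A f < \<infinity>"
  obtains p where "gurevich_pressure I A f = ereal p"
  using pressure_not_minus_infinity[OF assms(1,2)] assms(3)
  by (cases "gurevich_pressure I A f") auto

end


section \<open>Finitely primitive shifts are positive recurrent\<close>

text \<open>One small term suffices, because an index is split into blocks of length \<open>m\<close> and a bounded rest.\<close>

lemma submultiplicative_geometric_decay:
  fixes x :: "nat \<Rightarrow> ennreal"
  assumes sub: "\<And>n m. x (n + m) \<le> D * (x n * x m)" and fin: "\<And>n. x n < \<infinity>"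
    and m: "m \<ge> 1" and small: "D * x m < 1"
  obtains r K :: real where "0 < r" "r < 1" "0 < K" "\<And>n. x n \<le> ennreal (K * r ^ n)"
proof -
  obtain t0 where t0: "D * x m = ennreal t0" "0 \<le> t0" "t0 < 1"
    using small by (cases "D * x m") auto
  define t where "t = max t0 (1/2)"
  have t: "0 < t" "t < 1" "D * x m \<le> ennreal t"
    using t0 by (auto simp: t_def intro!: ennreal_leI)
  define r where "r = t powr (1 / real m)"
  have rm: "r ^ m = t"
    using t m by (simp add: r_def powr_realpow[symmetric] powr_powr)
  have r: "0 < r" "r < 1"
  proof -
    show "0 < r" using t by (simp add: r_def)
    show "r < 1"
    proof (rule ccontr)
      assume "\<not> r < 1"
      then have "1 \<le> r ^ m" by (simp add: one_le_power)
      then show False using rm t by simp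
    qed
  qed
  have block: "x (k * m + j) \<le> ennreal (t ^ k) * x j" for k j
  proof (induction k)
    case (Suc k)
    have "x (Suc k * m + j) = x (m + (k * m + j))"
      by (simp add: ac_simps)
    also have "\<dots> \<le> D * (x m * x (k * m + j))"
      by (rule sub)
    also have "\<dots> = (D * x m) * x (k * m + j)"
      by (simp add: ac_simps)
    also have "\<dots> \<le> ennreal t * (ennreal (t ^ k) * x j)"
      using t Suc by (intro mult_mono) auto
    finally show ?case
      using t by (simp add: ennreal_mult ac_simps)
  qed simp
  define B where "B = (\<Sum>j<m. enn2real (x j)) + 1"
  have B1: "0 < B"
    by (simp add: B_def add_nonneg_pos sum_nonneg)
  have B: "x j \<le> ennreal B" if "j < m" for j
  proof -
    have "enn2real (x j) \<le> (\<Sum>j<m. enn2real (x j))"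
      using that by (intro member_le_sum) auto
    then have "ennreal (enn2real (x j)) \<le> ennreal B"
      by (intro ennreal_leI) (simp add: B_def)
    then show ?thesis
      using fin[of j] by (simp add: less_top)
  qed
  have "x n \<le> ennreal (B / t * r ^ n)" for n
  proof -
    have "x n = x ((n div m) * m + n mod m)"
      by simp
    also have "\<dots> \<le> ennreal (t ^ (n div m)) * x (n mod m)"
      by (rule block)
    also have "\<dots> \<le> ennreal (t ^ (n div m)) * ennreal B"
      using m by (intro mult_left_mono B) auto
    also have "\<dots> = ennreal (t ^ (n div m) * B)"
      using t B1 by (simp add: ennreal_mult)
    also have "\<dots> \<le> ennreal (B / t * r ^ n)"
    proof (rule ennreal_leI)
      have "t ^ (n div m) * t \<le> t ^ (n div m) * r ^ (n mod m)"
      proof (rule mult_left_mono)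
        show "t \<le> r ^ (n mod m)"
          unfolding rm[symmetric] using r m by (intro power_decreasing) (auto intro: less_imp_le)
      qed (use t in simp)
      also have "\<dots> = r ^ (m * (n div m) + n mod m)"
        by (simp only: rm[symmetric] power_mult power_add)
      finally have "t ^ (n div m) * t \<le> r ^ n"
        by simp
      then have "t ^ (n div m) \<le> r ^ n / t"
        using t by (simp add: field_simps)
      then show "t ^ (n div m) * B \<le> B / t * r ^ n"
        using mult_right_mono[of "t ^ (n div m)" "r ^ n / t" B] B1 by (simp add: ac_simps)
    qed
    finally show ?thesis .
  qed
  then show thesis
    using r t B1 by (intro that[of r "B / t"]) auto
qed

lemma one_le_mult_ennreal:
  fixes x :: ennreal
  assumes "1 \<le> ennreal k * x"
  shows "0 < k" and "ennreal (1 / k) \<le> x"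
proof -
  show k: "0 < k"
  proof (rule ccontr)
    assume "\<not> 0 < k"
    then have "ennreal k = 0" by (simp add: ennreal_neg)
    then show False using assms by simp
  qed
  have "ennreal (1 / k) * 1 \<le> ennreal (1 / k) * (ennreal k * x)"
    using assms by (rule mult_left_mono) simp
  also have "\<dots> = x"
    using k by (simp add: mult.assoc[symmetric] ennreal_mult[symmetric])
  finally show "ennreal (1 / k) \<le> x" by simp
qed

lemma successively_insert:
  assumes "successively R x" "x \<noteq> []" "successively R y" "y \<noteq> []" "q \<noteq> []"
    and "successively R (last x # q @ [hd y])"
  shows "successively R (x @ q @ y)"
  using assms by (auto simp: successively_append_iff successively_Cons)

context markov_potential
begin

lemma W_lower_bound_finite:
  assumes "finite S"
  obtains K where "K < \<infinity>" "\<And>u. u \<in> S \<Longrightarrow> 1 \<le> K * W u"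
proof -
  have "\<forall>u. \<exists>r. W u = ennreal (exp r)"
    using W_eq_exp by metis
  then obtain r where r: "\<And>u. W u = ennreal (exp (r u))" by metis
  define K where "K = (\<Sum>u\<in>S. ennreal (exp (- r u)))"
  have "1 \<le> K * W u" if u: "u \<in> S" for u
  proof -
    have "1 = ennreal (exp (- r u)) * (ennreal (exp (r u)) * 1)"
      by (rule exp_cancel_ennreal[symmetric])
    also have "\<dots> = ennreal (exp (- r u)) * W u"
      by (simp add: r)
    also have "\<dots> \<le> K * W u"
      unfolding K_def using assms u by (intro mult_right_mono member_le_sum) auto
    finally show ?thesis .
  qed
  moreover have "K < \<infinity>"
    using assms by (simp add: K_def)
  ultimately show thesis by (rule that[rotated])
qed

lemma words_language:
  assumes irr: "irreducible I A" and ne: "I \<noteq> {}" and u: "u \<in> words I A n"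
  shows "u \<in> language"
proof (cases "u = []")
  case True
  obtain a where a: "a \<in> I" using ne by auto
  have "[] \<in> loops I A a" by (simp add: loops_def)
  then show ?thesis using loops_language[OF a irr] True by simp
next
  case False
  then have ends: "hd u \<in> I" "last u \<in> I"
    using u by (auto simp: words_def)
  obtain q where q: "word_path I A (last u) q (hd u)"
    using irr ends unfolding irreducible_def by blast
  \<comment> \<open>\<open>q\<close> starts with the last letter of \<open>u\<close>, so only its tail is appended to \<open>u\<close>\<close>
  then obtain t where t: "q = last u # t"
    by (cases q) (auto simp: word_path_def)
  have "successively A (u @ (t @ [hd u]))"
    using q u False unfolding t by (auto simp: word_path_def words_def successively_append_iff successively_Cons)
  then have "u @ t \<in> loops I A (hd u)"
    using q u False unfolding t by (auto simp: word_path_def words_def loops_def)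
  then show ?thesis
    using loops_language[OF ends(1) irr] language_append by blast
qed

definition word_total :: "nat \<Rightarrow> ennreal" where
  "word_total n = Wsum (words I A n)"

definition avoiding_total :: "'a \<Rightarrow> nat \<Rightarrow> ennreal" where
  "avoiding_total a n = Wsum {u\<in>words I A n. a \<notin> set u}"

lemma words_split:
  assumes "u \<in> words I A (n + m)"
  shows "take n u \<in> words I A n" "drop n u \<in> words I A m"
proof -
  have "successively A (take n u @ drop n u)"
    using assms by (simp add: words_def)
  then have "successively A (take n u)" "successively A (drop n u)"
    by (auto simp only: successively_append_iff)
  then show "take n u \<in> words I A n" "drop n u \<in> words I A m"
    using assms set_take_subset[of n u] set_drop_subset[of n u] by (auto simp: words_def)
qed

lemma word_total_mult:
  assumes "irreducible I A" "I \<noteq> {}"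
  shows "word_total (n + m) \<le> distortion * (word_total n * word_total m)"
  unfolding word_total_def
proof (rule Wsum_append_le)
  fix z assume "z \<in> words I A (n + m)"
  from words_split[OF this] show "\<exists>u\<in>words I A n. \<exists>v\<in>words I A m. z = u @ v"
    by (metis append_take_drop_id)
qed (use words_language[OF assms] in blast)

lemma avoiding_total_mult:
  assumes "irreducible I A" "I \<noteq> {}"
  shows "avoiding_total a (n + m) \<le> distortion * (avoiding_total a n * avoiding_total a m)"
  unfolding avoiding_total_def
proof (rule Wsum_append_le)
  fix z assume z: "z \<in> {u\<in>words I A (n + m). a \<notin> set u}"
  then have "take n z \<in> words I A n" "drop n z \<in> words I A m"
    using words_split by blast+
  moreover have "a \<notin> set (take n z)" "a \<notin> set (drop n z)"
    using z by (auto dest: in_set_takeD in_set_dropD)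
  ultimately show "\<exists>u\<in>{u\<in>words I A n. a \<notin> set u}. \<exists>v\<in>{u\<in>words I A m. a \<notin> set u}. z = u @ v"
    by (metis (no_types, lifting) append_take_drop_id mem_Collect_eq)
qed (use words_language[OF assms] in blast)

lemma connecting_words:
  assumes "finitely_primitive I A"
  obtains l \<Lambda> c where "finite \<Lambda>"
    "\<And>i j. i \<in> I \<Longrightarrow> j \<in> I \<Longrightarrow> c i j \<in> \<Lambda> \<and> length (c i j) = l \<and> c i j \<noteq> [] \<and> set (c i j) \<subseteq> I \<and>
       successively A (i # c i j @ [j])"
proof -
  obtain l \<Lambda> where l: "l \<ge> 1" "finite \<Lambda>" "\<Lambda> \<subseteq> words I A l"
    and conn: "\<And>i j. i \<in> I \<Longrightarrow> j \<in> I \<Longrightarrow> \<exists>w\<in>\<Lambda>. i # w @ [j] \<in> all_words I A"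
    using assms unfolding finitely_primitive_def by blast
  define c where "c i j = (SOME w. w \<in> \<Lambda> \<and> i # w @ [j] \<in> all_words I A)" for i j
  have c: "c i j \<in> \<Lambda> \<and> i # c i j @ [j] \<in> all_words I A" if "i \<in> I" "j \<in> I" for i j
    unfolding c_def using conn[OF that] by (intro someI_ex[of "\<lambda>w. w \<in> \<Lambda> \<and> i # w @ [j] \<in> all_words I A"]) blast
  have "c i j \<in> \<Lambda> \<and> length (c i j) = l \<and> c i j \<noteq> [] \<and> set (c i j) \<subseteq> I \<and>
      successively A (i # c i j @ [j])" if "i \<in> I" "j \<in> I" for i j
  proof -
    have "c i j \<in> words I A l" using c[OF that] l by blast
    moreover have "successively A (i # c i j @ [j])"
      using c[OF that] by (auto simp: all_words_def words_def)
    ultimately show ?thesis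
      using c[OF that] l by (auto simp: words_def)
  qed
  then show thesis using that l(2) by blast
qed

text \<open>By finite primitivity every word can be completed to a loop at \<open>a\<close> by connecting words from a
  finite set. Their weights are bounded below and their lengths are fixed, so the completed loops have
  a common length from which the original word can be cut out.\<close>

lemma word_total_le_loop_total:
  assumes fp: "finitely_primitive I A" and a: "a \<in> I"
  obtains K M where "K < \<infinity>" "\<And>n. n \<ge> 1 \<Longrightarrow> word_total n \<le> K * loop_total a (n + M)"
proof -
  have irr: "irreducible I A" by (rule irreducible_if_primitive[OF fp])
  obtain l \<Lambda> c where fin: "finite \<Lambda>"
    and c: "\<And>i j. i \<in> I \<Longrightarrow> j \<in> I \<Longrightarrow> c i j \<in> \<Lambda> \<and> length (c i j) = l \<and> c i j \<noteq> [] \<and> set (c i j) \<subseteq> I \<and>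
       successively A (i # c i j @ [j])"
    by (rule connecting_words[OF fp]) (erule that)
  have fin': "finite (\<Lambda> \<union> (#) a ` \<Lambda>)" using fin by simp
  obtain K where K: "K < \<infinity>" "\<And>u. u \<in> \<Lambda> \<union> (#) a ` \<Lambda> \<Longrightarrow> 1 \<le> K * W u"
    by (rule W_lower_bound_finite[OF fin']) (erule that)
  define h where "h u = (a # c a (hd u)) @ u @ c (last u) a" for u
  have "word_total n \<le> (K ^ 2 * distortion ^ 2) * loop_total a (n + (2 * l + 1))" if n: "n \<ge> 1" for n
  proof -
    have facts: "hd u \<in> I" "last u \<in> I" "u \<noteq> []" "set u \<subseteq> I" "successively A u" "length u = n"
      if "u \<in> words I A n" for u
    proof -
      show *: "u \<noteq> []" "set u \<subseteq> I" "successively A u" "length u = n"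
        using that n by (auto simp: words_def)
      then show "hd u \<in> I" "last u \<in> I"
        using hd_in_set last_in_set by blast+
    qed
    have h_loop: "h u \<in> loops I A a" if "u \<in> words I A n" for u
    proof -
      define q1 where "q1 = c a (hd u)"
      define q2 where "q2 = c (last u) a"
      have q1: "q1 \<noteq> []" "set q1 \<subseteq> I" "successively A (a # q1 @ [hd u])"
        using c[OF a facts(1)[OF that]] unfolding q1_def by blast+
      have q2: "q2 \<noteq> []" "set q2 \<subseteq> I" "successively A (last u # q2 @ [a])"
        using c[OF facts(2)[OF that] a] unfolding q2_def by blast+
      note u = facts[OF that]
      have "successively A ([a] @ q1 @ u)"
        by (rule successively_insert) (use u q1 in simp_all)
      then have "successively A (([a] @ q1 @ u) @ q2 @ [a])"
        by (rule successively_insert) (use u q2 in simp_all)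
      then show ?thesis
        using u a q1 q2 unfolding loops_def word_path_def h_def q1_def[symmetric] q2_def[symmetric] by simp
    qed
    have "word_total n \<le> (\<Sum>\<^sub>\<infinity>z\<in>{z\<in>loops I A a. length z = n + (2 * l + 1)}. (K ^ 2 * distortion ^ 2) * W z)"
      unfolding word_total_def Wsum_def
    proof (rule infsum_ennreal_inj_le[where h = h])
      show "inj_on h (words I A n)"
      proof (rule inj_onI)
        fix u v assume uv: "u \<in> words I A n" "v \<in> words I A n" "h u = h v"
        have "take n (drop (l + 1) (h u)) = u" if "u \<in> words I A n" for u
          using facts[OF that] c[OF a facts(1)[OF that]] by (simp add: h_def)
        then show "u = v" using uv by metis
      qed
      show "h ` words I A n \<subseteq> {z\<in>loops I A a. length z = n + (2 * l + 1)}"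
      proof
        fix z assume "z \<in> h ` words I A n"
        then obtain u where u: "u \<in> words I A n" "z = h u" by auto
        then show "z \<in> {z\<in>loops I A a. length z = n + (2 * l + 1)}"
          using h_loop facts[OF u(1)] c[OF a facts(1)[OF u(1)]] c[OF facts(2)[OF u(1)] a]
          by (simp add: h_def)
      qed
      fix u assume u: "u \<in> words I A n"
      note f = facts[OF u] c[OF a facts(1)[OF u]] c[OF facts(2)[OF u] a]
      let ?p = "a # c a (hd u)" and ?q = "c (last u) a"
      have lang: "?p @ (u @ ?q) \<in> language"
        using loops_language[OF a irr h_loop[OF u]] by (simp add: h_def)
      have "W u = 1 * W u * 1" by simp
      also have "\<dots> \<le> (K * W ?p) * W u * (K * W ?q)"
        using f by (intro mult_mono K) auto
      also have "\<dots> = K ^ 2 * (W ?p * (W u * W ?q))"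
        by (simp add: power2_eq_square ac_simps)
      also have "\<dots> \<le> K ^ 2 * (W ?p * (distortion * W (u @ ?q)))"
        using lang language_append[of ?p "u @ ?q"] by (intro mult_left_mono W_append_ge) auto
      also have "\<dots> = K ^ 2 * distortion * (W ?p * W (u @ ?q))"
        by (simp add: ac_simps)
      also have "\<dots> \<le> K ^ 2 * distortion * (distortion * W (?p @ (u @ ?q)))"
        by (intro mult_left_mono W_append_ge lang) auto
      finally show "W u \<le> (K ^ 2 * distortion ^ 2) * W (h u)"
        by (simp add: h_def power2_eq_square ac_simps)
    qed
    then show ?thesis
      by (simp add: infsum_ennreal_cmult loop_total_def Wsum_def)
  qed
  moreover have "K ^ 2 * distortion ^ 2 < \<infinity>"
    using K distortion_fin by (simp add: ennreal_mult_less_top power_less_top_ennreal)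
  ultimately show thesis by (rule that[rotated])
qed

text \<open>A word avoiding \<open>a\<close> can be cut at any position, and \<open>a\<close> together with connecting words can be put in
  between at the cost of a bounded factor. In the result the first occurrence of \<open>a\<close> lies at most \<open>l\<close>
  letters behind the cut, as the connecting word before \<open>a\<close> may itself contain \<open>a\<close>. Cutting only at
  multiples of \<open>l + 1\<close> therefore makes the insertion reversible, and \<open>N - 1\<close> positions give \<open>N - 1\<close>
  copies of the sum over the avoiding words inside the sum over all words.\<close>

lemma avoiding_total_insertion:
  assumes fp: "finitely_primitive I A" and a: "a \<in> I"
  obtains K l where "K < \<infinity>"
    "\<And>N. of_nat (N - 1) * avoiding_total a ((l + 1) * N) \<le> K * word_total ((l + 1) * N + (2 * l + 1))"
proof -
  have irr: "irreducible I A" by (rule irreducible_if_primitive[OF fp])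
  have ne: "I \<noteq> {}" using a by auto
  obtain l \<Lambda> c where fin: "finite \<Lambda>"
    and c: "\<And>i j. i \<in> I \<Longrightarrow> j \<in> I \<Longrightarrow> c i j \<in> \<Lambda> \<and> length (c i j) = l \<and> c i j \<noteq> [] \<and> set (c i j) \<subseteq> I \<and>
       successively A (i # c i j @ [j])"
    by (rule connecting_words[OF fp]) (erule that)
  define \<Lambda>' where "\<Lambda>' = (\<lambda>(q1, q2). q1 @ a # q2) ` (\<Lambda> \<times> \<Lambda>)"
  have fin': "finite \<Lambda>'" using fin by (simp add: \<Lambda>'_def)
  obtain K where K: "K < \<infinity>" "\<And>u. u \<in> \<Lambda>' \<Longrightarrow> 1 \<le> K * W u"
    by (rule W_lower_bound_finite[OF fin']) (erule that)
  define mid where "mid x y = c (last x) a @ a # c a (hd y)" for x y :: "'a list"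
  \<comment> \<open>the pair \<open>(u, i)\<close> stands for a word and the cut behind its first \<open>(l + 1) * i\<close> letters\<close>
  define h where "h = (\<lambda>(u, i). take ((l + 1) * i) u @ mid (take ((l + 1) * i) u) (drop ((l + 1) * i) u) @
      drop ((l + 1) * i) u)"
  have "of_nat (N - 1) * avoiding_total a ((l + 1) * N) \<le> (distortion ^ 3 * K) * word_total ((l + 1) * N + (2 * l + 1))" for N
  proof -
    let ?m = "(l + 1) * N"
    let ?U = "{u\<in>words I A ?m. a \<notin> set u}"
    let ?P = "?U \<times> {1..<N}"
    have facts: "x \<noteq> [] \<and> y \<noteq> [] \<and> u = x @ y \<and> length x = (l + 1) * i \<and> length y = ?m - (l + 1) * i \<and>
        mid x y \<in> \<Lambda>' \<and> length (mid x y) = 2 * l + 1 \<and> x @ mid x y @ y \<in> words I A (?m + (2 * l + 1)) \<and>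
        (\<exists>e. e \<le> l \<and> length (takeWhile (\<lambda>b. b \<noteq> a) (x @ mid x y @ y)) = (l + 1) * i + e)"
      if u: "u \<in> ?U" and i: "i \<in> {1..<N}" and x: "x = take ((l + 1) * i) u" and y: "y = drop ((l + 1) * i) u"
      for u i x y
    proof -
      have len: "length u = ?m" "set u \<subseteq> I" "successively A u" "a \<notin> set u" 
        using u by (auto simp: words_def)
      have lt: "(l + 1) * i < ?m" "0 < (l + 1) * i"
        by (rule mult_strict_left_mono; use i in simp) (use i in simp)
      have xy: "x \<noteq> []" "y \<noteq> []" "u = x @ y" "length x = (l + 1) * i" "length y = ?m - (l + 1) * i"
        using lt len x y by auto
      have ends: "last x \<in> I" "hd y \<in> I"
        using xy len by auto
      note c1 = c[OF ends(1) a] and c2 = c[OF a ends(2)]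
      let ?q1 = "c (last x) a" and ?q2 = "c a (hd y)"
      have s: "successively A x" "successively A y"
        using len xy by (auto simp: successively_append_iff)
      have "successively A (x @ ?q1 @ [a])"
        by (rule successively_insert) (use s xy c1 in simp_all)
      then have "successively A ((x @ ?q1 @ [a]) @ ?q2 @ y)"
        by (rule successively_insert) (use s xy c2 in simp_all)
      then have word: "x @ mid x y @ y \<in> words I A (?m + (2 * l + 1))"
        using c1 c2 len xy a lt by (auto simp: words_def mid_def)
      have "takeWhile (\<lambda>b. b \<noteq> a) (x @ mid x y @ y) = x @ takeWhile (\<lambda>b. b \<noteq> a) (mid x y @ y)"
        using len xy by (intro takeWhile_append2) auto
      moreover have "length (takeWhile (\<lambda>b. b \<noteq> a) (mid x y @ y)) \<le> l"
      proof (rule ccontr)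
        let ?t = "takeWhile (\<lambda>b. b \<noteq> a) (mid x y @ y)"
        assume "\<not> length ?t \<le> l"
        then have "l < length ?t" by simp
        then have "?t ! l \<noteq> a" "?t ! l = (mid x y @ y) ! l"
          using nth_mem[of l ?t] by (auto dest: set_takeWhileD simp: takeWhile_nth)
        then show False
          using c1 by (simp add: mid_def nth_append)
      qed
      ultimately have tw: "\<exists>e. e \<le> l \<and> length (takeWhile (\<lambda>b. b \<noteq> a) (x @ mid x y @ y)) = (l + 1) * i + e"
        using xy(4) by (metis length_append)
      have "(?q1, ?q2) \<in> \<Lambda> \<times> \<Lambda>"
        using c1 c2 by simp
      then have "mid x y \<in> \<Lambda>'"
        unfolding \<Lambda>'_def mid_def by (rule rev_image_eqI) simp
      moreover have "length (mid x y) = 2 * l + 1"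
        using c1 c2 by (simp add: mid_def)
      ultimately show ?thesis
        using xy word tw by (intro conjI)
    qed
    have "of_nat (N - 1) * avoiding_total a ?m = (\<Sum>\<^sub>\<infinity>(u, i)\<in>?P. W u * 1)"
      unfolding infsum_ennreal_product[of W ?U "\<lambda>_. 1" "{1..<N}", symmetric]
      by (simp add: avoiding_total_def Wsum_def mult.commute)
    also have "\<dots> \<le> (\<Sum>\<^sub>\<infinity>z\<in>words I A (?m + (2 * l + 1)). (distortion ^ 3 * K) * W z)"
    proof (rule infsum_ennreal_inj_le[where h = h])
      show "inj_on h ?P"
      proof (rule inj_onI)
        fix p p' assume pp: "p \<in> ?P" "p' \<in> ?P" "h p = h p'"
        have dec: "i = length (takeWhile (\<lambda>b. b \<noteq> a) (h (u, i))) div (l + 1) \<and>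
            u = take ((l + 1) * i) (h (u, i)) @ drop ((l + 1) * i + (2 * l + 1)) (h (u, i))"
          if "u \<in> ?U" "i \<in> {1..<N}" for u i
        proof -
          let ?x = "take ((l + 1) * i) u" and ?y = "drop ((l + 1) * i) u"
          note f = facts[OF that refl refl]
          have h: "h (u, i) = ?x @ mid ?x ?y @ ?y"
            by (simp add: h_def)
          from f obtain e where e: "e \<le> l"
            "length (takeWhile (\<lambda>b. b \<noteq> a) (h (u, i))) = (l + 1) * i + e"
            unfolding h by blast
          have "((l + 1) * i + e) div (l + 1) = i"
            using e(1) by (metis Suc_eq_plus1 add.right_neutral div_less div_mult_self4 le_imp_less_Suc nat.distinct(1))
          moreover have "take ((l + 1) * i) (h (u, i)) = ?x"
            unfolding h using f by simp
          moreover have "drop ((l + 1) * i + (2 * l + 1)) (h (u, i)) = ?y"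
            unfolding h using f by simp
          ultimately show ?thesis
            using e(2) by (metis append_take_drop_id)
        qed
        obtain u i u' i' where e: "p = (u, i)" "p' = (u', i')" by force
        have m: "u \<in> ?U" "i \<in> {1..<N}" "u' \<in> ?U" "i' \<in> {1..<N}"
          using pp(1,2) unfolding e by blast+
        have heq: "h (u, i) = h (u', i')"
          using pp(3) unfolding e .
        have i: "i = i'"
          using dec[OF m(1,2), THEN conjunct1] dec[OF m(3,4), THEN conjunct1] unfolding heq by (rule trans[OF _ sym])
        have "u = u'"
          using dec[OF m(1,2), THEN conjunct2, unfolded heq, unfolded i] dec[OF m(3,4), THEN conjunct2] by (rule trans[OF _ sym])
        then show "p = p'" using e i by simp
      qed
      show "h ` ?P \<subseteq> words I A (?m + (2 * l + 1))"
      proof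
        fix z assume "z \<in> h ` ?P"
        then obtain u i where ui: "u \<in> ?U" "i \<in> {1..<N}" "z = h (u, i)" by blast
        then show "z \<in> words I A (?m + (2 * l + 1))"
          using facts[OF ui(1,2) refl refl] by (simp only: h_def prod.case)
      qed
      fix p assume "p \<in> ?P"
      then obtain u i where ui: "p = (u, i)" "u \<in> ?U" "i \<in> {1..<N}" by blast
      define x where "x = take ((l + 1) * i) u"
      define y where "y = drop ((l + 1) * i) u"
      note f = facts[OF ui(2,3) x_def y_def]
      have hp: "h p = x @ mid x y @ y" by (simp add: ui h_def x_def y_def)
      have lang: "x @ (mid x y @ y) \<in> language"
        using f words_language[OF irr ne] by blast
      have "u \<in> language" using ui words_language[OF irr ne] by blast
      then have "W u \<le> distortion * (W x * W y)"
        using W_append_le[of x y] f by simp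
      also have "\<dots> = distortion * (W x * (1 * W y))" by simp
      also have "\<dots> \<le> distortion * (W x * ((K * W (mid x y)) * W y))"
        using f by (intro mult_left_mono mult_right_mono K(2)) auto
      also have "\<dots> = distortion * K * (W x * (W (mid x y) * W y))"
        by (simp add: ac_simps)
      also have "\<dots> \<le> distortion * K * (W x * (distortion * W (mid x y @ y)))"
        using language_append[OF lang] by (intro mult_left_mono W_append_ge) auto
      also have "\<dots> = distortion * K * distortion * (W x * W (mid x y @ y))"
        by (simp add: ac_simps)
      also have "\<dots> \<le> distortion * K * distortion * (distortion * W (x @ mid x y @ y))"
        by (intro mult_left_mono W_append_ge lang) auto
      finally show "(case p of (u, i) \<Rightarrow> W u * 1) \<le> (distortion ^ 3 * K) * W (h p)"
        unfolding hp by (simp add: ui power3_eq_cube ac_simps)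
    qed
    also have "\<dots> = (distortion ^ 3 * K) * word_total (?m + (2 * l + 1))"
      by (simp add: infsum_ennreal_cmult word_total_def Wsum_def)
    finally show ?thesis .
  qed
  moreover have "distortion ^ 3 * K < \<infinity>"
    using K distortion_fin by (simp add: ennreal_mult_less_top power_less_top_ennreal)
  ultimately show thesis by (rule that[rotated])
qed

text \<open>Sums over all words are submultiplicative up to a constant and comparable with loop sums. Up to
  constants they equal \<open>exp (n p)\<close> for the pressure \<open>p\<close>: if the normalised sums were small once, they would decay
  geometrically and the pressure would be smaller than \<open>p\<close>. This gives recurrence. By insertion the
  normalised sums over the words avoiding \<open>a\<close> tend to 0 along a subsequence; as they are
  submultiplicative up to a constant as well, they decay geometrically, and so do the first-return sums.\<close>

theorem finitely_primitive_positive_recurrent: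
  assumes fp: "finitely_primitive I A" and ne: "I \<noteq> {}" and P: "gurevich_pressure I A f < \<infinity>"
  shows "positive_recurrent I A f"
proof -
  have irr: "irreducible I A" by (rule irreducible_if_primitive[OF fp])
  obtain p where p: "gurevich_pressure I A f = ereal p"
    by (rule pressure_eq_real[OF irr ne P])
  define a where "a = (SOME a. a \<in> I)"
  have a: "a \<in> I" using ne unfolding a_def by (simp add: some_in_eq)
  define \<omega> where "\<omega> n = ennreal (exp (- (real n * p)))" for n
  have \<omega>_add: "\<omega> (n + m) = \<omega> n * \<omega> m" for n m
    by (simp add: \<omega>_def ennreal_mult[symmetric] exp_add[symmetric] algebra_simps)
  have \<omega>_exp: "\<omega> n * ennreal (exp (real n * p)) = 1" for n
    by (simp add: \<omega>_def ennreal_mult[symmetric] exp_add[symmetric])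
  have \<omega>_fin: "\<omega> n < \<infinity>" for n
    by (simp add: \<omega>_def)
  have \<omega>_cancel: "ennreal (exp (real n * p)) * (\<omega> n * x) = x" for n x
    using \<omega>_exp[of n] by (simp add: mult.assoc[symmetric] mult.commute[of _ "\<omega> n"])
  obtain K1 M where K1: "K1 < \<infinity>" and TL: "\<And>n. n \<ge> 1 \<Longrightarrow> word_total n \<le> K1 * loop_total a (n + M)"
    by (rule word_total_le_loop_total[OF fp a]) (erule that)
  have L_le: "loop_total a n \<le> distortion * ennreal (exp (real n * p))" for n
    unfolding a_def by (rule loop_total_le_exp_pressure_base[OF irr ne]) (simp add: p)
  define K2 where "K2 = K1 * distortion * ennreal (exp (real M * p))"
  have K2: "K2 < \<infinity>"
    using K1 distortion_fin by (simp add: K2_def ennreal_mult_less_top)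
  have T_le: "word_total n \<le> K2 * ennreal (exp (real n * p))" if "n \<ge> 1" for n
  proof -
    have "word_total n \<le> K1 * (distortion * ennreal (exp (real (n + M) * p)))"
      using TL[OF that] L_le[of "n + M"] by (meson mult_left_mono order_trans zero_le)
    also have "ennreal (exp (real (n + M) * p)) = ennreal (exp (real M * p)) * ennreal (exp (real n * p))"
      by (simp add: ennreal_mult[symmetric] exp_add[symmetric] algebra_simps)
    finally show ?thesis by (simp add: K2_def ac_simps)
  qed
  have T_fin: "word_total n < \<infinity>" for n
  proof (cases "n = 0")
    case True
    then have "words I A n = {[]}" by (auto simp: words_def)
    then show ?thesis by (simp add: word_total_def Wsum_def W_nil)
  next
    case False
    then have "word_total n \<le> K2 * ennreal (exp (real n * p))" using T_le by simp
    also have "\<dots> < \<infinity>" using K2 by (simp add: ennreal_mult_less_top)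
    finally show ?thesis .
  qed
  have X_fin: "avoiding_total a n < \<infinity>" for n
    using T_fin[of n] Wsum_mono[of "{u\<in>words I A n. a \<notin> set u}" "words I A n"]
    by (auto simp: avoiding_total_def word_total_def intro: le_less_trans)
  have submult: "\<omega> (n + m) * Y (n + m) \<le> distortion * ((\<omega> n * Y n) * (\<omega> m * Y m))"
    if "\<And>n m. Y (n + m) \<le> distortion * (Y n * Y m)" for Y n m
    using mult_left_mono[OF that[of n m], of "\<omega> (n + m)"] by (simp add: \<omega>_add ac_simps)

  \<comment> \<open>the normalised word sums stay away from zero, since otherwise the pressure would drop\<close>
  have T_ge: "1 \<le> distortion * (\<omega> n * word_total n)" if n: "n \<ge> 1" for n
  proof (rule ccontr)
    assume "\<not> 1 \<le> distortion * (\<omega> n * word_total n)"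
    then have small: "distortion * (\<omega> n * word_total n) < 1" by simp
    obtain r K where r: "0 < r" "r < 1" "0 < K" and dec: "\<And>n. \<omega> n * word_total n \<le> ennreal (K * r ^ n)"
    proof (rule submultiplicative_geometric_decay[of "\<lambda>n. \<omega> n * word_total n", OF _ _ n small])
      show "\<omega> (n + m) * word_total (n + m) \<le> distortion * (\<omega> n * word_total n * (\<omega> m * word_total m))" for n m
        by (rule submult[OF word_total_mult[OF irr ne]])
      show "\<omega> n * word_total n < \<infinity>" for n
        using T_fin \<omega>_fin by (simp add: ennreal_mult_less_top)
    qed (erule that)
    obtain d where d: "distortion = ennreal d" "1 \<le> d" by (rule distortion_eq_real)
    have "gurevich_pressure I A f \<le> ereal (p + ln r)"
    proof (rule pressure_le[of "d * K"])
      show "0 < d * K" using d r by simp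
      show "eventually (\<lambda>n. Z I A f (SOME a. a \<in> I) n \<le> ennreal (d * K * exp (real n * (p + ln r)))) sequentially"
        using eventually_ge_at_top[of 1]
      proof eventually_elim
        case (elim n)
        have "loop_total a n \<le> word_total n"
          unfolding loop_total_def word_total_def using elim
          by (intro Wsum_mono) (auto simp: loops_def word_path_def words_def successively_append_iff)
        also have "word_total n = ennreal (exp (real n * p)) * (\<omega> n * word_total n)"
          by (rule \<omega>_cancel[symmetric])
        also have "\<dots> \<le> ennreal (exp (real n * p)) * ennreal (K * r ^ n)"
          by (intro mult_left_mono dec) auto
        also have "\<dots> = ennreal (K * exp (real n * (p + ln r)))"
        proof -
          have "r ^ n = exp (real n * ln r)"
            using r by (simp add: exp_of_nat_mult)
          then show ?thesis
            using r by (simp add: ennreal_mult[symmetric] exp_add[symmetric] algebra_simps)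
        qed
        finally have "loop_total a n \<le> ennreal (K * exp (real n * (p + ln r)))" .
        then have "distortion * loop_total a n \<le> distortion * ennreal (K * exp (real n * (p + ln r)))"
          by (rule mult_left_mono) simp
        also have "\<dots> = ennreal (d * K * exp (real n * (p + ln r)))"
          using d r by (simp add: ennreal_mult[symmetric] ac_simps)
        finally have "distortion * loop_total a n \<le> ennreal (d * K * exp (real n * (p + ln r)))" .
        moreover have "Z I A f a n \<le> distortion * loop_total a n"
          using Z_loop_sum(1)[OF elim] by (simp add: loop_total_eq_loop_sum)
        ultimately show ?case
          unfolding a_def[symmetric] by (rule order_trans[rotated])
      qed
    qed
    then have "p \<le> p + ln r" by (simp add: p)
    then show False using r by simp
  qed

  have Z_ge: "\<exists>c>0. \<forall>n\<ge>M + 1. c \<le> \<omega> n * Z I A f a n"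
  proof -
    define k where "k = distortion * (K1 * ennreal (exp (real M * p)) * distortion)"
    have k_fin: "k < \<infinity>"
      using K1 distortion_fin by (simp add: k_def ennreal_mult_less_top)
    then obtain k' where k': "k = ennreal k'" by (cases k) auto
    have one: "1 \<le> ennreal k' * (\<omega> n * Z I A f a n)" if n: "n \<ge> M + 1" for n
    proof -
      have n': "n - M \<ge> 1" "n - M + M = n" using n by auto
      have "1 \<le> distortion * (\<omega> (n - M) * word_total (n - M))"
        by (rule T_ge[OF n'(1)])
      also have "\<dots> \<le> distortion * (\<omega> (n - M) * (K1 * loop_total a n))"
        using TL[OF n'(1)] n'(2) by (intro mult_left_mono) auto
      also have "\<omega> (n - M) = ennreal (exp (real M * p)) * \<omega> n"
        using \<omega>_cancel[of M "\<omega> (n - M)"] \<omega>_add[of "n - M" M] n'(2) by (simp add: ac_simps)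
      also have "distortion * (ennreal (exp (real M * p)) * \<omega> n * (K1 * loop_total a n)) \<le>
          distortion * (ennreal (exp (real M * p)) * \<omega> n * (K1 * (distortion * Z I A f a n)))"
        using Z_loop_sum(2)[of n a] n by (intro mult_left_mono) (auto simp: loop_total_eq_loop_sum)
      finally show ?thesis
        by (simp add: k'[symmetric] k_def ac_simps)
    qed
    then have "0 < k'" "\<forall>n\<ge>M + 1. ennreal (1 / k') \<le> \<omega> n * Z I A f a n"
      using one_le_mult_ennreal[OF one] by auto
    then show ?thesis by (intro exI[of _ "ennreal (1 / k')"]) simp
  qed
  have \<omega>_eq: "ennreal (exp (- real n * real_of_ereal (gurevich_pressure I A f))) = \<omega> n" for n
    by (simp add: p \<omega>_def)
  have rec: "recurrent I A f"
    unfolding recurrent_def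
  proof (intro conjI bexI[OF _ a])
    obtain c where c: "c > 0" "\<And>n. n \<ge> M + 1 \<Longrightarrow> c \<le> \<omega> n * Z I A f a n"
      using Z_ge by blast
    have "(\<Sum>\<^sub>\<infinity>n\<in>{M + 1..}. \<omega> n * Z I A f a n) = \<infinity>"
      using c infinite_Ici by (intro infsum_superconst_infinite_ennreal[where b = c]) auto
    moreover have "(\<Sum>\<^sub>\<infinity>n\<in>{M + 1..}. \<omega> n * Z I A f a n) \<le> (\<Sum>\<^sub>\<infinity>n\<in>{1..}. \<omega> n * Z I A f a n)"
      by (intro infsum_ennreal_mono) auto
    ultimately show "(\<Sum>\<^sub>\<infinity>n\<in>{1..}. ennreal (exp (- real n * real_of_ereal (gurevich_pressure I A f))) * Z I A f a n) = \<infinity>"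
      unfolding \<omega>_eq by (simp add: top_unique)
  qed (rule P)

  \<comment> \<open>there are \<open>N - 1\<close> places to insert \<open>a\<close>, but all words of one length together have bounded normalised weight\<close>
  obtain K3 l where K3: "K3 < \<infinity>"
    and ins: "\<And>N. of_nat (N - 1) * avoiding_total a ((l + 1) * N) \<le> K3 * word_total ((l + 1) * N + (2 * l + 1))"
    by (rule avoiding_total_insertion[OF fp a]) (erule that)
  define B where "B = K3 * K2 * ennreal (exp (real (2 * l + 1) * p))"
  have B: "B < \<infinity>"
    using K2 K3 by (simp add: B_def ennreal_mult_less_top)
  have X_small: "of_nat (N - 1) * (\<omega> ((l + 1) * N) * avoiding_total a ((l + 1) * N)) \<le> B" for N
  proof -
    let ?m = "(l + 1) * N"
    have "of_nat (N - 1) * (\<omega> ?m * avoiding_total a ?m) = \<omega> ?m * (of_nat (N - 1) * avoiding_total a ?m)"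
      by (simp add: ac_simps)
    also have "\<dots> \<le> \<omega> ?m * (K3 * word_total (?m + (2 * l + 1)))"
      by (intro mult_left_mono ins) auto
    also have "\<dots> \<le> \<omega> ?m * (K3 * (K2 * ennreal (exp (real (?m + (2 * l + 1)) * p))))"
      by (intro mult_left_mono T_le) auto
    also have "ennreal (exp (real (?m + (2 * l + 1)) * p)) =
        ennreal (exp (real (2 * l + 1) * p)) * ennreal (exp (real ?m * p))"
      unfolding of_nat_add distrib_right by (simp add: ennreal_mult[symmetric] exp_add[symmetric] add.commute)
    also have "\<omega> ?m * (K3 * (K2 * (ennreal (exp (real (2 * l + 1) * p)) * ennreal (exp (real ?m * p))))) =
        B * (\<omega> ?m * ennreal (exp (real ?m * p)))"
      unfolding B_def by (simp only: ac_simps)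
    also have "\<dots> = B"
      unfolding \<omega>_exp by simp
    finally show ?thesis .
  qed
  obtain m where m: "m \<ge> 1" "distortion * (\<omega> m * avoiding_total a m) < 1"
  proof -
    obtain d where d: "distortion = ennreal d" "1 \<le> d" by (rule distortion_eq_real)
    obtain b where b: "B = ennreal b" "0 \<le> b" using B by (cases B) auto
    obtain N :: nat where N: "d * b < real N" using reals_Archimedean2 by blast
    have Npos: "0 < real N" using N b d by (smt (verit) mult_nonneg_nonneg)
    let ?m = "(l + 1) * (N + 1)"
    obtain x where x: "\<omega> ?m * avoiding_total a ?m = ennreal x" "0 \<le> x"
      using X_fin[of ?m] \<omega>_fin[of ?m] by (cases "\<omega> ?m * avoiding_total a ?m") (auto simp: ennreal_mult_eq_top_iff)
    have "ennreal (real N * x) \<le> ennreal b"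
      using X_small[of "N + 1"] x b by (simp add: ennreal_of_nat_eq_real_of_nat ennreal_mult[symmetric])
    then have "real N * x \<le> b"
      using b by simp
    then have "d * (real N * x) \<le> d * b" using d by (intro mult_left_mono) auto
    then have "real N * (d * x) < real N * 1" using N by (simp add: ac_simps)
    then have "d * x < 1" using Npos by simp
    then have "distortion * (\<omega> ?m * avoiding_total a ?m) < 1"
      using d x by (simp add: ennreal_mult[symmetric] ennreal_less_one_iff)
    then show thesis by (intro that[of ?m]) auto
  qed
  obtain r K where r: "0 < r" "r < 1" "0 < K" and dec: "\<And>n. \<omega> n * avoiding_total a n \<le> ennreal (K * r ^ n)"
  proof (rule submultiplicative_geometric_decay[of "\<lambda>n. \<omega> n * avoiding_total a n", OF _ _ m])
    show "\<omega> (n + m) * avoiding_total a (n + m) \<le> distortion * (\<omega> n * avoiding_total a n * (\<omega> m * avoiding_total a m))" for n m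
      by (rule submult[OF avoiding_total_mult[OF irr ne]])
    show "\<omega> n * avoiding_total a n < \<infinity>" for n
      using X_fin \<omega>_fin by (simp add: ennreal_mult_less_top)
  qed (erule that)

  have star: "Z_star I A f a (Suc n) \<le> distortion ^ 2 * W [a] * avoiding_total a n" for n
  proof -
    let ?Q = "\<lambda>u. \<forall>k\<in>{1..<length u}. u ! k \<noteq> a"
    have "loop_sum a ?Q (Suc n) = Wsum {u\<in>loops I A a. length u = Suc n \<and> ?Q u}"
      by (simp add: loop_sum_def Wsum_def)
    also have "\<dots> \<le> distortion * (Wsum {[a]} * Wsum {u\<in>words I A n. a \<notin> set u})"
    proof (rule Wsum_append_le)
      fix z assume z: "z \<in> {u\<in>loops I A a. length u = Suc n \<and> ?Q u}"
      then obtain v where v: "z = a # v" "length v = n"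
        by (cases z) (auto simp: loops_def word_path_def)
      have "successively A ([a] @ v @ [a])" "set v \<subseteq> I"
        using z v by (auto simp: loops_def word_path_def)
      then have "v \<in> words I A n"
        using v by (auto simp: words_def successively_append_iff successively_Cons)
      moreover have "a \<notin> set v"
      proof
        assume "a \<in> set v"
        then obtain k where "k < length v" "v ! k = a" by (auto simp: in_set_conv_nth)
        then have "Suc k \<in> {1..<length z}" "z ! Suc k = a" using v by auto
        then show False using z by blast
      qed
      ultimately show "\<exists>u\<in>{[a]}. \<exists>v\<in>{u\<in>words I A n. a \<notin> set u}. z = u @ v"
        using v by auto
    next
      show "{u\<in>loops I A a. length u = Suc n \<and> ?Q u} \<subseteq> language"
        using loops_language[OF a irr] by blast
    qed
    finally have "distortion * loop_sum a ?Q (Suc n) \<le> distortion * (distortion * (W [a] * avoiding_total a n))"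
      by (intro mult_left_mono) (simp_all add: avoiding_total_def Wsum_def)
    moreover have "Z_star I A f a (Suc n) \<le> distortion * loop_sum a ?Q (Suc n)"
      by (rule Z_star_loop_sum) simp
    ultimately show ?thesis
      by (simp add: power2_eq_square ac_simps)
  qed
  define K4 where "K4 = distortion ^ 2 * W [a] * \<omega> 1"
  have K4: "K4 < \<infinity>"
    using distortion_fin W_fin[of "[a]"] \<omega>_fin[of 1] by (simp add: K4_def ennreal_mult_less_top power_less_top_ennreal)
  have "(\<Sum>\<^sub>\<infinity>n\<in>{1..}. ennreal (real n * exp (- real n * real_of_ereal (gurevich_pressure I A f)))
          * Z_star I A f a n) \<le> (\<Sum>\<^sub>\<infinity>n\<in>UNIV. K4 * ennreal (K * (real (Suc n) * r ^ n)))"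
  proof (rule infsum_ennreal_inj_le[where h = "\<lambda>n. n - 1"])
    show "inj_on (\<lambda>n. n - 1) {1::nat..}"
      by (auto simp: inj_on_def)
    fix n :: nat assume "n \<in> {1..}"
    then obtain j where j: "n = Suc j" by (cases n) auto
    have "ennreal (real n * exp (- real n * real_of_ereal (gurevich_pressure I A f))) * Z_star I A f a n =
        ennreal (real n) * (\<omega> n * Z_star I A f a n)"
      by (simp add: \<omega>_eq[symmetric] ennreal_mult ac_simps)
    also have "\<dots> \<le> ennreal (real n) * (\<omega> n * (distortion ^ 2 * W [a] * avoiding_total a j))"
      unfolding j by (intro mult_left_mono star) auto
    also have "\<dots> = ennreal (real n) * (K4 * (\<omega> j * avoiding_total a j))"
      using \<omega>_add[of 1 j] by (simp add: j K4_def ac_simps)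
    also have "\<dots> \<le> ennreal (real n) * (K4 * ennreal (K * r ^ j))"
      by (intro mult_left_mono dec) auto
    also have "\<dots> = K4 * ennreal (K * (real (Suc (n - 1)) * r ^ (n - 1)))"
    proof -
      have "ennreal (real n) * ennreal (K * r ^ j) = ennreal (real n * (K * r ^ j))"
        using r by (intro ennreal_mult[symmetric]) auto
      also have "real n * (K * r ^ j) = K * (real (Suc (n - 1)) * r ^ (n - 1))"
        by (simp add: j)
      finally show ?thesis
        by (metis mult.left_commute)
    qed
    finally show "ennreal (real n * exp (- real n * real_of_ereal (gurevich_pressure I A f))) * Z_star I A f a n \<le>
        K4 * ennreal (K * (real (Suc (n - 1)) * r ^ (n - 1)))" .
  qed simp
  also have "\<dots> < \<infinity>"
  proof -
    have "summable (\<lambda>n. real (Suc n) * r ^ n)"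
      using geometric_deriv_sums[of r] r by (auto simp: sums_iff)
    then have "(\<Sum>\<^sub>\<infinity>n\<in>UNIV. ennreal (K * (real (Suc n) * r ^ n))) < \<infinity>"
      using r by (intro infsum_ennreal_summable summable_mult) auto
    then show ?thesis
      using K4 by (simp add: infsum_ennreal_cmult ennreal_mult_less_top)
  qed
  finally show ?thesis
    unfolding positive_recurrent_def using rec a by blast
qed

end


section \<open>Group extensions\<close>

text \<open>The homomorphism is given on non-empty words; the empty loop gets the unit as its value.\<close>

definition word_value :: "('g, 'b) monoid_scheme \<Rightarrow> ('a list \<Rightarrow> 'g) \<Rightarrow> 'a list \<Rightarrow> 'g" where
  "word_value G \<Psi> u = (if u = [] then \<one>\<^bsub>G\<^esub> else \<Psi> u)"

text \<open>The word of the extension that lies above a word of the base and starts at \<open>g\<close>.\<close>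

fun lift :: "('g, 'b) monoid_scheme \<Rightarrow> ('a list \<Rightarrow> 'g) \<Rightarrow> 'g \<Rightarrow> 'a list \<Rightarrow> ('a \<times> 'g) list" where
  "lift G \<Psi> g [] = []"
| "lift G \<Psi> g (i # u) = (i, g) # lift G \<Psi> (g \<otimes>\<^bsub>G\<^esub> \<Psi> [i]) u"

lemma map_fst_lift: "map fst (lift G \<Psi> g u) = u"
  by (induction u arbitrary: g) auto

lemma length_lift: "length (lift G \<Psi> g u) = length u"
  using arg_cong[OF map_fst_lift[of G \<Psi> g u], of length] by simp

lemma inj_lift: "inj_on (lift G \<Psi> g) S"
  by (rule inj_on_inverseI[of _ "map fst"]) (rule map_fst_lift)

lemma lift_eq_Nil: "lift G \<Psi> g u = [] \<longleftrightarrow> u = []"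
  by (cases u) auto

lemma hd_lift: "u \<noteq> [] \<Longrightarrow> hd (lift G \<Psi> g u) = (hd u, g)"
  by (cases u) auto

lemma hoelder_continuous_proj1:
  assumes "hoelder_continuous I A \<phi>"
  shows "hoelder_continuous (I \<times> carrier G) (extension_matrix A G \<Psi>) (\<phi> \<circ> proj1)"
proof -
  obtain \<alpha> V where \<alpha>: "\<alpha> > 0" and V: "\<And>x y. x \<in> shift_space I A \<Longrightarrow> y \<in> shift_space I A \<Longrightarrow>
      x 0 = y 0 \<Longrightarrow> x \<noteq> y \<Longrightarrow> \<bar>\<phi> x - \<phi> y\<bar> \<le> V * exp (- \<alpha> * real (common_length x y))"
    using assms unfolding hoelder_continuous_def by blast
  show ?thesis
    unfolding hoelder_continuous_def
  proof (rule exI[of _ \<alpha>], rule conjI[OF \<alpha>], rule exI[of _ "\<bar>V\<bar>"], intro ballI impI)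
    fix x y
    assume x: "x \<in> shift_space (I \<times> carrier G) (extension_matrix A G \<Psi>)"
      and y: "y \<in> shift_space (I \<times> carrier G) (extension_matrix A G \<Psi>)"
      and xy: "x 0 = y 0 \<and> x \<noteq> y"
    show "\<bar>(\<phi> \<circ> proj1) x - (\<phi> \<circ> proj1) y\<bar> \<le> \<bar>V\<bar> * exp (- \<alpha> * real (common_length x y))"
    proof (cases "proj1 x = proj1 y")
      case False
      then obtain k where k: "proj1 x k \<noteq> proj1 y k" by auto
      have "common_length x y \<le> common_length (proj1 x) (proj1 y)"
        unfolding common_length_def
      proof (rule Least_le)
        have "proj1 x (LEAST k. proj1 x k \<noteq> proj1 y k) \<noteq> proj1 y (LEAST k. proj1 x k \<noteq> proj1 y k)"
          using k by (rule LeastI)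
        then show "x (LEAST k. proj1 x k \<noteq> proj1 y k) \<noteq> y (LEAST k. proj1 x k \<noteq> proj1 y k)"
          by (auto simp: proj1_def)
      qed
      then have e: "exp (- \<alpha> * real (common_length (proj1 x) (proj1 y))) \<le> exp (- \<alpha> * real (common_length x y))"
        using \<alpha> by simp
      have "\<bar>\<phi> (proj1 x) - \<phi> (proj1 y)\<bar> \<le> V * exp (- \<alpha> * real (common_length (proj1 x) (proj1 y)))"
        using x y xy False by (intro V) (auto simp: shift_space_extension proj1_def)
      also have "\<dots> \<le> \<bar>V\<bar> * exp (- \<alpha> * real (common_length (proj1 x) (proj1 y)))"
        by (intro mult_right_mono) auto
      also have "\<dots> \<le> \<bar>V\<bar> * exp (- \<alpha> * real (common_length x y))"
        using e by (intro mult_left_mono) auto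
      finally show ?thesis by simp
    qed simp
  qed
qed

lemma proj1_funpow: "proj1 ((left_shift ^^ k) x) = (left_shift ^^ k) (proj1 x)"
  by (auto simp: left_shift_funpow proj1_def)

lemma birkhoff_sum_proj1: "birkhoff_sum n (\<phi> \<circ> proj1) x = birkhoff_sum n \<phi> (proj1 x)"
  by (simp add: birkhoff_sum_def proj1_funpow)

locale group_extension = group G for G :: "('g, 'b) monoid_scheme" (structure) +
  fixes I :: "'a set" and A :: "'a \<Rightarrow> 'a \<Rightarrow> bool" and \<Psi> :: "'a list \<Rightarrow> 'g" and \<phi> :: "(nat \<Rightarrow> 'a) \<Rightarrow> real"
  assumes hom: "\<Psi> \<in> semigroup_hom I G" and hoelder_base: "hoelder_continuous I A \<phi>"
begin

abbreviation J :: "('a \<times> 'g) set" where "J \<equiv> I \<times> carrier G"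
abbreviation B :: "'a \<times> 'g \<Rightarrow> 'a \<times> 'g \<Rightarrow> bool" where "B \<equiv> extension_matrix A G \<Psi>"
abbreviation val :: "'a list \<Rightarrow> 'g" where "val \<equiv> word_value G \<Psi>"

sublocale base: markov_potential I A \<phi>
  by unfold_locales (rule hoelder_base)

sublocale ext: markov_potential J B "\<phi> \<circ> proj1"
  by unfold_locales (rule hoelder_continuous_proj1[OF hoelder_base])

lemma letter_closed: "i \<in> I \<Longrightarrow> \<Psi> [i] \<in> carrier G"
  using hom by (auto simp: semigroup_hom_def)

lemma value_closed: "set u \<subseteq> I \<Longrightarrow> val u \<in> carrier G"
  using hom by (auto simp: semigroup_hom_def word_value_def lists_eq_set)

lemma value_append:
  assumes "set u \<subseteq> I" "set v \<subseteq> I"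
  shows "val (u @ v) = val u \<otimes> val v"
proof (cases "u = [] \<or> v = []")
  case False
  then have "u \<in> lists I - {[]}" "v \<in> lists I - {[]}"
    using assms by (auto simp: lists_eq_set)
  then have "\<Psi> (u @ v) = \<Psi> u \<otimes> \<Psi> v"
    using hom unfolding semigroup_hom_def by blast
  then show ?thesis using False by (simp add: word_value_def)
next
  case True
  then show ?thesis
    using value_closed[OF assms(1)] value_closed[OF assms(2)] by (auto simp: word_value_def)
qed

lemma value_Cons: "i \<in> I \<Longrightarrow> set u \<subseteq> I \<Longrightarrow> val (i # u) = \<Psi> [i] \<otimes> val u"
  using value_append[of "[i]" u] by (simp add: word_value_def)

lemma successively_lift:
  assumes "set u \<subseteq> I" "g \<in> carrier G"
  shows "set (lift G \<Psi> g u) \<subseteq> J \<and>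
    successively B (lift G \<Psi> g u @ [(j, h)]) = (successively A (u @ [j]) \<and> (u = [] \<or> h = g \<otimes> val u))"
  using assms
proof (induction u arbitrary: g)
  case (Cons i u)
  have i: "i \<in> I" "\<Psi> [i] \<in> carrier G" "set u \<subseteq> I"
    using Cons.prems letter_closed by auto
  have IH: "set (lift G \<Psi> (g \<otimes> \<Psi> [i]) u) \<subseteq> J \<and>
    successively B (lift G \<Psi> (g \<otimes> \<Psi> [i]) u @ [(j, h)]) =
      (successively A (u @ [j]) \<and> (u = [] \<or> h = (g \<otimes> \<Psi> [i]) \<otimes> val u))"
    using Cons.prems i by (intro Cons.IH) auto
  have v: "val (i # u) = \<Psi> [i] \<otimes> val u" "val u \<in> carrier G"
    using value_Cons[OF i(1,3)] value_closed[OF i(3)] by auto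
  show ?case
  proof (cases u)
    case Nil
    then show ?thesis
      using Cons.prems i v by (auto simp: extension_matrix_def word_value_def)
  next
    case (Cons k u')
    have B: "B (i, g) (k, g \<otimes> \<Psi> [i]) = A i k"
      by (simp add: extension_matrix_def)
    have s: "successively B (lift G \<Psi> g (i # u) @ [(j, h)]) \<longleftrightarrow>
        A i k \<and> successively B (lift G \<Psi> (g \<otimes> \<Psi> [i]) u @ [(j, h)])"
      using Cons by (simp add: successively_Cons B)
    show ?thesis
      unfolding s v(1) using IH Cons Cons.prems i v(2) 
      by (auto simp: successively_Cons m_assoc)
  qed
qed simp

text \<open>Projection to the base identifies the paths of the extension from \<open>(i, g)\<close> to \<open>(j, h)\<close> with the
  paths of the base from \<open>i\<close> to \<open>j\<close> whose value is \<open>inv g \<otimes> h\<close>.\<close>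

lemma word_path_lift:
  assumes "i \<in> I" "g \<in> carrier G"
  shows "word_path J B (i, g) w (j, h) \<longleftrightarrow> (\<exists>u. w = lift G \<Psi> g u \<and> word_path I A i u j \<and> h = g \<otimes> val u)"
proof
  assume w: "word_path J B (i, g) w (j, h)"
  have lift_eq: "set w \<subseteq> J \<Longrightarrow> successively B (w @ [(j, h)]) \<Longrightarrow> w \<noteq> [] \<Longrightarrow> snd (hd w) = g \<Longrightarrow> w = lift G \<Psi> g (map fst w)" for w g
  proof (induction w arbitrary: g)
    case (Cons x w)
    obtain k where x: "x = (k, g)" using Cons.prems by (cases x) auto
    show ?case
    proof (cases w)
      case Nil
      then show ?thesis using x by simp
    next
      case (Cons y w')
      then have "B x y" "successively B (w @ [(j, h)])"
        using Cons.prems(2) by (auto simp: successively_Cons)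
      then have "snd y = g \<otimes> \<Psi> [k]"
        unfolding x by (cases y) (auto simp: extension_matrix_def)
      then have "w = lift G \<Psi> (g \<otimes> \<Psi> [k]) (map fst w)"
        using Cons.prems Cons \<open>successively B (w @ [(j, h)])\<close> by (intro Cons.IH) auto
      then show ?thesis using x by simp
    qed
  qed simp
  have p: "w \<noteq> []" "hd w = (i, g)" "set w \<subseteq> J" "successively B (w @ [(j, h)])"
    using w by (auto simp: word_path_def)
  define u where "u = map fst w"
  have wu: "w = lift G \<Psi> g u"
    unfolding u_def using p by (intro lift_eq) auto
  have u: "set u \<subseteq> I" "u \<noteq> []" "hd u = i"
    using p unfolding u_def by (auto simp: hd_map)
  have "successively A (u @ [j]) \<and> h = g \<otimes> val u"
    using successively_lift[OF u(1) assms(2), of j h] p u wu by simp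
  then show "\<exists>u. w = lift G \<Psi> g u \<and> word_path I A i u j \<and> h = g \<otimes> val u"
    using wu u by (auto simp: word_path_def)
next
  assume "\<exists>u. w = lift G \<Psi> g u \<and> word_path I A i u j \<and> h = g \<otimes> val u"
  then obtain u where u: "w = lift G \<Psi> g u" "word_path I A i u j" "h = g \<otimes> val u" by blast
  then have "u \<noteq> []" "hd u = i" "set u \<subseteq> I" "successively A (u @ [j])"
    by (auto simp: word_path_def)
  then show "word_path J B (i, g) w (j, h)"
    using successively_lift[of u g j h] u assms by (auto simp: word_path_def lift_eq_Nil hd_lift)
qed

lemma loops_subset: "u \<in> loops I A i \<Longrightarrow> set u \<subseteq> I"
  by (auto simp: loops_def word_path_def)

lemma loops_lift:
  assumes i: "i \<in> I" and g: "g \<in> carrier G"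
  shows "loops J B (i, g) = lift G \<Psi> g ` {u\<in>loops I A i. val u = \<one>}"
proof -
  have e: "g = g \<otimes> val u \<longleftrightarrow> val u = \<one>" if "word_path I A i u i" for u
    using g value_closed[of u] that by (simp add: word_path_def)
  have "w \<in> loops J B (i, g) \<longleftrightarrow> w \<in> lift G \<Psi> g ` {u\<in>loops I A i. val u = \<one>}" for w
  proof -
    have "w \<in> loops J B (i, g) \<longleftrightarrow> w = [] \<or> (\<exists>u. w = lift G \<Psi> g u \<and> word_path I A i u i \<and> val u = \<one>)"
      using e by (auto simp: loops_def word_path_lift[OF i g])
    also have "\<dots> \<longleftrightarrow> (\<exists>u. w = lift G \<Psi> g u \<and> u \<in> loops I A i \<and> val u = \<one>)"
      by (auto simp: loops_def word_value_def)
    finally show ?thesis by blast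
  qed
  then show ?thesis by blast
qed

text \<open>A point of the extension that begins with the lift of \<open>u\<close> projects to a point of the base that begins
  with \<open>u\<close>, and the Birkhoff sums along both points coincide.\<close>

lemma W_lift:
  assumes "lift G \<Psi> g u \<in> ext.language"
  shows "ext.W (lift G \<Psi> g u) \<le> base.distortion * base.W u"
    and "base.W u \<le> base.distortion * ext.W (lift G \<Psi> g u)"
proof -
  let ?x = "ext.extension (lift G \<Psi> g u)"
  have x: "?x \<in> shift_space J B" "begins_with ?x (lift G \<Psi> g u)"
    using ext.extension[OF assms] by auto
  have px: "proj1 ?x \<in> shift_space I A"
    using x(1) by (simp add: shift_space_extension)
  have bx: "begins_with (proj1 ?x) u"
    unfolding begins_with_def
  proof (intro allI impI)
    fix k assume k: "k < length u"
    then have "?x k = lift G \<Psi> g u ! k"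
      using x(2) by (simp add: begins_with_def length_lift)
    then have "proj1 ?x k = map fst (lift G \<Psi> g u) ! k"
      using k by (simp add: proj1_def length_lift)
    then show "proj1 ?x k = u ! k" by (simp add: map_fst_lift)
  qed
  have "ext.W (lift G \<Psi> g u) = ennreal (exp (birkhoff_sum (length u) \<phi> (proj1 ?x)))"
    by (simp add: ext.W_def birkhoff_sum_proj1 length_lift)
  then show "ext.W (lift G \<Psi> g u) \<le> base.distortion * base.W u"
    "base.W u \<le> base.distortion * ext.W (lift G \<Psi> g u)"
    using base.exp_le_W[OF px bx] base.W_le_exp[OF px bx] by simp_all
qed

lemma loop_sum_lift:
  assumes irr: "irreducible J B" and i: "i \<in> I" and g: "g \<in> carrier G"
  shows "ext.loop_sum (i, g) Q n \<le>
      base.distortion * base.Wsum {u\<in>loops I A i. val u = \<one> \<and> length u = n \<and> Q (lift G \<Psi> g u)}"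
    and "base.Wsum {u\<in>loops I A i. val u = \<one> \<and> length u = n \<and> Q (lift G \<Psi> g u)} \<le>
      base.distortion * ext.loop_sum (i, g) Q n"
proof -
  let ?S = "{u\<in>loops I A i. val u = \<one> \<and> length u = n \<and> Q (lift G \<Psi> g u)}"
  have im: "{w\<in>loops J B (i, g). length w = n \<and> Q w} = lift G \<Psi> g ` ?S"
    unfolding loops_lift[OF i g] by (auto simp: length_lift)
  have eq: "ext.loop_sum (i, g) Q n = (\<Sum>\<^sub>\<infinity>u\<in>?S. ext.W (lift G \<Psi> g u))"
    unfolding ext.loop_sum_def im infsum_reindex[OF inj_lift] by (simp add: comp_def)
  have lang: "lift G \<Psi> g u \<in> ext.language" if "u \<in> ?S" for u
    using that i g by (intro ext.loops_language[OF _ irr, of "(i, g)"]) (auto simp: loops_lift)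
  show "ext.loop_sum (i, g) Q n \<le> base.distortion * base.Wsum ?S"
    unfolding eq base.Wsum_def infsum_ennreal_cmult[symmetric]
    by (intro infsum_ennreal_mono W_lift(1) lang) auto
  show "base.Wsum ?S \<le> base.distortion * ext.loop_sum (i, g) Q n"
    unfolding eq base.Wsum_def infsum_ennreal_cmult[symmetric]
    by (intro infsum_ennreal_mono W_lift(2) lang) auto
qed

end


section \<open>Recurrence of group extensions\<close>

context markov_potential
begin

lemma Wsum_by_length:
  "(\<Sum>\<^sub>\<infinity>u\<in>S. W u * c (length u)) = (\<Sum>\<^sub>\<infinity>n\<in>UNIV. c n * Wsum {u\<in>S. length u = n})"
proof -
  have "(\<Sum>\<^sub>\<infinity>u\<in>S. W u * c (length u)) = (\<Sum>\<^sub>\<infinity>n\<in>UNIV. \<Sum>\<^sub>\<infinity>u\<in>{u\<in>S. length u = n}. W u * c (length u))"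
    by (rule infsum_ennreal_partition) simp
  also have "\<dots> = (\<Sum>\<^sub>\<infinity>n\<in>UNIV. c n * Wsum {u\<in>S. length u = n})"
  proof (rule infsum_cong)
    fix n
    have "(\<Sum>\<^sub>\<infinity>u\<in>{u\<in>S. length u = n}. W u * c (length u)) = (\<Sum>\<^sub>\<infinity>u\<in>{u\<in>S. length u = n}. c n * W u)"
      by (rule infsum_cong) (simp add: mult.commute)
    then show "(\<Sum>\<^sub>\<infinity>u\<in>{u\<in>S. length u = n}. W u * c (length u)) = c n * Wsum {u\<in>S. length u = n}"
      by (simp only: infsum_ennreal_cmult Wsum_def)
  qed
  finally show ?thesis .
qed

lemma recurrent_loop_total:
  assumes irr: "irreducible I A" and a: "a \<in> I" and rec: "recurrent I A f"
    and p: "gurevich_pressure I A f = ereal p"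
  shows "(\<Sum>\<^sub>\<infinity>n\<in>UNIV. ennreal (exp (- (real n * p))) * loop_total a n) = \<infinity>"
proof (rule ccontr)
  let ?\<omega> = "\<lambda>n. ennreal (exp (- (real n * p)))"
  assume *: "\<not> ?thesis"
  obtain b where b: "b \<in> I" "(\<Sum>\<^sub>\<infinity>n\<in>{1..}. ?\<omega> n * Z I A f b n) = \<infinity>"
    using rec by (auto simp: recurrent_def p)
  obtain K m where K: "K < \<infinity>" "\<And>n. loop_total b n \<le> K * loop_total a (n + m)"
    by (rule loop_total_compare[OF irr b(1) a]) (erule that)
  have "(\<Sum>\<^sub>\<infinity>n\<in>{1..}. ?\<omega> n * Z I A f b n) \<le>
      (\<Sum>\<^sub>\<infinity>n\<in>UNIV. (distortion * K * ennreal (exp (real m * p))) * (?\<omega> n * loop_total a n))"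
  proof (rule infsum_ennreal_inj_le[where h = "\<lambda>n. n + m"])
    fix n :: nat assume n: "n \<in> {1..}"
    have "?\<omega> n * Z I A f b n \<le> ?\<omega> n * (distortion * loop_total b n)"
      using Z_loop_sum(1)[of n b] n by (intro mult_left_mono) (auto simp: loop_total_eq_loop_sum)
    also have "\<dots> \<le> ?\<omega> n * (distortion * (K * loop_total a (n + m)))"
      by (intro mult_left_mono K) auto
    also have "\<dots> = (distortion * K * ennreal (exp (real m * p))) * (?\<omega> (n + m) * loop_total a (n + m))"
    proof -
      have \<omega>: "?\<omega> n = ennreal (exp (real m * p)) * ?\<omega> (n + m)"
        by (simp add: ennreal_mult[symmetric] exp_add[symmetric] algebra_simps)
      show ?thesis
        unfolding \<omega> by (simp only: ac_simps)
    qed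
    finally show "?\<omega> n * Z I A f b n \<le>
        (distortion * K * ennreal (exp (real m * p))) * (?\<omega> (n + m) * loop_total a (n + m))" .
  qed (auto simp: inj_on_def)
  also have "\<dots> = (distortion * K * ennreal (exp (real m * p))) * (\<Sum>\<^sub>\<infinity>n\<in>UNIV. ?\<omega> n * loop_total a n)"
    by (rule infsum_ennreal_cmult)
  also have "\<dots> < \<infinity>"
    using * K distortion_fin by (simp add: ennreal_mult_less_top less_top)
  finally show False using b by simp
qed

end

context group_extension
begin

definition normalised_weight :: "real \<Rightarrow> 'a list \<Rightarrow> ennreal" where
  "normalised_weight p u = base.W u * ennreal (exp (- (real (length u) * p)))"

text \<open>Irreducibility of the extension makes the value map surjective on the loops at \<open>i\<close>. The loops with
  value \<open>\<one>\<close> lift to the loops of the extension at \<open>(i, \<one>)\<close>, whose growth rate is the pressure of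
  the extension.\<close>

lemma loop_monoid:
  assumes irr_base: "irreducible I A" and irr: "irreducible J B" and i: "i \<in> I"
    and P: "gurevich_pressure J B (\<phi> \<circ> proj1) \<le> ereal p"
  shows "weighted_word_monoid G (loops I A i) (normalised_weight p) val base.distortion"
proof (unfold_locales)
  let ?\<omega> = "\<lambda>n. ennreal (exp (- (real n * p)))"
  have \<omega>_add: "?\<omega> (n + m) = ?\<omega> n * ?\<omega> m" for n m
    by (simp add: ennreal_mult[symmetric] exp_add[symmetric] algebra_simps)
  show "[] \<in> loops I A i"
    by (simp add: loops_def)
  show "u @ v \<in> loops I A i" if "u \<in> loops I A i" "v \<in> loops I A i" for u v
    using that by (rule loops_append)
  show "u \<in> loops I A i" if "u @ v \<in> loops I A i" "v \<in> loops I A i" for u v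
    using that by (rule loops_cancel)
  show "normalised_weight p [] = 1"
    by (simp add: normalised_weight_def base.W_nil)
  show "0 < normalised_weight p u" for u
    using base.W_pos[of u] by (simp add: normalised_weight_def ennreal_zero_less_mult_iff)
  show "normalised_weight p u < \<infinity>" for u
    using base.W_fin[of u] by (simp add: normalised_weight_def ennreal_mult_less_top)
  show "base.distortion < \<infinity>"
    by (rule base.distortion_fin)
  have lang: "u @ v \<in> base.language" if "u \<in> loops I A i" "v \<in> loops I A i" for u v
    by (rule base.loops_language[OF i irr_base loops_append[OF that]])
  show "normalised_weight p (u @ v) \<le> base.distortion * (normalised_weight p u * normalised_weight p v)"
    if "u \<in> loops I A i" "v \<in> loops I A i" for u v
    using mult_right_mono[OF base.W_append_le[OF lang[OF that]], of "?\<omega> (length u + length v)"]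
    unfolding normalised_weight_def length_append \<omega>_add by (simp add: ac_simps)
  show "normalised_weight p u * normalised_weight p v \<le> base.distortion * normalised_weight p (u @ v)"
    if "u \<in> loops I A i" "v \<in> loops I A i" for u v
    using mult_right_mono[OF base.W_append_ge[OF lang[OF that]], of "?\<omega> (length u + length v)"]
    unfolding normalised_weight_def length_append \<omega>_add by (simp add: ac_simps)
  show "val u \<in> carrier G" if "u \<in> loops I A i" for u
    by (rule value_closed[OF loops_subset[OF that]])
  show "val [] = \<one>"
    by (simp add: word_value_def)
  show "val (u @ v) = val u \<otimes> val v" if "u \<in> loops I A i" "v \<in> loops I A i" for u v
    by (rule value_append[OF loops_subset loops_subset]) (fact that)+
  show "\<exists>u\<in>loops I A i. val u = g" if g: "g \<in> carrier G" for g
  proof -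
    obtain w where "word_path J B (i, \<one>) w (i, g)"
      using irr i g unfolding irreducible_def by blast
    then obtain u where u: "word_path I A i u i" "g = \<one> \<otimes> val u"
      using word_path_lift[OF i one_closed] by blast
    have "u \<in> loops I A i" using u by (simp add: loops_def)
    then show ?thesis
      using u value_closed[OF loops_subset] by (intro bexI[of _ u]) auto
  qed
  show "(\<Sum>\<^sub>\<infinity>u\<in>{u\<in>loops I A i. val u = \<one>}. normalised_weight p u * s ^ length u) < \<infinity>" if s: "s < 1" for s
  proof -
    let ?S = "{u\<in>loops I A i. val u = \<one>}"
    have iJ: "(i, \<one>) \<in> J" using i by simp
    obtain K where K: "K < \<infinity>" "\<And>n. ext.loop_total (i, \<one>) n \<le> K * ennreal (exp (real n * p))"
      by (rule ext.loop_total_le_exp_pressure[OF irr iJ P]) (erule that)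
    have "(\<Sum>\<^sub>\<infinity>u\<in>?S. normalised_weight p u * s ^ length u) =
        (\<Sum>\<^sub>\<infinity>u\<in>?S. base.W u * (?\<omega> (length u) * s ^ length u))"
      by (simp add: normalised_weight_def ac_simps)
    also have "\<dots> = (\<Sum>\<^sub>\<infinity>n\<in>UNIV. (?\<omega> n * s ^ n) * base.Wsum {u\<in>?S. length u = n})"
      by (rule base.Wsum_by_length)
    also have "\<dots> \<le> (\<Sum>\<^sub>\<infinity>n\<in>UNIV. (base.distortion * K) * s ^ n)"
    proof (rule infsum_ennreal_mono[OF order_refl])
      fix n
      have "base.Wsum {u\<in>?S. length u = n} \<le> base.distortion * ext.loop_total (i, \<one>) n"
        using loop_sum_lift(2)[OF irr i one_closed, of n "\<lambda>_. True"]
        by (simp add: ext.loop_total_eq_loop_sum conj_assoc)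
      also have "\<dots> \<le> base.distortion * (K * ennreal (exp (real n * p)))"
        by (intro mult_left_mono K) auto
      finally have "(?\<omega> n * s ^ n) * base.Wsum {u\<in>?S. length u = n} \<le>
          (?\<omega> n * s ^ n) * (base.distortion * (K * ennreal (exp (real n * p))))"
        by (rule mult_left_mono) simp
      also have "\<dots> = (base.distortion * K) * s ^ n * (?\<omega> n * ennreal (exp (real n * p)))"
        by (simp only: ac_simps)
      also have "?\<omega> n * ennreal (exp (real n * p)) = 1"
        by (simp add: ennreal_mult[symmetric] exp_add[symmetric])
      finally show "(?\<omega> n * s ^ n) * base.Wsum {u\<in>?S. length u = n} \<le>
          (base.distortion * K) * s ^ n"
        by simp
    qed
    also have "\<dots> = (base.distortion * K) * (\<Sum>\<^sub>\<infinity>n\<in>UNIV. s ^ n)"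
      by (rule infsum_ennreal_cmult)
    also have "\<dots> < \<infinity>"
      using infsum_geometric_ennreal[OF s] K base.distortion_fin by (simp add: ennreal_mult_less_top)
    finally show ?thesis .
  qed
qed

lemma Green_infinite:
  assumes irr_base: "irreducible I A" and irr: "irreducible J B" and i: "i \<in> I"
    and rec: "recurrent J B (\<phi> \<circ> proj1)" and P: "gurevich_pressure J B (\<phi> \<circ> proj1) = ereal p"
  shows "(\<Sum>\<^sub>\<infinity>u\<in>{u\<in>loops I A i. val u = \<one>}. normalised_weight p u) = \<infinity>"
proof -
  let ?S = "{u\<in>loops I A i. val u = \<one>}"
  let ?\<omega> = "\<lambda>n. ennreal (exp (- (real n * p)))"
  have iJ: "(i, \<one>) \<in> J" using i by simp
  have "(\<Sum>\<^sub>\<infinity>n\<in>UNIV. ?\<omega> n * ext.loop_total (i, \<one>) n) \<le>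
      (\<Sum>\<^sub>\<infinity>n\<in>UNIV. base.distortion * (?\<omega> n * base.Wsum {u\<in>?S. length u = n}))"
  proof (rule infsum_ennreal_mono[OF order_refl])
    fix n
    have "ext.loop_total (i, \<one>) n \<le> base.distortion * base.Wsum {u\<in>?S. length u = n}"
      using loop_sum_lift(1)[OF irr i one_closed, of "\<lambda>_. True" n]
      by (simp add: ext.loop_total_eq_loop_sum conj_assoc)
    then have "?\<omega> n * ext.loop_total (i, \<one>) n \<le>
        ?\<omega> n * (base.distortion * base.Wsum {u\<in>?S. length u = n})"
      by (rule mult_left_mono) simp
    then show "?\<omega> n * ext.loop_total (i, \<one>) n \<le>
        base.distortion * (?\<omega> n * base.Wsum {u\<in>?S. length u = n})"
      by (simp only: ac_simps)
  qed
  also have "\<dots> = base.distortion * (\<Sum>\<^sub>\<infinity>u\<in>?S. normalised_weight p u)"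
    unfolding infsum_ennreal_cmult normalised_weight_def by (subst base.Wsum_by_length) (rule refl)
  finally have "\<infinity> \<le> base.distortion * (\<Sum>\<^sub>\<infinity>u\<in>?S. normalised_weight p u)"
    unfolding ext.recurrent_loop_total[OF irr iJ rec P] .
  then show ?thesis
    using base.distortion_fin by (auto simp: top_unique ennreal_mult_eq_top_iff)
qed

theorem recurrent_amenable:
  assumes "irreducible I A" "irreducible J B" "I \<noteq> {}" and rec: "recurrent J B (\<phi> \<circ> proj1)"
  shows "amenable G"
proof -
  obtain i where i: "i \<in> I" using assms(3) by auto
  have "J \<noteq> {}" using i one_closed by blast
  then obtain p where p: "gurevich_pressure J B (\<phi> \<circ> proj1) = ereal p"
    using ext.pressure_eq_real[OF assms(2)] rec unfolding recurrent_def by blast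
  interpret weighted_word_monoid G "loops I A i" "normalised_weight p" val base.distortion
    by (rule loop_monoid[OF assms(1,2) i]) (simp add: p)
  show ?thesis
    by (rule amenable_if_recurrent) (simp add: gsum_def fiber_def Green_infinite[OF assms(1,2) i rec p])
qed

lemma lift_nth:
  "k < length u \<Longrightarrow> set u \<subseteq> I \<Longrightarrow> g \<in> carrier G \<Longrightarrow> lift G \<Psi> g u ! k = (u ! k, g \<otimes> val (take k u))"
proof (induction u arbitrary: g k)
  case (Cons i u)
  show ?case
  proof (cases k)
    case 0
    then show ?thesis using Cons.prems by (simp add: word_value_def)
  next
    case (Suc j)
    have i: "i \<in> I" "\<Psi> [i] \<in> carrier G" "set (take j u) \<subseteq> I"
      using Cons.prems letter_closed set_take_subset[of j u] by auto
    have "lift G \<Psi> (g \<otimes> \<Psi> [i]) u ! j = (u ! j, (g \<otimes> \<Psi> [i]) \<otimes> val (take j u))"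
      using Cons.prems Suc i by (intro Cons.IH) auto
    then show ?thesis
      using Suc i Cons.prems value_Cons[OF i(1,3)] value_closed[OF i(3)] by (simp add: m_assoc)
  qed
qed simp

text \<open>The first returns of the extension to \<open>(i, g)\<close> are the lifts of the prime loops at \<open>i\<close>: a lift visits
  \<open>(i, g)\<close> in between exactly where the loop has a proper suffix that is a loop with value \<open>\<one>\<close>. So the
  sum in the definition of positive recurrence dominates the weighted length of the primes.\<close>

theorem positive_recurrent_finite:
  assumes "irreducible I A" "irreducible J B" and pos: "positive_recurrent J B (\<phi> \<circ> proj1)"
  shows "finite (carrier G)"
proof -
  have rec: "recurrent J B (\<phi> \<circ> proj1)"
    using pos by (simp add: positive_recurrent_def)
  obtain i g where ig: "i \<in> I" "g \<in> carrier G"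
    and star: "(\<Sum>\<^sub>\<infinity>n\<in>{1..}. ennreal (real n * exp (- real n * real_of_ereal (gurevich_pressure J B (\<phi> \<circ> proj1))))
          * Z_star J B (\<phi> \<circ> proj1) (i, g) n) < \<infinity>"
    using pos unfolding positive_recurrent_def by blast
  have "J \<noteq> {}" using ig by blast
  then obtain p where p: "gurevich_pressure J B (\<phi> \<circ> proj1) = ereal p"
    using ext.pressure_eq_real[OF assms(2)] rec unfolding recurrent_def by blast
  interpret weighted_word_monoid G "loops I A i" "normalised_weight p" val base.distortion
    by (rule loop_monoid[OF assms(1,2) ig(1)]) (simp add: p)
  let ?\<omega> = "\<lambda>n. ennreal (exp (- (real n * p)))"
  let ?c = "\<lambda>n. ennreal (real n * exp (- real n * real_of_ereal (gurevich_pressure J B (\<phi> \<circ> proj1))))"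
  let ?Q = "\<lambda>w. \<forall>k\<in>{1..<length w}. w ! k \<noteq> (i, g)"
  have prime_Q: "?Q (lift G \<Psi> g u)" if u: "u \<in> primes" for u
  proof (intro ballI notI)
    fix k assume k: "k \<in> {1..<length (lift G \<Psi> g u)}" and eq: "lift G \<Psi> g u ! k = (i, g)"
    have ku: "0 < k" "k < length u" using k by (auto simp: length_lift)
    have uE: "u \<in> loops I A i" "val u = \<one>" using u by (auto simp: primes_def fiber_def)
    have sub: "set u \<subseteq> I" by (rule loops_subset[OF uE(1)])
    have nth: "u ! k = i" "g \<otimes> val (take k u) = g"
      using eq lift_nth[OF ku(2) sub ig(2)] by auto
    have tk: "val (take k u) \<in> carrier G" "set (take k u) \<subseteq> I" "set (drop k u) \<subseteq> I"
      using sub set_take_subset[of k u] set_drop_subset[of k u] by (auto intro!: value_closed)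
    have "val (take k u) = \<one>"
      using nth(2) tk ig(2) by simp
    then have "val (drop k u) = \<one>"
      using value_append[OF tk(2,3)] uE(2) value_closed[OF tk(3)] by simp
    moreover have "drop k u \<in> loops I A i"
    proof -
      have "successively A ((take k u @ drop k u) @ [i])"
        using uE ku by (auto simp: loops_def word_path_def)
      then have "successively A (drop k u @ [i])"
        unfolding append_assoc by (simp only: successively_append_iff)
      then show ?thesis
        using ku nth(1) tk(3) by (auto simp: loops_def word_path_def hd_drop_conv_nth)
    qed
    moreover have "u = take k u @ drop k u" "take k u \<noteq> []" "drop k u \<noteq> []"
      using ku by auto
    ultimately show False
      using u unfolding primes_def by blast
  qed
  have "(\<Sum>\<^sub>\<infinity>u\<in>primes. of_nat (length u) * normalised_weight p u) =
      (\<Sum>\<^sub>\<infinity>u\<in>primes. base.W u * (of_nat (length u) * ?\<omega> (length u)))"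
    by (simp add: normalised_weight_def ac_simps)
  also have "\<dots> = (\<Sum>\<^sub>\<infinity>n\<in>UNIV. (of_nat n * ?\<omega> n) * base.Wsum {u\<in>primes. length u = n})"
    by (rule base.Wsum_by_length)
  also have "\<dots> = (\<Sum>\<^sub>\<infinity>n\<in>{1..}. (of_nat n * ?\<omega> n) * base.Wsum {u\<in>primes. length u = n})"
    by (rule infsum_cong_neutral) auto
  also have "\<dots> \<le> (\<Sum>\<^sub>\<infinity>n\<in>{1..}. (base.distortion * ext.distortion) *
      (?c n
          * Z_star J B (\<phi> \<circ> proj1) (i, g) n))"
  proof (rule infsum_ennreal_mono[OF order_refl])
    fix n :: nat assume n: "n \<in> {1..}"
    have "base.Wsum {u\<in>primes. length u = n} \<le>
        base.Wsum {u\<in>loops I A i. val u = \<one> \<and> length u = n \<and> ?Q (lift G \<Psi> g u)}"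
      using prime_Q by (intro base.Wsum_mono) (auto simp: primes_def fiber_def)
    also have "\<dots> \<le> base.distortion * ext.loop_sum (i, g) ?Q n"
      by (rule loop_sum_lift(2)[OF assms(2) ig])
    also have "\<dots> \<le> base.distortion * (ext.distortion * Z_star J B (\<phi> \<circ> proj1) (i, g) n)"
      using n by (intro mult_left_mono ext.Z_star_loop_sum(2)) auto
    finally have "(of_nat n * ?\<omega> n) * base.Wsum {u\<in>primes. length u = n} \<le>
        (of_nat n * ?\<omega> n) * (base.distortion * (ext.distortion * Z_star J B (\<phi> \<circ> proj1) (i, g) n))"
      by (rule mult_left_mono) simp
    moreover have e: "?c n = of_nat n * ?\<omega> n"
      by (simp add: p ennreal_mult ennreal_of_nat_eq_real_of_nat)
    ultimately show "(of_nat n * ?\<omega> n) * base.Wsum {u\<in>primes. length u = n} \<le> (base.distortion * ext.distortion) *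
      (?c n
          * Z_star J B (\<phi> \<circ> proj1) (i, g) n)"
      unfolding e by (simp only: ac_simps)
  qed
  also have "\<dots> < \<infinity>"
    unfolding infsum_ennreal_cmult using star base.distortion_fin ext.distortion_fin
    by (simp add: ennreal_mult_less_top)
  finally have "(\<Sum>\<^sub>\<infinity>u\<in>primes. of_nat (length u) * normalised_weight p u) < \<infinity>" .
  then show ?thesis
    by (rule finite_if_positive_recurrent[rotated])
      (simp add: gsum_def fiber_def Green_infinite[OF assms(1,2) ig(1) rec p])
qed

text \<open>A connecting word behind the letter \<open>(i, g)\<close> starts with the group element \<open>g \<otimes> \<Psi> [i]\<close>, which
  determines \<open>g\<close>.\<close>

theorem finite_if_extension_primitive:
  assumes fp: "finitely_primitive J B" and "I \<noteq> {}"
  shows "finite (carrier G)"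
proof -
  obtain i where i: "i \<in> I" using assms(2) by auto
  obtain l \<Lambda> where l: "l \<ge> 1" "finite \<Lambda>" "\<Lambda> \<subseteq> words J B l"
    and conn: "\<And>x y. x \<in> J \<Longrightarrow> y \<in> J \<Longrightarrow> \<exists>w\<in>\<Lambda>. x # w @ [y] \<in> all_words J B"
    using fp unfolding finitely_primitive_def by blast
  have "carrier G \<subseteq> (\<lambda>w. snd (hd w) \<otimes> inv \<Psi> [i]) ` \<Lambda>"
  proof
    fix g assume g: "g \<in> carrier G"
    then obtain w where w: "w \<in> \<Lambda>" "(i, g) # w @ [(i, g)] \<in> all_words J B"
      using conn[of "(i, g)" "(i, g)"] i by auto
    then have "w \<noteq> []" using l by (auto simp: words_def)
    then obtain y w' where y: "w = y # w'" by (cases w) auto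
    then have "B (i, g) y"
      using w(2) by (auto simp: all_words_def words_def)
    then have "snd (hd w) = g \<otimes> \<Psi> [i]"
      unfolding y by (cases y) (auto simp: extension_matrix_def)
    then have "g = snd (hd w) \<otimes> inv \<Psi> [i]"
      using g letter_closed[OF i] by (simp add: m_assoc)
    then show "g \<in> (\<lambda>w. snd (hd w) \<otimes> inv \<Psi> [i]) ` \<Lambda>"
      using w(1) by (rule image_eqI)
  qed
  then show ?thesis
    using l(2) by (meson finite_imageI finite_subset)
qed

text \<open>Connecting words of the base are lifted, starting from the first letter and ending before the last
  one. Between them there are finitely many pairs of letters to join, so mixing provides joining words
  of a common length.\<close>

theorem extension_primitive_if_finite:
  assumes fp: "finitely_primitive I A" and fin: "finite (carrier G)" and mix: "topologically_mixing J B"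
  shows "finitely_primitive J B"
proof -
  obtain l \<Lambda> where l: "l \<ge> 1" "finite \<Lambda>" "\<Lambda> \<subseteq> words I A l"
    and conn: "\<And>i j. i \<in> I \<Longrightarrow> j \<in> I \<Longrightarrow> \<exists>w\<in>\<Lambda>. i # w @ [j] \<in> all_words I A"
    using fp unfolding finitely_primitive_def by blast
  define F where "F = (\<Union>w\<in>\<Lambda>. set w) \<times> carrier G"
  have F: "finite F" "F \<subseteq> J"
    using l fin by (auto simp: F_def words_def)
  have "\<forall>x\<in>F. \<forall>y\<in>F. \<exists>n0. \<forall>n\<ge>n0. \<exists>w\<in>words J B n. x # w @ [y] \<in> all_words J B"
    using mix F(2) unfolding topologically_mixing_def by blast
  then obtain n0 where n0: "\<And>x y n. x \<in> F \<Longrightarrow> y \<in> F \<Longrightarrow> n \<ge> n0 x y \<Longrightarrow>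
      \<exists>w\<in>words J B n. x # w @ [y] \<in> all_words J B"
    by metis
  define N where "N = (\<Sum>(x, y)\<in>F \<times> F. n0 x y) + 1"
  have "\<exists>w\<in>words J B N. x # w @ [y] \<in> all_words J B" if "x \<in> F" "y \<in> F" for x y
  proof (rule n0[OF that])
    have "n0 x y \<le> (\<Sum>(x, y)\<in>F \<times> F. n0 x y)"
      using member_le_sum[of "(x, y)" "F \<times> F" "\<lambda>(x, y). n0 x y"] that F by simp
    then show "n0 x y \<le> N" by (simp add: N_def)
  qed
  then obtain c where c: "\<And>x y. x \<in> F \<Longrightarrow> y \<in> F \<Longrightarrow> c x y \<in> words J B N \<and> x # c x y @ [y] \<in> all_words J B"
    by metis
  define F' where "F' = F \<union> (\<Union>(x, y)\<in>F \<times> F. set (c x y))"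
  have "set (c x y) \<subseteq> J" if "x \<in> F" "y \<in> F" for x y
    using c[OF that] unfolding words_def by blast
  then have F': "finite F'" "F' \<subseteq> J"
    unfolding F'_def using F by (simp, blast)
  define M where "M = l + N + l"
  define \<Lambda>' where "\<Lambda>' = {w\<in>words J B M. set w \<subseteq> F'}"
  have "finite \<Lambda>'"
    by (rule finite_subset[OF _ finite_lists_length_eq[OF F'(1), of M]]) (auto simp: \<Lambda>'_def words_def)
  moreover have "\<exists>w\<in>\<Lambda>'. x # w @ [y] \<in> all_words J B" if xy: "x \<in> J" "y \<in> J" for x y
  proof -
    obtain i g where x: "x = (i, g)" "i \<in> I" "g \<in> carrier G" using xy by auto
    obtain j h where y: "y = (j, h)" "j \<in> I" "h \<in> carrier G" using xy by auto
    obtain q1 where q1: "q1 \<in> \<Lambda>" "i # q1 @ [i] \<in> all_words I A" using conn[OF x(2,2)] by blast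
    obtain q2 where q2: "q2 \<in> \<Lambda>" "j # q2 @ [j] \<in> all_words I A" using conn[OF y(2,2)] by blast
    have len: "length q1 = l" "set q1 \<subseteq> I" "q1 \<noteq> []" "length q2 = l" "set q2 \<subseteq> I" "q2 \<noteq> []"
      using q1 q2 l by (auto simp: words_def)
    define g2 where "g2 = h \<otimes> inv (val q2)"
    have g2: "g2 \<in> carrier G" "h = g2 \<otimes> val q2"
      using y value_closed[OF len(5)] by (auto simp: g2_def m_assoc)
    define v1 where "v1 = lift G \<Psi> (g \<otimes> \<Psi> [i]) q1"
    define v2 where "v2 = lift G \<Psi> g2 q2"
    have ne: "v1 \<noteq> []" "v2 \<noteq> []"
      using len by (auto simp: v1_def v2_def lift_eq_Nil)
    have g1: "g \<otimes> \<Psi> [i] \<in> carrier G" using x letter_closed by simp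
    have fst_v: "map fst v1 = q1" "map fst v2 = q2"
      by (simp_all add: v1_def v2_def map_fst_lift)
    have "successively A ((i # q1) @ [i])"
      using q1 by (simp add: all_words_def words_def)
    then have s1: "successively B ((x # v1) @ [(i, g \<otimes> val (i # q1))])"
      using successively_lift[of "i # q1" g i "g \<otimes> val (i # q1)"] x len by (simp add: v1_def)
    then have s1: "successively B (x # v1)"
      by (simp only: successively_append_iff)
    have "successively A (q2 @ [j])"
      using q2 by (auto simp: all_words_def words_def successively_Cons split: if_splits)
    then have s2: "successively B (v2 @ [y])"
      using successively_lift[of q2 g2 j h] g2 len y by (simp add: v2_def)
    have vJ: "set v1 \<subseteq> J" "set v2 \<subseteq> J"
      using successively_lift[OF len(2) g1] successively_lift[OF len(5) g2(1)] by (auto simp: v1_def v2_def)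
    have inF: "set v \<subseteq> F" if "map fst v \<in> \<Lambda>" "set v \<subseteq> J" for v
    proof
      fix z assume z: "z \<in> set v"
      then have "fst z \<in> set (map fst v)" by auto
      then have "fst z \<in> (\<Union>w\<in>\<Lambda>. set w)"
        using that(1) by blast
      then show "z \<in> F"
        using that(2) z by (auto simp: F_def mem_Times_iff)
    qed
    have v1F: "set v1 \<subseteq> F" using vJ q1 fst_v by (intro inF) auto
    have v2F: "set v2 \<subseteq> F" using vJ q2 fst_v by (intro inF) auto
    define m where "m = c (last v1) (hd v2)"
    have lh: "last v1 \<in> F" "hd v2 \<in> F"
      using v1F v2F ne last_in_set hd_in_set by blast+
    have m: "m \<in> words J B N" "last v1 # m @ [hd v2] \<in> all_words J B"
      using c[OF lh] by (auto simp: m_def)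
    have "m \<noteq> []" using m(1) by (auto simp: words_def N_def)
    have "successively B ((x # v1) @ m @ (v2 @ [y]))"
    proof (rule successively_insert[OF s1 _ s2 _ \<open>m \<noteq> []\<close>])
      show "successively B (last (x # v1) # m @ [hd (v2 @ [y])])"
        using m(2) ne by (simp add: all_words_def words_def)
    qed simp_all
    then have s: "successively B (x # (v1 @ m @ v2) @ [y])" by simp
    then have "successively B ([x] @ (v1 @ m @ v2) @ [y])" by simp
    then have s': "successively B (v1 @ m @ v2)"
      by (simp only: successively_append_iff)
    have mF: "set m \<subseteq> F'"
      using lh by (auto simp: F'_def m_def)
    have all: "set (v1 @ m @ v2) \<subseteq> F'"
      using v1F v2F mF by (auto simp: F'_def)
    have lenM: "length (v1 @ m @ v2) = M"
      using len m(1) by (simp add: v1_def v2_def length_lift words_def M_def)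
    have "v1 @ m @ v2 \<in> \<Lambda>'"
      using all lenM s' F'(2) unfolding \<Lambda>'_def words_def by auto
    moreover have "x # (v1 @ m @ v2) @ [y] \<in> all_words J B"
      using s all F'(2) xy unfolding all_words_def words_def by auto
    ultimately show ?thesis by blast
  qed
  moreover have "M \<ge> 1" using l by (simp add: M_def)
  moreover have "\<Lambda>' \<subseteq> words J B M" by (auto simp: \<Lambda>'_def)
  ultimately show ?thesis
    unfolding finitely_primitive_def by (intro exI[of _ M] conjI exI[of _ \<Lambda>']) auto
qed

end

theorem corollary1p2:
  fixes I :: "nat set" and A :: "nat \<Rightarrow> nat \<Rightarrow> bool"
    and G :: "('g, 'b) monoid_scheme" and \<Psi> :: "nat list \<Rightarrow> 'g"
    and \<phi> :: "(nat \<Rightarrow> nat) \<Rightarrow> real"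
  assumes "I \<noteq> {}"
    and "finitely_primitive I A"
    and "group G" and "countable (carrier G)"
    and "\<Psi> \<in> semigroup_hom I G"
    and "topologically_mixing (I \<times> carrier G) (extension_matrix A G \<Psi>)"
    and "hoelder_continuous I A \<phi>"
    and "gurevich_pressure (I \<times> carrier G) (extension_matrix A G \<Psi>) (\<phi> \<circ> proj1) < \<infinity>"
  shows "(recurrent (I \<times> carrier G) (extension_matrix A G \<Psi>) (\<phi> \<circ> proj1) \<longrightarrow> amenable G) \<and>
    (positive_recurrent (I \<times> carrier G) (extension_matrix A G \<Psi>) (\<phi> \<circ> proj1)
       \<longleftrightarrow> finite (carrier G)) \<and>
    (finite (carrier G)
       \<longleftrightarrow> finitely_primitive (I \<times> carrier G) (extension_matrix A G \<Psi>))"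
proof -
  interpret group G by fact
  interpret group_extension G I A \<Psi> \<phi>
    using assms(5,7) by unfold_locales
  have irr_base: "irreducible I A"
    by (rule irreducible_if_primitive) fact
  have irr: "irreducible J B"
    by (rule irreducible_if_mixing) fact
  have J: "J \<noteq> {}"
    using \<open>I \<noteq> {}\<close> one_closed by blast
  have "amenable G" if "recurrent J B (\<phi> \<circ> proj1)"
    by (rule recurrent_amenable[OF irr_base irr \<open>I \<noteq> {}\<close> that])
  moreover have "finite (carrier G)" if "positive_recurrent J B (\<phi> \<circ> proj1)"
    by (rule positive_recurrent_finite[OF irr_base irr that])
  moreover have primitive: "finitely_primitive J B" if "finite (carrier G)"
    by (rule extension_primitive_if_finite) (fact that assms)+
  moreover have "finite (carrier G)" if "finitely_primitive J B"
    by (rule finite_if_extension_primitive[OF that \<open>I \<noteq> {}\<close>])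
  moreover have "positive_recurrent J B (\<phi> \<circ> proj1)" if "finite (carrier G)"
    by (rule ext.finitely_primitive_positive_recurrent[OF primitive[OF that] J]) fact
  ultimately show ?thesis by blast
qed

end
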